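(* Consider the algebraic system of the MSMFE-0 method with matrices $(A_{\sigma\sigma})_{ij}=(A\tau_j,\tau_i)_Q$, $(A_{\sigma u})_{ij}=(\operatorname{div}\tau_j,v_i)$, $(A_{\sigma\gamma})_{ij}=(\tau_j,w_i)$, where $\{\tau_j\}$ is the basis of $\mathbb{X}_h$ dual to the vertex degrees of freedom, and $\{v_i\}$, $\{w_i\}$ are bases of $V_h$ and $\mathbb{W}_h^0$. Then $A_{\sigma\sigma}$ is block-diagonal with blocks associated with the mesh vertices (of size $36\times36$ for an interior vertex), each block being symmetric and positive definite; and the matrix of the cell-centered displacement-rotation system obtained by eliminating the stress, $$\begin{pmatrix} A_{\sigma u}A_{\sigma\sigma}^{-1}A_{\sigma u}^T & A_{\sigma u}A_{\sigma\sigma}^{-1}A_{\sigma\gamma}^T\\ A_{\sigma\gamma}A_{\sigma\sigma}^{-1}A_{\sigma u}^T & A_{\sigma\gamma}A_{\sigma\sigma}^{-1}A_{\sigma\gamma}^T\end{pmatrix},$$ is symmetric and positive definite.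
   Context: **Setting.** $\Omega\subset\mathbb{R}^3$ is a simply connected bounded domain, $\partial\Omega=\Gamma_D\cup\Gamma_N$ with $\Gamma_D\neq\emptyset$. $\mathbb{M}$ and $\mathbb{N}$ denote the real $3\times3$ matrices and the skew-symmetric $3\times 3$ matrices. $\operatorname{div}$ and $\operatorname{curl}$ act row-wise on matrix fields. $(\cdot,\cdot)$, $\|\cdot\|$ are the $L^2(\Omega)$ inner product and norm ($:$ is the Frobenius product). The compliance tensor $A=A(\mathbf{x})$ is a symmetric, bounded, uniformly positive definite linear operator $\mathbb{M}\to\mathbb{M}$, element-wise continuous on the mesh below. **Mesh.** $\mathcal{T}_h$ is a shape-regular, conforming (face-to-face) partition of $\Omega$ into cuboids (rectangular boxes); $\Gamma_D$ and $\Gamma_N$ are unions of element faces. $\hat E=[0,1]^3$ is the reference cube with vertices $\hat{\mathbf r}_1=(0,0,0)$, $\hat{\mathbf r}_2=(1,0,0)$, $\hat{\mathbf r}_3=(1,1,0)$, $\hat{\mathbf r}_4=(0,1,0)$, $\hat{\mathbf r}_5=(0,0,1)$, $\hat{\mathbf r}_6=(1,0,1)$, $\hat{\mathbf r}_7=(1,1,1)$, $\hat{\mathbf r}_8=(0,1,1)$. For an element $E$ with corresponding vertices $\mathbf r_1,\dots,\mathbf r_8$, $F_E:\hat E\to E$ is the affine bijection $F_E(\hat{\mathbf{x}})=\mathbf r_1+(\mathbf r_2-\mathbf r_1)\hat x+(\mathbf r_4-\mathbf r_1)\hat y+(\mathbf r_5-\mathbf r_1)\hat z$, with Jacobian matrix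 $DF_E$ and $J_E=|\det DF_E|$. **Enhanced Raviart-Thomas space.** $\mathcal{RT}_0(\hat E)=\{(\alpha_1+\beta_1\hat x,\alpha_2+\beta_2\hat y,\alpha_3+\beta_3\hat z)^T:\alpha_i,\beta_i\in\mathbb{R}\}$. $\mathcal B(\hat E)$ is the span of the vectors $(b,0,0)^T$ with $b\in\{\hat y,\hat z,\hat x\hat y,\hat x\hat z,\hat y\hat z,\hat x\hat y\hat z\}$, $(0,b,0)^T$ with $b\in\{\hat x,\hat z,\hat x\hat y,\hat x\hat z,\hat y\hat z,\hat x\hat y\hat z\}$, and $(0,0,b)^T$ with $b\in\{\hat x,\hat y,\hat x\hat y,\hat x\hat z,\hat y\hat z,\hat x\hat y\hat z\}$. Then $\mathcal{ERT}_0(\hat E)=\mathcal{RT}_0(\hat E)+\operatorname{curl}(\hat{\mathbf x}\times\mathcal B(\hat E))$, where $\hat{\mathbf x}=(\hat x,\hat y,\hat z)^T$ and $\times$ is the cross product. The degrees of freedom of $\mathcal{ERT}_0(\hat E)$ are the values of the normal component at the four vertices of each of the six faces. **Discrete spaces.** $\mathbb{X}_h$ is the set of $\tau\in L^2(\Omega,\mathbb{M})$ with $\operatorname{div}\tau\in L^2(\Omega,\mathbb{R}^3)$, $\tau n=0$ on $\Gamma_N$, such that on each $E$, $\tau^T=\frac1{J_E}DF_E\,\hat\tau^T\circ F_E^{-1}$ for some $\hat\tau$ whose three rows belong to $\mathcal{ERT}_0(\hat E)$ (row-wise Piola transform). Its degrees of freedom are the values of the three components of $\tau n_f$ at the four vertices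 of each mesh face $f$ not on $\Gamma_N$; each degree of freedom is associated with the vertex at which it is evaluated. $V_h$ is the space of $\mathbb{R}^3$-valued functions constant on each element. $\mathbb{W}_h^0$ is the space of $\mathbb{N}$-valued functions constant on each element. **Vertex quadrature.** $(A\tau,\chi)_Q=\sum_{E\in\mathcal{T}_h}\frac{|E|}{8}\sum_{i=1}^8 A(\mathbf r_i)\tau(\mathbf r_i):\chi(\mathbf r_i)$, where for each $E$ the $\mathbf r_i$ are its vertices and all values are taken from within $E$. **MSMFE-0 method.** Find $(\sigma_h,u_h,\gamma_h)\in \mathbb{X}_h\times V_h\times \mathbb{W}_h^0$ with $(A\sigma_h,\tau)_Q+(u_h,\operatorname{div}\tau)+(\gamma_h,\tau)=0$ for all $\tau\in\mathbb{X}_h$, $(\operatorname{div}\sigma_h,v)=(f,v)$ for all $v\in V_h$, and $(\sigma_h,w)=0$ for all $w\in\mathbb{W}_h^0$. *)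

theory Defs
  imports "HOL-Analysis.Analysis"
begin

section \<open>Square integrable fields and the weak row-wise divergence\<close>

type_synonym vec3 = "real^3"
type_synonym mat3 = "real^3^3"

text \<open>On \<^typ>\<open>mat3\<close> the library's inner product and norm are the Frobenius ones.
  Elements of \<open>L\<^sup>2\<close> are represented by functions on the whole space; only their values almost
  everywhere in \<open>\<Omega>\<close> matter.\<close>

definition in_L2 :: "vec3 set \<Rightarrow> (vec3 \<Rightarrow> 'b::euclidean_space) \<Rightarrow> bool" where
  "in_L2 \<Omega> u \<longleftrightarrow> u \<in> borel_measurable (lebesgue_on \<Omega>)
                 \<and> integrable (lebesgue_on \<Omega>) (\<lambda>x. (norm (u x))\<^sup>2)"

definition L2_inner :: "vec3 set \<Rightarrow> (vec3 \<Rightarrow> 'b::euclidean_space) \<Rightarrow> (vec3 \<Rightarrow> 'b) \<Rightarrow> real" where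
  "L2_inner \<Omega> u v = (LINT x|lebesgue_on \<Omega>. u x \<bullet> v x)"

text \<open>\<open>\<phi>\<close> is a continuously differentiable function with gradient \<open>g\<close> and compact support
  in \<open>\<Omega>\<close>.\<close>

definition test_function :: "vec3 set \<Rightarrow> (vec3 \<Rightarrow> real) \<Rightarrow> (vec3 \<Rightarrow> vec3) \<Rightarrow> bool" where
  "test_function \<Omega> \<phi> g \<longleftrightarrow>
     (\<forall>x. GDERIV \<phi> x :> g x) \<and> continuous_on UNIV g \<and>
     compact (closure {x. \<phi> x \<noteq> 0}) \<and> closure {x. \<phi> x \<noteq> 0} \<subseteq> \<Omega>"

definition weak_div :: "vec3 set \<Rightarrow> (vec3 \<Rightarrow> mat3) \<Rightarrow> (vec3 \<Rightarrow> vec3) \<Rightarrow> bool" where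
  "weak_div \<Omega> \<tau> d \<longleftrightarrow> (\<forall>\<phi> g. test_function \<Omega> \<phi> g \<longrightarrow>
     (\<forall>k. (LINT x|lebesgue_on \<Omega>. (\<tau> x $ k) \<bullet> g x) = - (LINT x|lebesgue_on \<Omega>. (d x $ k) * \<phi> x)))"

definition in_Hdiv :: "vec3 set \<Rightarrow> (vec3 \<Rightarrow> mat3) \<Rightarrow> bool" where
  "in_Hdiv \<Omega> \<tau> \<longleftrightarrow> in_L2 \<Omega> \<tau> \<and> (\<exists>d. in_L2 \<Omega> d \<and> weak_div \<Omega> \<tau> d)"

text \<open>Determined up to equality almost everywhere in \<open>\<Omega>\<close>.\<close>

definition divergence :: "vec3 set \<Rightarrow> (vec3 \<Rightarrow> mat3) \<Rightarrow> vec3 \<Rightarrow> vec3" where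
  "divergence \<Omega> \<tau> = (SOME d. in_L2 \<Omega> d \<and> weak_div \<Omega> \<tau> d)"

text \<open>A finite basis of a subspace \<open>S\<close> of \<open>L\<^sup>2(\<Omega>)\<close>, functions being identified when they agree
  almost everywhere.\<close>

definition L2_basis :: "vec3 set \<Rightarrow> (vec3 \<Rightarrow> 'b::euclidean_space) set \<Rightarrow> ('i::finite \<Rightarrow> vec3 \<Rightarrow> 'b) \<Rightarrow> bool" where
  "L2_basis \<Omega> S b \<longleftrightarrow> (\<forall>i. b i \<in> S) \<and>
     (\<forall>s\<in>S. \<exists>!c::'i \<Rightarrow> real. AE x in lebesgue_on \<Omega>. s x = (\<Sum>i\<in>UNIV. c i *\<^sub>R b i x))"

section \<open>Cuboid meshes\<close>

definition ref_vertex :: "nat \<Rightarrow> vec3" where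
  "ref_vertex i =
     [vector [0,0,0], vector [1,0,0], vector [1,1,0], vector [0,1,0],
      vector [0,0,1], vector [1,0,1], vector [1,1,1], vector [0,1,1]] ! (i - 1)"

definition ref_cube :: "vec3 set" where
  "ref_cube = {x. \<forall>i. 0 \<le> x $ i \<and> x $ i \<le> 1}"

text \<open>In the following \<open>r 1, \<dots>, r 8\<close> are the vertices of an element, numbered as those of the
  reference cube.\<close>

definition elem_map :: "(nat \<Rightarrow> vec3) \<Rightarrow> vec3 \<Rightarrow> vec3" where
  "elem_map r x = r 1 + (x $ 1) *\<^sub>R (r 2 - r 1) + (x $ 2) *\<^sub>R (r 4 - r 1) + (x $ 3) *\<^sub>R (r 5 - r 1)"

definition elem_jac :: "(nat \<Rightarrow> vec3) \<Rightarrow> mat3" where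
  "elem_jac r = transpose (vector [r 2 - r 1, r 4 - r 1, r 5 - r 1])"

definition cuboid :: "vec3 set \<Rightarrow> (nat \<Rightarrow> vec3) \<Rightarrow> bool" where
  "cuboid E r \<longleftrightarrow>
     r 2 \<noteq> r 1 \<and> r 4 \<noteq> r 1 \<and> r 5 \<noteq> r 1 \<and>
     orthogonal (r 2 - r 1) (r 4 - r 1) \<and>
     orthogonal (r 2 - r 1) (r 5 - r 1) \<and>
     orthogonal (r 4 - r 1) (r 5 - r 1) \<and>
     (\<forall>i\<in>{1..8}. r i = elem_map r (ref_vertex i)) \<and>
     E = elem_map r ` ref_cube"

text \<open>\<open>T\<close> is the set of (closed) elements and \<open>r E\<close> numbers the vertices of \<open>E\<close>. The condition
  \<open>interior (\<Union>T) = \<Omega>\<close> says that \<open>\<Omega>\<close> lies on one side of its boundary (no slits).\<close>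

definition conforming_cuboid_mesh :: "vec3 set \<Rightarrow> vec3 set set \<Rightarrow> (vec3 set \<Rightarrow> nat \<Rightarrow> vec3) \<Rightarrow> bool" where
  "conforming_cuboid_mesh \<Omega> T r \<longleftrightarrow>
     finite T \<and> \<Union>T = closure \<Omega> \<and> interior (\<Union>T) = \<Omega> \<and>
     (\<forall>E\<in>T. cuboid E (r E)) \<and>
     (\<forall>E\<in>T. \<forall>E'\<in>T. (E \<inter> E') face_of E \<and> (E \<inter> E') face_of E')"

definition shape_regular :: "real \<Rightarrow> vec3 set set \<Rightarrow> bool" where
  "shape_regular \<kappa> T \<longleftrightarrow> (\<forall>E\<in>T. \<exists>c \<rho>. \<rho> > 0 \<and> cball c \<rho> \<subseteq> E \<and> diameter E \<le> \<kappa> * \<rho>)"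

definition mesh_faces :: "vec3 set set \<Rightarrow> vec3 set set" where
  "mesh_faces T = {f. \<exists>E\<in>T. f facet_of E}"

definition mesh_vertices :: "vec3 set set \<Rightarrow> (vec3 set \<Rightarrow> nat \<Rightarrow> vec3) \<Rightarrow> vec3 set" where
  "mesh_vertices T r = {r E i | E i. E \<in> T \<and> i \<in> {1..8}}"

definition unit_normals :: "vec3 set set \<Rightarrow> (vec3 set \<Rightarrow> vec3) \<Rightarrow> bool" where
  "unit_normals T \<nu> \<longleftrightarrow> (\<forall>f\<in>mesh_faces T. norm (\<nu> f) = 1 \<and> (\<forall>x\<in>f. \<forall>y\<in>f. \<nu> f \<bullet> (x - y) = 0))"

text \<open>\<open>\<partial>\<Omega> = \<Gamma>\<^sub>D \<union> \<Gamma>\<^sub>N\<close>, both unions of closed element faces that overlap in no whole face.\<close>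

definition boundary_partition :: "vec3 set \<Rightarrow> vec3 set set \<Rightarrow> vec3 set \<Rightarrow> vec3 set \<Rightarrow> bool" where
  "boundary_partition \<Omega> T \<Gamma>D \<Gamma>N \<longleftrightarrow>
     frontier \<Omega> = \<Gamma>D \<union> \<Gamma>N \<and>
     (\<exists>F \<subseteq> mesh_faces T. \<Gamma>D = \<Union>F) \<and> (\<exists>F \<subseteq> mesh_faces T. \<Gamma>N = \<Union>F) \<and>
     (\<forall>f\<in>mesh_faces T. \<not> (f \<subseteq> \<Gamma>D \<and> f \<subseteq> \<Gamma>N))"

text \<open>The value at a point \<open>x\<close> of the closed element \<open>E\<close> of an element-wise continuous function,
  taken from within \<open>E\<close>.\<close>

definition elem_val :: "vec3 set \<Rightarrow> (vec3 \<Rightarrow> 'b::t2_space) \<Rightarrow> vec3 \<Rightarrow> 'b" where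
  "elem_val E g x = Lim (at x within interior E) g"

section \<open>The enhanced Raviart-Thomas space on the reference cube\<close>

definition partial :: "3 \<Rightarrow> (vec3 \<Rightarrow> real) \<Rightarrow> vec3 \<Rightarrow> real" where
  "partial j g x = frechet_derivative g (at x) (axis j 1)"

definition curl :: "(vec3 \<Rightarrow> vec3) \<Rightarrow> vec3 \<Rightarrow> vec3" where
  "curl q x = vector
     [partial 2 (\<lambda>y. q y $ 3) x - partial 3 (\<lambda>y. q y $ 2) x,
      partial 3 (\<lambda>y. q y $ 1) x - partial 1 (\<lambda>y. q y $ 3) x,
      partial 1 (\<lambda>y. q y $ 2) x - partial 2 (\<lambda>y. q y $ 1) x]"

definition RT0 :: "(vec3 \<Rightarrow> vec3) set" where
  "RT0 = {\<lambda>x. vector [\<alpha> $ 1 + \<beta> $ 1 * x $ 1, \<alpha> $ 2 + \<beta> $ 2 * x $ 2, \<alpha> $ 3 + \<beta> $ 3 * x $ 3]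
          | (\<alpha> :: vec3) (\<beta> :: vec3). True}"

definition B_generators :: "vec3 \<Rightarrow> vec3 list" where
  "B_generators x =
    (let b1 = x $ 1; b2 = x $ 2; b3 = x $ 3 in
     [vector [b2, 0, 0], vector [b3, 0, 0], vector [b1*b2, 0, 0],
      vector [b1*b3, 0, 0], vector [b2*b3, 0, 0], vector [b1*b2*b3, 0, 0],
      vector [0, b1, 0], vector [0, b3, 0], vector [0, b1*b2, 0],
      vector [0, b1*b3, 0], vector [0, b2*b3, 0], vector [0, b1*b2*b3, 0],
      vector [0, 0, b1], vector [0, 0, b2], vector [0, 0, b1*b2],
      vector [0, 0, b1*b3], vector [0, 0, b2*b3], vector [0, 0, b1*b2*b3]])"

definition B_space :: "(vec3 \<Rightarrow> vec3) set" where
  "B_space = {\<lambda>x. \<Sum>i<18. c i *\<^sub>R (B_generators x ! i) | c :: nat \<Rightarrow> real. True}"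

definition ERT0 :: "(vec3 \<Rightarrow> vec3) set" where
  "ERT0 = {\<lambda>x. p x + curl (\<lambda>y. cross3 y (b y)) x | p b. p \<in> RT0 \<and> b \<in> B_space}"

section \<open>The discrete spaces\<close>

definition X_space ::
  "vec3 set \<Rightarrow> vec3 set set \<Rightarrow> (vec3 set \<Rightarrow> nat \<Rightarrow> vec3) \<Rightarrow> (vec3 set \<Rightarrow> vec3) \<Rightarrow> vec3 set \<Rightarrow> (vec3 \<Rightarrow> mat3) set" where
  "X_space \<Omega> T r \<nu> \<Gamma>N = {\<tau>. in_Hdiv \<Omega> \<tau> \<and>
     (\<forall>E\<in>T. \<exists>\<tau>'. (\<forall>k. (\<lambda>x. \<tau>' x $ k) \<in> ERT0) \<and>
        (\<forall>x\<in>interior E. transpose (\<tau> x) =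
           (1 / \<bar>det (elem_jac (r E))\<bar>) *\<^sub>R
             (elem_jac (r E) ** transpose (\<tau>' (inv (elem_map (r E)) x))))) \<and>
     (\<forall>E\<in>T. \<forall>f. f facet_of E \<and> f \<subseteq> \<Gamma>N \<longrightarrow> (\<forall>x\<in>f. elem_val E \<tau> x *v \<nu> f = 0))}"

definition V_space :: "vec3 set set \<Rightarrow> (vec3 \<Rightarrow> vec3) set" where
  "V_space T = {v. \<forall>E\<in>T. \<exists>c. \<forall>x\<in>interior E. v x = c}"

definition W_space :: "vec3 set set \<Rightarrow> (vec3 \<Rightarrow> mat3) set" where
  "W_space T = {w. \<forall>E\<in>T. \<exists>S. transpose S = - S \<and> (\<forall>x\<in>interior E. w x = S)}"

text \<open>The degree of freedom \<open>(f, p, k)\<close> is the \<open>k\<close>-th component of \<open>\<tau> n\<^sub>f\<close> at the vertex \<open>p\<close> of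
  the face \<open>f\<close>.\<close>

type_synonym dof = "vec3 set \<times> vec3 \<times> 3"

definition dofs :: "vec3 set set \<Rightarrow> vec3 set \<Rightarrow> dof set" where
  "dofs T \<Gamma>N = {(f, p, k). f \<in> mesh_faces T \<and> \<not> f \<subseteq> \<Gamma>N \<and> p extreme_point_of f}"

definition dof_face :: "dof \<Rightarrow> vec3 set" where "dof_face = (\<lambda>(f, p, k). f)"
definition dof_vertex :: "dof \<Rightarrow> vec3" where "dof_vertex = (\<lambda>(f, p, k). p)"

definition dof_val :: "(vec3 set \<Rightarrow> vec3) \<Rightarrow> vec3 set \<Rightarrow> dof \<Rightarrow> (vec3 \<Rightarrow> mat3) \<Rightarrow> real" where
  "dof_val \<nu> E = (\<lambda>(f, p, k) \<tau>. (elem_val E \<tau> p *v \<nu> f) $ k)"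

text \<open>Fields in \<open>X\<^sub>h\<close> have the same normal trace on \<open>f\<close> from both sides, so the element from which
  a degree of freedom is evaluated is immaterial.\<close>

definition dual_to_dofs ::
  "vec3 set set \<Rightarrow> (vec3 set \<Rightarrow> vec3) \<Rightarrow> ('j \<Rightarrow> dof) \<Rightarrow> ('j \<Rightarrow> vec3 \<Rightarrow> mat3) \<Rightarrow> bool" where
  "dual_to_dofs T \<nu> d \<tau> \<longleftrightarrow>
     (\<forall>i j. \<forall>E\<in>T. dof_face (d i) facet_of E \<longrightarrow> dof_val \<nu> E (d i) (\<tau> j) = (if i = j then 1 else 0))"

section \<open>Compliance tensor, vertex quadrature and matrices\<close>

definition compliance_tensor :: "vec3 set \<Rightarrow> vec3 set set \<Rightarrow> (vec3 \<Rightarrow> mat3 \<Rightarrow>\<^sub>L mat3) \<Rightarrow> bool" where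
  "compliance_tensor \<Omega> T A \<longleftrightarrow>
     (\<forall>x\<in>\<Omega>. \<forall>\<sigma> \<tau>. A x \<sigma> \<bullet> \<tau> = \<sigma> \<bullet> A x \<tau>) \<and>
     bounded (A ` \<Omega>) \<and>
     (\<exists>a>0. \<forall>x\<in>\<Omega>. \<forall>\<tau>. A x \<tau> \<bullet> \<tau> \<ge> a * (\<tau> \<bullet> \<tau>)) \<and>
     (\<forall>E\<in>T. \<exists>A'. continuous_on E A' \<and> (\<forall>x\<in>interior E. A' x = A x))"

definition quad ::
  "vec3 set set \<Rightarrow> (vec3 set \<Rightarrow> nat \<Rightarrow> vec3) \<Rightarrow> (vec3 \<Rightarrow> mat3 \<Rightarrow>\<^sub>L mat3) \<Rightarrow> (vec3 \<Rightarrow> mat3) \<Rightarrow> (vec3 \<Rightarrow> mat3) \<Rightarrow> real" where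
  "quad T r A \<tau> \<theta> = (\<Sum>E\<in>T. measure lebesgue E / 8 *
     (\<Sum>i=1..8. elem_val E A (r E i) (elem_val E \<tau> (r E i)) \<bullet> elem_val E \<theta> (r E i)))"

definition block_matrix ::
  "real^'a^'a \<Rightarrow> real^'b^'a \<Rightarrow> real^'a^'b \<Rightarrow> real^'b^'b \<Rightarrow> real^('a::finite + 'b::finite)^('a + 'b)" where
  "block_matrix P Q R S = (\<chi> i j. case i of
       Inl a \<Rightarrow> (case j of Inl a' \<Rightarrow> P $ a $ a' | Inr b' \<Rightarrow> Q $ a $ b')
     | Inr b \<Rightarrow> (case j of Inl a' \<Rightarrow> R $ b $ a' | Inr b' \<Rightarrow> S $ b $ b'))"

text \<open>The principal submatrix of \<open>M\<close> with rows and columns in \<open>I\<close> is symmetric positive definite.\<close>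

definition sym_pos_def_on :: "'n set \<Rightarrow> real^'n::finite^'n \<Rightarrow> bool" where
  "sym_pos_def_on I M \<longleftrightarrow>
     (\<forall>i\<in>I. \<forall>j\<in>I. M $ i $ j = M $ j $ i) \<and>
     (\<forall>x::real^'n. (\<exists>i\<in>I. x $ i \<noteq> 0) \<longrightarrow> (\<Sum>i\<in>I. \<Sum>j\<in>I. x $ i * M $ i $ j * x $ j) > 0)"

end

theory Submission
  imports Defs
begin

text \<open>A field in \<open>X\<^sub>h\<close> whose normal components at a vertex of an element vanish on the three facets
  through that vertex vanishes there, so the vertex quadrature couples only degrees of freedom
  of one vertex, and the quadratic form of \<open>A\<^bsub>\<sigma>\<sigma>\<^esub>\<close> is a sum of positive terms. An interior vertex
  lies in 8 elements, because each of them fills an octant of a small ball; each has 3 facets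
  through the vertex and each of these belongs to exactly 2 elements, which gives 12 faces and
  36 degrees of freedom.

  For the Schur complement it remains to see that \<open>(u, div \<tau>) + (\<gamma>, \<tau>) = 0\<close> for all \<open>\<tau>\<close> in \<open>X\<^sub>h\<close>
  forces \<open>u = 0\<close> and \<open>\<gamma> = 0\<close>. On an element with centre \<open>c\<close>, integration by parts turns this form
  into the pairing of the normal trace of \<open>\<tau>\<close> with the rigid motion \<open>u + \<gamma> (x - c)\<close>. Testing with
  the four vertex functions of a face shows that the rigid motion of an element vanishes if the
  one on the other side of the face does, or if the face is a Dirichlet face. As the elements are
  connected through facets, all rigid motions vanish.\<close>

section \<open>Schur complements of positive definite matrices\<close>

text \<open>The obstacle is the integration by parts on an element: the divergence of a stress field
  is merely some square integrable function, fixed by testing with functions supported in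
  \<open>\<Omega>\<close>, and facets are null sets for it. As displacement and rotation are
  constant on an element, only two integrals matter there, that of the divergence and that of the
  field. The first is found by testing with cutoff functions that tend to 1 on the interior of the
  element, the second by integrating the polynomials of \<open>ERT0\<close> explicitly. Both are
  fixed linear combinations of normal components at the vertices, whose weights are boundary
  integrals in disguise. On each element that has its face as a facet, a dual basis function keeps
  exactly one of these normal components, so the form reads off the rigid motion at a single point
  of that facet.\<close>

lemma sym_pos_def_on_UNIV_iff:
  fixes M :: "real^'n::finite^'n"
  shows "sym_pos_def_on UNIV M \<longleftrightarrow> transpose M = M \<and> (\<forall>x. x \<noteq> 0 \<longrightarrow> x \<bullet> (M *v x) > 0)"
proof -
  have "(\<Sum>i\<in>UNIV. \<Sum>j\<in>UNIV. x $ i * M $ i $ j * x $ j) = x \<bullet> (M *v x)" for x :: "real^'n"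
    by (simp add: inner_vec_def matrix_vector_mult_def sum_distrib_left mult.assoc)
  moreover have "(\<exists>i. x $ i \<noteq> 0) \<longleftrightarrow> x \<noteq> 0" for x :: "real^'n"
    by (simp add: vec_eq_iff)
  moreover have "(\<forall>i j. M $ i $ j = M $ j $ i) \<longleftrightarrow> transpose M = M"
    by (auto simp: transpose_def vec_eq_iff)
  ultimately show ?thesis
    by (simp add: sym_pos_def_on_def)
qed

lemma sym_pos_def_invertible:
  fixes M :: "real^'n::finite^'n"
  assumes "sym_pos_def_on UNIV M"
  shows "invertible M"
proof -
  have "x = 0" if "M *v x = 0" for x
    using assms that by (auto simp: sym_pos_def_on_UNIV_iff)
  then have "\<exists>B. B ** M = mat 1"
    by (simp add: matrix_left_invertible_ker)
  then show ?thesis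
    using matrix_left_right_inverse by (auto simp: invertible_def)
qed

text \<open>Extension by zero turns the form on \<open>I\<close> into the full form, so every
  diagonal block inherits definiteness.\<close>

lemma sym_pos_def_on_subset:
  fixes M :: "real^'n::finite^'n"
  assumes "sym_pos_def_on UNIV M"
  shows "sym_pos_def_on I M"
  unfolding sym_pos_def_on_def
proof (intro conjI ballI allI impI)
  show "M $ i $ j = M $ j $ i" for i j
    using assms by (auto simp: sym_pos_def_on_def)
  fix x :: "real^'n" assume "\<exists>i\<in>I. x $ i \<noteq> 0"
  define y :: "real^'n" where "y = (\<chi> i. if i \<in> I then x $ i else 0)"
  have "\<exists>i. y $ i \<noteq> 0"
    using \<open>\<exists>i\<in>I. x $ i \<noteq> 0\<close> by (auto simp: y_def)
  then have "(\<Sum>i\<in>UNIV. \<Sum>j\<in>UNIV. y $ i * M $ i $ j * y $ j) > 0"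
    using assms by (auto simp: sym_pos_def_on_def)
  also have "(\<Sum>i\<in>UNIV. \<Sum>j\<in>UNIV. y $ i * M $ i $ j * y $ j)
      = (\<Sum>i\<in>I. \<Sum>j\<in>UNIV. y $ i * M $ i $ j * y $ j)"
    by (rule sum.mono_neutral_right) (auto simp: y_def)
  also have "\<dots> = (\<Sum>i\<in>I. \<Sum>j\<in>I. x $ i * M $ i $ j * x $ j)"
  proof (rule sum.cong[OF refl])
    fix i assume "i \<in> I"
    then show "(\<Sum>j\<in>UNIV. y $ i * M $ i $ j * y $ j) = (\<Sum>j\<in>I. x $ i * M $ i $ j * x $ j)"
      by (intro sum.mono_neutral_cong_right) (auto simp: y_def)
  qed
  finally show "(\<Sum>i\<in>I. \<Sum>j\<in>I. x $ i * M $ i $ j * x $ j) > 0" .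
qed

lemma sum_sum_type:
  "(\<Sum>i\<in>(UNIV::('a::finite + 'b::finite) set). f i) = (\<Sum>a\<in>UNIV. f (Inl a)) + (\<Sum>b\<in>UNIV. f (Inr b))"
  by (subst UNIV_sum, subst sum.union_disjoint) (auto simp: sum.reindex)

lemma matrix_inv_inverse:
  fixes M :: "real^'n::finite^'n"
  assumes "invertible M"
  shows "M ** matrix_inv M = mat 1" "matrix_inv M ** M = mat 1"
  using someI_ex[OF assms[unfolded invertible_def]] by (simp_all add: matrix_inv_def)

lemma transpose_matrix_inv_eq:
  fixes M :: "real^'n::finite^'n"
  assumes "invertible M" "transpose M = M"
  shows "transpose (matrix_inv M) = matrix_inv M"
proof -
  have "transpose (matrix_inv M) ** M = mat 1"
    using arg_cong[OF matrix_inv_inverse(1)[OF assms(1)], of transpose]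
    by (simp add: matrix_transpose_mul assms(2) transpose_mat)
  then have "transpose (matrix_inv M) ** (M ** matrix_inv M) = matrix_inv M"
    by (simp add: matrix_mul_assoc)
  then show ?thesis by (simp add: matrix_inv_inverse(1)[OF assms(1)])
qed

lemma transpose_block_matrix:
  "transpose (block_matrix P Q R S) = block_matrix (transpose P) (transpose R) (transpose Q) (transpose S)"
  by (auto simp: transpose_def block_matrix_def vec_eq_iff split: sum.split)

text \<open>With \<open>N\<close> the inverse of \<open>M\<close> and
  \<open>t = transpose B *v y + transpose C *v z\<close>, the quadratic form at
  \<open>(y, z)\<close> is \<open>t \<bullet> (N *v t)\<close>. Hence definiteness amounts to
  injectivity of the map from \<open>(y, z)\<close> to \<open>t\<close>, which is where the coupling
  form of the method enters.\<close>

lemma sym_pos_def_schur: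
  fixes M :: "real^'n::finite^'n" and B :: "real^'n^'v::finite" and C :: "real^'n^'w::finite"
  assumes M: "sym_pos_def_on UNIV M"
    and inj: "\<And>y z. transpose B *v y + transpose C *v z = 0 \<Longrightarrow> y = 0 \<and> z = 0"
  shows "sym_pos_def_on UNIV
    (block_matrix (B ** matrix_inv M ** transpose B) (B ** matrix_inv M ** transpose C)
                  (C ** matrix_inv M ** transpose B) (C ** matrix_inv M ** transpose C))"
    (is "sym_pos_def_on UNIV ?S")
proof -
  have MT: "transpose M = M" and Mpos: "\<And>x. x \<noteq> 0 \<Longrightarrow> x \<bullet> (M *v x) > 0"
    using M by (auto simp: sym_pos_def_on_UNIV_iff)
  have inv: "invertible M" using M by (rule sym_pos_def_invertible)
  define N where "N = matrix_inv M"
  have NT: "transpose N = N" unfolding N_def using inv MT by (rule transpose_matrix_inv_eq)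
  have Npos: "t \<bullet> (N *v t) > 0" if "t \<noteq> 0" for t
  proof -
    have t: "M *v (N *v t) = t"
      by (simp add: N_def matrix_inv_inverse(1)[OF inv] matrix_vector_mul_assoc)
    then have "N *v t \<noteq> 0" using that by auto
    from Mpos[OF this] show ?thesis unfolding t by (simp add: inner_commute)
  qed
  have form: "x \<bullet> (?S *v x) = t \<bullet> (N *v t)"
    if "y = (\<chi> a. x $ Inl a)" "z = (\<chi> b. x $ Inr b)" "t = transpose B *v y + transpose C *v z"
    for x y z t
  proof -
    have "x \<bullet> (?S *v x) = y \<bullet> ((B ** N ** transpose B) *v y) + y \<bullet> ((B ** N ** transpose C) *v z)
         + (z \<bullet> ((C ** N ** transpose B) *v y) + z \<bullet> ((C ** N ** transpose C) *v z))"
      unfolding that N_def[symmetric]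
      by (simp add: inner_vec_def matrix_vector_mult_def sum_sum_type block_matrix_def
          distrib_left sum.distrib)
    also have "\<dots> = y \<bullet> (B *v (N *v t)) + z \<bullet> (C *v (N *v t))"
      by (simp add: that matrix_vector_mul_assoc[symmetric] matrix_vector_right_distrib inner_add_right)
    also have "\<dots> = t \<bullet> (N *v t)"
      unfolding that(3) inner_add_left
      by (simp only: transpose_matrix_vector dot_lmul_matrix)
    finally show ?thesis .
  qed
  have "transpose ?S = ?S"
    unfolding N_def[symmetric]
  proof -
    have *: "transpose (X ** N ** transpose Y) = Y ** N ** transpose X"
      for X :: "real^'n^'k::finite" and Y :: "real^'n^'l::finite"
      by (simp add: matrix_transpose_mul NT matrix_mul_assoc)
    show "transpose (block_matrix (B ** N ** transpose B) (B ** N ** transpose C)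
                  (C ** N ** transpose B) (C ** N ** transpose C))
       = block_matrix (B ** N ** transpose B) (B ** N ** transpose C)
                  (C ** N ** transpose B) (C ** N ** transpose C)"
      by (simp only: transpose_block_matrix *)
  qed
  moreover have "x \<bullet> (?S *v x) > 0" if "x \<noteq> 0" for x
  proof -
    define y z where "y = (\<chi> a. x $ Inl a)" and "z = (\<chi> b. x $ Inr b)"
    have "\<not> (y = 0 \<and> z = 0)"
    proof
      assume "y = 0 \<and> z = 0"
      then have "x $ i = 0" for i
        by (cases i) (auto simp: y_def z_def vec_eq_iff)
      then show False using that by (simp add: vec_eq_iff)
    qed
    with inj[of y z] have "transpose B *v y + transpose C *v z \<noteq> 0" by blast
    then show ?thesis
      using form[OF y_def z_def refl] Npos by simp
  qed
  ultimately show ?thesis by (simp add: sym_pos_def_on_UNIV_iff)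
qed

section \<open>Cuboids\<close>

definition edge :: "(nat \<Rightarrow> vec3) \<Rightarrow> 3 \<Rightarrow> vec3" where
  "edge r i = (if i = 1 then r 2 - r 1 else if i = 2 then r 4 - r 1 else r 5 - r 1)"

text \<open>For orthogonal edges the inverse of \<open>elem_map r\<close> consists of three inner
  products; interior, facets and vertices of an element then become conditions on single
  coordinates.\<close>

definition coord :: "(nat \<Rightarrow> vec3) \<Rightarrow> 3 \<Rightarrow> vec3 \<Rightarrow> real" where
  "coord r i x = ((x - r 1) \<bullet> edge r i) / (edge r i \<bullet> edge r i)"

definition elem_face :: "vec3 set \<Rightarrow> (nat \<Rightarrow> vec3) \<Rightarrow> 3 \<Rightarrow> real \<Rightarrow> vec3 set" where
  "elem_face E r i s = {x\<in>E. coord r i x = s}"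

lemma edge_simps [simp]: "edge r 1 = r 2 - r 1" "edge r 2 = r 4 - r 1" "edge r 3 = r 5 - r 1"
  by (simp_all add: edge_def)

lemma elem_map_edge: "elem_map r x = r 1 + (\<Sum>i\<in>UNIV. x $ i *\<^sub>R edge r i)"
  by (simp add: elem_map_def sum_3 add.assoc)

lemma coord_diff: "coord r i x - coord r i y = ((x - y) \<bullet> edge r i) / (edge r i \<bullet> edge r i)"
  by (simp add: coord_def inner_diff_left diff_divide_distrib)

lemma coord_convex: "coord r i ((1 - u) *\<^sub>R x + u *\<^sub>R y) = (1 - u) * coord r i x + u * coord r i y"
proof -
  have "(1 - u) *\<^sub>R x + u *\<^sub>R y - r 1 = (1 - u) *\<^sub>R (x - r 1) + u *\<^sub>R (y - r 1)"
    by (simp add: algebra_simps)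
  then show ?thesis by (simp add: coord_def inner_add_left add_divide_distrib)
qed

lemma continuous_coord [continuous_intros]:
  "continuous_on S f \<Longrightarrow> continuous_on S (\<lambda>x. coord r i (f x))"
  unfolding coord_def divide_inverse by (intro continuous_intros)

context
  fixes E :: "vec3 set" and r :: "nat \<Rightarrow> vec3"
  assumes cub: "cuboid E r"
begin

lemma edge_nonzero: "edge r i \<noteq> 0"
  using cub exhaust_3[of i] by (auto simp: cuboid_def)

lemma edge_inner_pos: "edge r i \<bullet> edge r i > 0"
  by (simp add: edge_nonzero)

lemma edge_orthogonal: "i \<noteq> j \<Longrightarrow> edge r i \<bullet> edge r j = 0"
  using cub exhaust_3[of i] exhaust_3[of j]
  by (auto simp: cuboid_def orthogonal_def inner_commute)

lemma coord_elem_map [simp]: "coord r i (elem_map r x) = x $ i"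
proof -
  have "(\<Sum>j\<in>UNIV. x $ j * (edge r j \<bullet> edge r i)) = (\<Sum>j\<in>UNIV. if j = i then x $ i * (edge r i \<bullet> edge r i) else 0)"
    by (intro sum.cong) (auto simp: edge_orthogonal)
  then show ?thesis
    unfolding coord_def elem_map_edge using edge_nonzero[of i] by (simp add: inner_sum_left)
qed

lemma inj_elem_map: "inj (elem_map r)"
proof (rule injI)
  fix x y assume "elem_map r x = elem_map r y"
  then have "coord r i (elem_map r x) = coord r i (elem_map r y)" for i by (rule arg_cong)
  then show "x = y" unfolding coord_elem_map by (simp add: vec_eq_iff)
qed

lemma elem_map_coord [simp]: "elem_map r (\<chi> i. coord r i x) = x"
proof -
  \<comment> \<open>The linear part is surjective because it is injective between spaces of equal
    dimension.\<close>
  define L where "L y = (\<Sum>i\<in>UNIV. y $ i *\<^sub>R edge r i)" for y :: vec3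
  have "linear L"
    by (auto intro!: linearI simp: L_def scaleR_add_left sum.distrib scaleR_sum_right)
  moreover have "inj L"
  proof (rule injI)
    fix x y assume "L x = L y"
    then have "elem_map r x = elem_map r y" by (simp add: elem_map_edge L_def)
    then show "x = y" using inj_elem_map by (rule injD[rotated])
  qed
  ultimately have "surj L" by (simp add: linear_injective_imp_surjective)
  then obtain y where "x - r 1 = L y" by blast
  then have "x = elem_map r y" by (simp add: elem_map_edge L_def algebra_simps)
  then show ?thesis by simp
qed

lemma coord_eq_imp_eq:
  assumes "\<And>i. coord r i x = coord r i y"
  shows "x = y"
proof -
  have "(\<chi> i. coord r i x) = (\<chi> i. coord r i y)" using assms by (simp add: vec_eq_iff)
  then have "elem_map r (\<chi> i. coord r i x) = elem_map r (\<chi> i. coord r i y)" by (rule arg_cong)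
  then show ?thesis unfolding elem_map_coord .
qed

lemma inv_elem_map: "inv (elem_map r) x = (\<chi> i. coord r i x)"
  by (rule inv_f_eq) (simp_all add: inj_elem_map)

lemma coord_add_edge: "coord r i (x + t *\<^sub>R edge r j) = coord r i x + (if i = j then t else 0)"
proof -
  have "coord r i (x + t *\<^sub>R edge r j) - coord r i x = (if i = j then t else 0)"
    using edge_nonzero[of i] edge_orthogonal[of j i] by (auto simp: coord_diff)
  then show ?thesis by simp
qed

lemma vec_edge_expansion: "v = (\<Sum>i\<in>UNIV. ((v \<bullet> edge r i) / (edge r i \<bullet> edge r i)) *\<^sub>R edge r i)"
proof -
  have "elem_map r (\<chi> i. coord r i (r 1 + v)) = r 1 + v" by (rule elem_map_coord)
  then show ?thesis unfolding elem_map_edge by (simp add: coord_def)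
qed

lemma mem_cuboid_iff: "x \<in> E \<longleftrightarrow> (\<forall>i. 0 \<le> coord r i x \<and> coord r i x \<le> 1)"
proof
  assume "x \<in> E"
  then show "\<forall>i. 0 \<le> coord r i x \<and> coord r i x \<le> 1"
    using cub by (auto simp: cuboid_def ref_cube_def)
next
  assume "\<forall>i. 0 \<le> coord r i x \<and> coord r i x \<le> 1"
  then have "(\<chi> i. coord r i x) \<in> ref_cube" by (simp add: ref_cube_def)
  then have "elem_map r (\<chi> i. coord r i x) \<in> E" using cub unfolding cuboid_def by blast
  then show "x \<in> E" by simp
qed

lemma convex_cuboid: "convex E"
  unfolding convex_alt
proof (intro ballI allI impI)
  fix x y and u :: real
  assume "x \<in> E" "y \<in> E" and u: "0 \<le> u \<and> u \<le> 1"
  then have "0 \<le> coord r i x" "coord r i x \<le> 1" "0 \<le> coord r i y" "coord r i y \<le> 1" for i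
    by (auto simp: mem_cuboid_iff)
  then show "(1 - u) *\<^sub>R x + u *\<^sub>R y \<in> E"
    unfolding mem_cuboid_iff coord_convex using u by (simp add: convex_bound_le)
qed

lemma interior_cuboid: "interior E = {x. \<forall>i. 0 < coord r i x \<and> coord r i x < 1}" (is "_ = ?I")
proof
  have "?I = (\<Inter>i. {x. 0 < coord r i x} \<inter> {x. coord r i x < 1})" by auto
  moreover have "open (\<Inter>i. {x. 0 < coord r i x} \<inter> {x. coord r i x < 1})"
    by (rule open_INT) (auto intro!: open_Int open_Collect_less continuous_intros)
  ultimately have "open ?I" by simp
  moreover have "?I \<subseteq> E" by (auto simp: mem_cuboid_iff less_imp_le)
  ultimately show "?I \<subseteq> interior E" by (rule interior_maximal[rotated])
next
  show "interior E \<subseteq> ?I"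
  proof
    fix x assume "x \<in> interior E"
    then obtain e where e: "e > 0" "ball x e \<subseteq> E" by (auto simp: mem_interior)
    have "0 < coord r i x \<and> coord r i x < 1" for i
    proof -
      define t where "t = e / (2 * norm (edge r i))"
      have "norm (t *\<^sub>R edge r i) < e" "t > 0"
        using e(1) edge_nonzero[of i] by (auto simp: t_def)
      then have "x + t *\<^sub>R edge r i \<in> ball x e" "x + (-t) *\<^sub>R edge r i \<in> ball x e"
        by (simp_all add: dist_norm)
      then have "x + t *\<^sub>R edge r i \<in> E" "x + (-t) *\<^sub>R edge r i \<in> E"
        using e(2) by blast+
      then have "coord r i (x + t *\<^sub>R edge r i) \<le> 1" "0 \<le> coord r i (x + (-t) *\<^sub>R edge r i)"
        unfolding mem_cuboid_iff by blast+
      then show ?thesis using \<open>t > 0\<close> unfolding coord_add_edge by simp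
    qed
    then show "x \<in> ?I" by simp
  qed
qed

lemma interior_cuboid_nonempty: "interior E \<noteq> {}"
proof -
  have "elem_map r (\<chi> i. 1/2) \<in> interior E" by (simp add: interior_cuboid)
  then show ?thesis by blast
qed

lemma coord_mult: "coord r i x * (edge r i \<bullet> edge r i) = edge r i \<bullet> x - edge r i \<bullet> r 1"
proof -
  have "coord r i x * (edge r i \<bullet> edge r i) = edge r i \<bullet> (x - r 1)"
    using edge_nonzero[of i] by (simp add: coord_def inner_commute)
  then show ?thesis by (simp only: inner_diff_right)
qed

lemma coord_eq_iff: "coord r i x = s \<longleftrightarrow> edge r i \<bullet> x = edge r i \<bullet> r 1 + s * (edge r i \<bullet> edge r i)"
proof -
  have "coord r i x = s \<longleftrightarrow> coord r i x * (edge r i \<bullet> edge r i) = s * (edge r i \<bullet> edge r i)"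
    using edge_nonzero[of i] by simp
  then show ?thesis unfolding coord_mult by linarith
qed

text \<open>These bring the element into half-space form, for use with supporting hyperplanes and
  polyhedra. The factor \<open>1\<close> matches \<open>coord_eq_iff\<close> at
  \<open>s = 1\<close>.\<close>

lemma coord_bounds_iff:
  "0 \<le> coord r i x \<longleftrightarrow> edge r i \<bullet> r 1 \<le> edge r i \<bullet> x"
  "coord r i x \<le> 1 \<longleftrightarrow> edge r i \<bullet> x \<le> edge r i \<bullet> r 1 + 1 * (edge r i \<bullet> edge r i)"
proof -
  have "0 \<le> coord r i x \<longleftrightarrow> 0 \<le> coord r i x * (edge r i \<bullet> edge r i)"
    using mult_le_cancel_right_pos[OF edge_inner_pos[of i], of 0 "coord r i x"] by simp
  then show "0 \<le> coord r i x \<longleftrightarrow> edge r i \<bullet> r 1 \<le> edge r i \<bullet> x"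
    unfolding coord_mult by linarith
  have "coord r i x \<le> 1 \<longleftrightarrow> coord r i x * (edge r i \<bullet> edge r i) \<le> 1 * (edge r i \<bullet> edge r i)"
    using edge_inner_pos[of i] by (simp only: mult_le_cancel_right_pos)
  then show "coord r i x \<le> 1 \<longleftrightarrow> edge r i \<bullet> x \<le> edge r i \<bullet> r 1 + 1 * (edge r i \<bullet> edge r i)"
    unfolding coord_mult by linarith
qed

lemma polyhedron_cuboid: "polyhedron E"
proof -
  have "E = (\<Inter>i. {x. edge r i \<bullet> x \<ge> edge r i \<bullet> r 1}) \<inter>
            (\<Inter>i. {x. edge r i \<bullet> x \<le> edge r i \<bullet> r 1 + 1 * (edge r i \<bullet> edge r i)})"
    by (auto simp: mem_cuboid_iff coord_bounds_iff)
  then show ?thesis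
    by (auto intro!: polyhedron_Int polyhedron_Inter polyhedron_halfspace_ge polyhedron_halfspace_le)
qed

lemma compact_cuboid: "compact E"
proof -
  have "continuous_on ref_cube (elem_map r)"
    unfolding elem_map_def by (intro continuous_intros)
  moreover have "ref_cube = cbox 0 1"
    by (auto simp: ref_cube_def mem_box_cart)
  ultimately show ?thesis
    using cub by (metis compact_cbox compact_continuous_image cuboid_def)
qed

lemma closed_cuboid: "closed E"
  using compact_cuboid by (rule compact_imp_closed)

lemma closure_interior_cuboid: "closure (interior E) = E"
  by (simp add: closed_cuboid convex_closure_interior convex_cuboid interior_cuboid_nonempty)

lemma aff_dim_cuboid: "aff_dim E = 3"
  by (simp add: aff_dim_nonempty_interior interior_cuboid_nonempty)

section \<open>Facets, vertices and normals of a cuboid\<close>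

lemma elem_face_subset: "elem_face E r i s \<subseteq> E"
  by (auto simp: elem_face_def)

lemma elem_face_face_of:
  assumes "s \<in> {0, 1}"
  shows "elem_face E r i s face_of E"
proof -
  have "elem_face E r i s = E \<inter> {x. edge r i \<bullet> x = edge r i \<bullet> r 1 + s * (edge r i \<bullet> edge r i)}"
    by (auto simp: elem_face_def coord_eq_iff)
  moreover have "E \<inter> {x. edge r i \<bullet> x = edge r i \<bullet> r 1 + s * (edge r i \<bullet> edge r i)} face_of E"
  proof (cases "s = 0")
    case True
    then show ?thesis
      by (intro face_of_Int_supporting_hyperplane_ge convex_cuboid)
         (auto simp: mem_cuboid_iff coord_bounds_iff)
  next
    case False
    then have "s = 1" using assms by simp
    then show ?thesis
      by (intro face_of_Int_supporting_hyperplane_le convex_cuboid)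
         (auto simp: mem_cuboid_iff coord_bounds_iff)
  qed
  ultimately show ?thesis by simp
qed

lemma elem_face_neq: "elem_face E r i s \<noteq> E"
proof
  assume eq: "elem_face E r i s = E"
  have "elem_map r (\<chi> l. t) \<in> E" if "0 \<le> t" "t \<le> 1" for t
    using that by (simp add: mem_cuboid_iff)
  then have "elem_map r (\<chi> l. 0) \<in> elem_face E r i s" "elem_map r (\<chi> l. 1) \<in> elem_face E r i s"
    unfolding eq by auto
  then have "coord r i (elem_map r (\<chi> l. 0)) = s" "coord r i (elem_map r (\<chi> l. 1)) = s"
    unfolding elem_face_def by blast+
  then show False by simp
qed

lemma elem_face_nonempty:
  assumes "s \<in> {0, 1}"
  shows "elem_face E r i s \<noteq> {}"
proof -
  have "elem_map r (\<chi> l. s) \<in> elem_face E r i s"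
    using assms by (auto simp: elem_face_def mem_cuboid_iff)
  then show ?thesis by blast
qed

text \<open>A relative interior point of a facet lies off the interior, so one of its coordinates is
  0 or 1. A face that contains a relative interior point of \<open>f\<close> contains all of
  \<open>f\<close>, and comparing dimensions turns this inclusion into an equality.\<close>

lemma facet_of_cuboidE:
  assumes "f facet_of E"
  obtains i s where "s \<in> {0, 1}" "f = elem_face E r i s"
proof -
  have f: "f face_of E" "aff_dim f = 2" "f \<noteq> {}"
    using assms by (auto simp: facet_of_def aff_dim_cuboid)
  have "f \<noteq> E" using f(2) by (auto simp: aff_dim_cuboid)
  have "f \<inter> interior E = {}"
    using face_of_disjoint_interior f(1) \<open>f \<noteq> E\<close> by blast
  moreover have "rel_interior f \<noteq> {}"
    using f face_of_imp_convex rel_interior_eq_empty by blast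
  ultimately obtain x where x: "x \<in> rel_interior f" "x \<notin> interior E"
    using rel_interior_subset by blast
  then have "x \<in> f" using rel_interior_subset by blast
  then have "x \<in> E" using f(1) face_of_imp_subset by blast
  then obtain i where "coord r i x = 0 \<or> coord r i x = 1"
    using x(2) unfolding interior_cuboid mem_cuboid_iff mem_Collect_eq
    by (metis less_le)
  then obtain s where s: "s \<in> {0, 1}" "x \<in> elem_face E r i s"
    using \<open>x \<in> E\<close> by (auto simp: elem_face_def)
  have ff: "elem_face E r i s face_of E" using s(1) by (rule elem_face_face_of)
  have sub: "f \<subseteq> elem_face E r i s"
    using subset_of_face_of[OF ff, of f] x(1) s(2) f(1) face_of_imp_subset by blast
  have fff: "f face_of elem_face E r i s"
    using face_of_subset[OF f(1) sub elem_face_subset] .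
  have "aff_dim (elem_face E r i s) < 3"
    using face_of_aff_dim_lt[OF convex_cuboid ff elem_face_neq] by (simp add: aff_dim_cuboid)
  then have "f = elem_face E r i s"
    using face_of_aff_dim_lt[OF _ fff] f(2) ff face_of_imp_convex by fastforce
  then show thesis using that s(1) by blast
qed

lemma elem_face_eqD:
  assumes "elem_face E r i s \<subseteq> elem_face E r j t" "s \<in> {0, 1}"
  shows "i = j \<and> s = t"
proof -
  \<comment> \<open>Two opposite corners of the face: they share the coordinate \<open>i\<close> and
    no other.\<close>
  define x where "x = (\<lambda>a. elem_map r (\<chi> l. if l = i then s else a))"
  have "x 0 \<in> elem_face E r i s" "x 1 \<in> elem_face E r i s"
    using assms(2) by (auto simp: elem_face_def x_def mem_cuboid_iff)
  then have "coord r j (x 0) = t" "coord r j (x 1) = t"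
    using assms(1) by (auto simp: elem_face_def)
  then show ?thesis by (auto simp: x_def split: if_splits)
qed

text \<open>The dimension need not be computed: the face lies in some facet, that facet is a
  coordinate face as well, and inclusions between coordinate faces are equalities.\<close>

lemma elem_face_facet_of:
  assumes "s \<in> {0, 1}"
  shows "elem_face E r i s facet_of E"
proof -
  obtain g where g: "g facet_of E" "elem_face E r i s \<subseteq> g"
    using face_of_polyhedron_subset_facet[OF polyhedron_cuboid elem_face_face_of[OF assms]
        elem_face_nonempty[OF assms] elem_face_neq] by blast
  obtain j t where "g = elem_face E r j t" using facet_of_cuboidE[OF g(1)] by blast
  then show ?thesis
    using g elem_face_eqD[of i s j t] assms by simp
qed

text \<open>A coordinate strictly inside the unit interval leaves room to move both ways along its
  edge; conversely 0 and 1 are no proper averages of distinct numbers in the unit interval.\<close>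

lemma extreme_point_of_cuboid_iff:
  "x extreme_point_of E \<longleftrightarrow> (\<forall>l. coord r l x \<in> {0, 1})"
proof
  assume x: "x extreme_point_of E"
  then have "x \<in> E" by (simp add: extreme_point_of_def)
  show "\<forall>l. coord r l x \<in> {0, 1}"
  proof (rule ccontr)
    assume "\<not> (\<forall>l. coord r l x \<in> {0, 1})"
    then obtain l where l: "coord r l x \<noteq> 0" "coord r l x \<noteq> 1" by auto
    with \<open>x \<in> E\<close> have l': "0 < coord r l x" "coord r l x < 1"
      by (auto simp: mem_cuboid_iff less_le)
    define t where "t = min (coord r l x) (1 - coord r l x)"
    have t: "t > 0" using l' by (simp add: t_def)
    have "x + t *\<^sub>R edge r l \<in> E" "x + (-t) *\<^sub>R edge r l \<in> E"
      unfolding mem_cuboid_iff coord_add_edge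
      using \<open>x \<in> E\<close> l' by (auto simp: mem_cuboid_iff t_def)
    moreover have "x \<in> open_segment (x + t *\<^sub>R edge r l) (x + (-t) *\<^sub>R edge r l)"
    proof -
      have "x + t *\<^sub>R edge r l \<noteq> x + (-t) *\<^sub>R edge r l"
        using t edge_nonzero[of l] by (simp add: algebra_simps flip: scaleR_add_left)
      moreover have "x = (1 - 1/2) *\<^sub>R (x + t *\<^sub>R edge r l) + (1/2) *\<^sub>R (x + (-t) *\<^sub>R edge r l)"
        by (simp add: algebra_simps flip: scaleR_add_left)
      ultimately show ?thesis
          unfolding in_segment by (intro conjI exI[of _ "1/2"]) auto
    qed
    ultimately show False using x by (auto simp: extreme_point_of_def)
  qed
next
  assume x: "\<forall>l. coord r l x \<in> {0, 1}"
  have "x \<in> E" unfolding mem_cuboid_iff using x by (metis empty_iff insert_iff order_refl zero_le_one)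
  moreover have "x \<notin> open_segment a b" if "a \<in> E" "b \<in> E" for a b
  proof
    assume "x \<in> open_segment a b"
    then obtain u where u: "a \<noteq> b" "0 < u" "u < 1" "x = (1 - u) *\<^sub>R a + u *\<^sub>R b"
      by (auto simp: in_segment)
    have "coord r l a = coord r l b" for l
    proof -
      have ab: "0 \<le> coord r l a" "coord r l a \<le> 1" "0 \<le> coord r l b" "coord r l b \<le> 1"
        using that by (auto simp: mem_cuboid_iff)
      have "coord r l x = (1 - u) * coord r l a + u * coord r l b"
        by (simp add: u(4) coord_convex)
      moreover have "coord r l x = 0 \<or> coord r l x = 1" using x by auto
      moreover have "(1 - u) * coord r l a \<ge> 0" "u * coord r l b \<ge> 0"
        "(1 - u) * (1 - coord r l a) \<ge> 0" "u * (1 - coord r l b) \<ge> 0"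
        using ab u by auto
      moreover have "(1 - u) * (1 - coord r l a) + u * (1 - coord r l b)
          = 1 - ((1 - u) * coord r l a + u * coord r l b)"
        by (simp add: algebra_simps)
      ultimately have "((1 - u) * coord r l a = 0 \<and> u * coord r l b = 0) \<or>
          ((1 - u) * (1 - coord r l a) = 0 \<and> u * (1 - coord r l b) = 0)"
        by linarith
      then show ?thesis using u by auto
    qed
    then show False using u(1) coord_eq_imp_eq by blast
  qed
  ultimately show "x extreme_point_of E" by (auto simp: extreme_point_of_def)
qed

lemma extreme_point_of_elem_face_iff:
  assumes "s \<in> {0, 1}"
  shows "x extreme_point_of elem_face E r i s \<longleftrightarrow> coord r i x = s \<and> (\<forall>l. coord r l x \<in> {0, 1})"
proof -
  have "x extreme_point_of elem_face E r i s \<longleftrightarrow> x extreme_point_of E \<and> x \<in> elem_face E r i s"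
    using extreme_point_of_face[OF elem_face_face_of[OF assms]] .
  moreover have "x \<in> E" if "x extreme_point_of E" using that by (simp add: extreme_point_of_def)
  ultimately show ?thesis
    using extreme_point_of_cuboid_iff by (auto simp: elem_face_def)
qed

text \<open>Trades the numbering of the eight vertices for a coordinate condition, the form in which
  vertices are handled from here on.\<close>

lemma vertex_iff: "(\<exists>i\<in>{1..8}. x = r i) \<longleftrightarrow> (\<forall>l. coord r l x \<in> {0, 1})"
proof
  assume "\<exists>i\<in>{1..8}. x = r i"
  then obtain i where i: "i \<in> {1..8}" "x = r i" by blast
  then have x: "x = elem_map r (ref_vertex i)" using cub by (simp add: cuboid_def)
  have "i \<in> {1,2,3,4,5,6,7,8}" using i(1) by auto
  then show "\<forall>l. coord r l x \<in> {0, 1}"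
    unfolding x coord_elem_map by (auto simp: ref_vertex_def forall_3)
next
  assume "\<forall>l. coord r l x \<in> {0, 1}"
  then have c: "coord r 1 x \<in> {0,1}" "coord r 2 x \<in> {0,1}" "coord r 3 x \<in> {0,1}" by auto
  have "\<exists>i\<in>{1,2,3,4,5,6,7,8}. (\<chi> l. coord r l x) = ref_vertex i"
    using c by (auto simp: ref_vertex_def vec_eq_iff forall_3)
  then obtain i where i: "i \<in> {1,2,3,4,5,6,7,8::nat}" "(\<chi> l. coord r l x) = ref_vertex i" by blast
  then have "i \<in> {1..8}" by auto
  moreover have "x = elem_map r (ref_vertex i)" using i(2) elem_map_coord[of x] by simp
  moreover have "r i = elem_map r (ref_vertex i)" using cub \<open>i \<in> {1..8}\<close> by (simp add: cuboid_def)
  ultimately show "\<exists>i\<in>{1..8}. x = r i" by metis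
qed

text \<open>Otherwise a second coordinate face would contain a relative interior point of the first,
  hence all of it.\<close>

lemma rel_interior_elem_faceD:
  assumes "x \<in> rel_interior (elem_face E r i s)" "s \<in> {0, 1}" "l \<noteq> i"
  shows "0 < coord r l x \<and> coord r l x < 1"
proof -
  have x: "x \<in> elem_face E r i s" using assms(1) rel_interior_subset by blast
  then have "x \<in> E" by (simp add: elem_face_def)
  have "coord r l x \<noteq> t" if t: "t \<in> {0, 1}" for t
  proof
    assume "coord r l x = t"
    then have "x \<in> elem_face E r l t" using \<open>x \<in> E\<close> by (simp add: elem_face_def)
    then have "elem_face E r i s \<subseteq> elem_face E r l t"
      using subset_of_face_of[OF elem_face_face_of[OF t], of "elem_face E r i s" l] assms(1) elem_face_subset
      by blast
    then show False using elem_face_eqD assms by blast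
  qed
  from this[of 0] this[of 1] show ?thesis
    using \<open>x \<in> E\<close> by (auto simp: mem_cuboid_iff less_le)
qed

text \<open>The two edges other than \<open>i\<close> are differences of points of the face, so a
  normal is orthogonal to both.\<close>

lemma normal_parallel_edge:
  assumes "\<And>x y. x \<in> elem_face E r i s \<Longrightarrow> y \<in> elem_face E r i s \<Longrightarrow> n \<bullet> (x - y) = 0"
    and "n \<noteq> 0" "s \<in> {0, 1}"
  obtains c where "c \<noteq> 0" "n = c *\<^sub>R edge r i"
proof -
  have "n \<bullet> edge r l = 0" if "l \<noteq> i" for l
  proof -
    define x where "x = elem_map r (\<chi> k. if k = i then s else 0)"
    have "x \<in> elem_face E r i s" "x + 1 *\<^sub>R edge r l \<in> elem_face E r i s"
      using assms(3) that unfolding elem_face_def mem_Collect_eq mem_cuboid_iff coord_add_edge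
      by (auto simp: x_def)
    from assms(1)[OF this(2,1)] show ?thesis by simp
  qed
  then have "(\<Sum>l\<in>UNIV. ((n \<bullet> edge r l) / (edge r l \<bullet> edge r l)) *\<^sub>R edge r l)
      = (\<Sum>l\<in>UNIV. if l = i then ((n \<bullet> edge r i) / (edge r i \<bullet> edge r i)) *\<^sub>R edge r i else 0)"
    by (intro sum.cong) auto
  also have "\<dots> = ((n \<bullet> edge r i) / (edge r i \<bullet> edge r i)) *\<^sub>R edge r i"
    by simp
  finally have "n = ((n \<bullet> edge r i) / (edge r i \<bullet> edge r i)) *\<^sub>R edge r i"
    using vec_edge_expansion[of n] by simp
  moreover from this have "(n \<bullet> edge r i) / (edge r i \<bullet> edge r i) \<noteq> 0"
    using assms(2) by (metis scaleR_zero_left)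
  ultimately show thesis using that by blast
qed

text \<open>Near a relative interior point of a facet only the inequality of that facet can fail.
  The sign \<open>\<sigma>\<close> makes \<open>\<sigma> *\<^sub>R n\<close> point into the element;
  it is what is later compared between neighbours.\<close>

lemma cuboid_half_ball:
  assumes "f facet_of E" "x \<in> rel_interior f"
    and n: "\<And>x y. x \<in> f \<Longrightarrow> y \<in> f \<Longrightarrow> n \<bullet> (x - y) = 0" "n \<noteq> 0"
  obtains \<epsilon> \<sigma> where "\<epsilon> > 0" "\<sigma> \<in> {-1, 1}" "\<And>y. y \<in> ball x \<epsilon> \<Longrightarrow> y \<in> E \<longleftrightarrow> 0 \<le> \<sigma> * (n \<bullet> (y - x))"
proof -
  obtain i s where s: "s \<in> {0, 1}" and f: "f = elem_face E r i s"
    using facet_of_cuboidE[OF assms(1)] by blast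
  obtain c where c: "c \<noteq> 0" "n = c *\<^sub>R edge r i"
    using normal_parallel_edge[of i s n] n s unfolding f by blast
  have x: "coord r i x = s"
    using assms(2) rel_interior_subset by (auto simp: f elem_face_def)
  \<comment> \<open>The open set on which all inequalities of the cuboid except the one of the facet
    hold strictly.\<close>
  define U where "U = {y. (\<forall>l. l \<noteq> i \<longrightarrow> 0 < coord r l y \<and> coord r l y < 1) \<and>
                          (if s = 0 then coord r i y < 1 else 0 < coord r i y)}"
  have "U = (\<Inter>l\<in>-{i}. {y. 0 < coord r l y} \<inter> {y. coord r l y < 1}) \<inter>
          (if s = 0 then {y. coord r i y < 1} else {y. 0 < coord r i y})"
    by (auto simp: U_def)
  moreover have "open \<dots>"
    by (auto intro!: open_INT open_Int open_Collect_less continuous_intros)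
  ultimately have "open U" by simp
  moreover have "x \<in> U"
    using rel_interior_elem_faceD[OF assms(2)[unfolded f] s] x s by (auto simp: U_def)
  ultimately obtain \<epsilon> where \<epsilon>: "\<epsilon> > 0" "ball x \<epsilon> \<subseteq> U" by (auto simp: open_contains_ball)
  define \<sigma> where "\<sigma> = sgn c * (if s = 0 then 1 else - 1)"
  have "y \<in> E \<longleftrightarrow> 0 \<le> \<sigma> * (n \<bullet> (y - x))" if "y \<in> ball x \<epsilon>" for y
  proof -
    have y: "y \<in> U" using that \<epsilon> by blast
    have "\<sigma> * (n \<bullet> (y - x)) = (sgn c * c) * (if s = 0 then 1 else - 1) * (edge r i \<bullet> (y - x))"
      by (simp add: \<sigma>_def c)
    also have "edge r i \<bullet> (y - x) = (coord r i y - s) * (edge r i \<bullet> edge r i)"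
      using coord_diff[of r i y x] edge_inner_pos[of i] by (simp add: x field_simps inner_commute)
    finally have eq: "\<sigma> * (n \<bullet> (y - x)) =
        (\<bar>c\<bar> * (edge r i \<bullet> edge r i)) * ((if s = 0 then 1 else - 1) * (coord r i y - s))"
      by (simp add: abs_sgn mult.commute)
    have "0 < \<bar>c\<bar> * (edge r i \<bullet> edge r i)" using c edge_inner_pos[of i] by simp
    then have "0 \<le> \<sigma> * (n \<bullet> (y - x)) \<longleftrightarrow> 0 \<le> (if s = 0 then 1 else - 1) * (coord r i y - s)"
      unfolding eq by (simp add: zero_le_mult_iff)
    also have "\<dots> \<longleftrightarrow> y \<in> E"
    proof -
      have "y \<in> E \<longleftrightarrow> 0 \<le> coord r i y \<and> coord r i y \<le> 1"
        using y unfolding mem_cuboid_iff U_def by (metis (mono_tags, lifting) less_imp_le mem_Collect_eq)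
      also have "\<dots> \<longleftrightarrow> 0 \<le> (if s = 0 then 1 else - 1) * (coord r i y - s)"
        using s y by (auto simp: U_def)
      finally show ?thesis by simp
    qed
    finally show ?thesis by simp
  qed
  moreover have "\<sigma> \<in> {-1, 1}" using c by (auto simp: \<sigma>_def sgn_if)
  ultimately show thesis using that \<epsilon>(1) by blast
qed

end

section \<open>Octants\<close>

definition orthonormal_frame :: "(3 \<Rightarrow> vec3) \<Rightarrow> bool" where
  "orthonormal_frame u \<longleftrightarrow> (\<forall>i j. u i \<bullet> u j = (if i = j then 1 else 0))"

definition octant :: "(3 \<Rightarrow> vec3) \<Rightarrow> real \<Rightarrow> vec3 set" where
  "octant u \<epsilon> = {x \<in> ball 0 \<epsilon>. \<forall>i. 0 \<le> x \<bullet> u i}"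

lemma octant_lmeasurable: "octant u \<epsilon> \<in> lmeasurable"
proof (rule measurable_convex)
  have "octant u \<epsilon> = ball 0 \<epsilon> \<inter> (\<Inter>i. {x. u i \<bullet> x \<ge> 0})"
    by (auto simp: octant_def inner_commute)
  then show "convex (octant u \<epsilon>)"
    by (auto intro!: convex_Int convex_INT convex_halfspace_ge)
  show "bounded (octant u \<epsilon>)"
    by (rule bounded_subset[of "ball 0 \<epsilon>"]) (auto simp: octant_def)
qed

text \<open>The matrix with rows \<open>u i\<close> is orthogonal and carries the octant of the
  frame \<open>u\<close> to the coordinate octant.\<close>

lemma measure_octant:
  assumes "orthonormal_frame u"
  shows "measure lebesgue (octant u \<epsilon>) = measure lebesgue (octant (\<lambda>i. axis i 1) \<epsilon>)"
proof -
  define U :: mat3 where "U = (\<chi> i. u i)"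
  have Ux: "(U *v x) $ i = x \<bullet> u i" for x i
    by (simp add: U_def matrix_vector_mult_def inner_vec_def mult.commute)
  have row: "row i U = u i" for i by (simp add: row_def U_def vec_eq_iff)
  have "orthogonal_matrix U"
    using assms by (auto simp: orthogonal_matrix_orthonormal_rows row orthonormal_frame_def
        orthogonal_def norm_eq_1)
  then have ot: "orthogonal_transformation ((*v) U)"
    by (simp add: orthogonal_transformation_matrix)
  have "(*v) U ` octant u \<epsilon> = octant (\<lambda>i. axis i 1) \<epsilon>"
  proof (rule set_eqI)
    fix y
    obtain x where x: "y = U *v x"
      using orthogonal_transformation_surj[OF ot] by blast
    have n: "norm (U *v z) = norm z" for z
      using ot by (simp add: orthogonal_transformation)
    have "y \<in> octant (\<lambda>i. axis i 1) \<epsilon> \<longleftrightarrow> x \<in> octant u \<epsilon>"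
      by (simp add: octant_def x n Ux inner_axis)
    moreover have "y \<in> (*v) U ` octant u \<epsilon> \<longleftrightarrow> x \<in> octant u \<epsilon>"
      using orthogonal_transformation_inj[OF ot] x by (auto dest: injD)
    ultimately show "y \<in> (*v) U ` octant u \<epsilon> \<longleftrightarrow> y \<in> octant (\<lambda>i. axis i 1) \<epsilon>" by simp
  qed
  then show ?thesis
    using measure_orthogonal_image[OF ot octant_lmeasurable] by metis
qed

lemma measure_octant_tiling:
  assumes "finite S" "\<And>s. s \<in> S \<Longrightarrow> orthonormal_frame (u s)"
    and "(\<Union>s\<in>S. octant (u s) \<epsilon>) = ball 0 \<epsilon>"
    and "pairwise (\<lambda>s t. negligible (octant (u s) \<epsilon> \<inter> octant (u t) \<epsilon>)) S"
  shows "real (card S) * measure lebesgue (octant (\<lambda>i. axis i 1) \<epsilon>) = measure lebesgue (ball (0::vec3) \<epsilon>)"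
proof -
  have "measure lebesgue (ball (0::vec3) \<epsilon>) = (\<Sum>s\<in>S. measure lebesgue (octant (u s) \<epsilon>))"
    unfolding assms(3)[symmetric]
    by (rule measure_negligible_finite_Union_image) (use assms octant_lmeasurable in auto)
  also have "\<dots> = (\<Sum>s\<in>S. measure lebesgue (octant (\<lambda>i. axis i 1) \<epsilon>))"
    using assms(2) by (intro sum.cong) (auto intro: measure_octant)
  finally show ?thesis by simp
qed

text \<open>Counting by volume: all octants of a ball are congruent, so all tilings by octants have
  equally many pieces. Comparison with the tiling by the eight sign patterns \<open>w\<close> makes
  the value of the volume irrelevant.\<close>

lemma octant_tiling_card:
  assumes "finite S" "\<And>s. s \<in> S \<Longrightarrow> orthonormal_frame (u s)" "\<epsilon> > 0"
    and "(\<Union>s\<in>S. octant (u s) \<epsilon>) = ball 0 \<epsilon>"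
    and "pairwise (\<lambda>s t. negligible (octant (u s) \<epsilon> \<inter> octant (u t) \<epsilon>)) S"
  shows "card S = 8"
proof -
  define w :: "(3 \<Rightarrow> bool) \<Rightarrow> 3 \<Rightarrow> vec3" where "w \<sigma> i = (if \<sigma> i then axis i 1 else - axis i 1)" for \<sigma> i
  have "orthonormal_frame (w \<sigma>)" for \<sigma>
    by (auto simp: orthonormal_frame_def w_def inner_axis_axis)
  moreover have "(\<Union>\<sigma>. octant (w \<sigma>) \<epsilon>) = ball 0 \<epsilon>"
  proof
    show "ball 0 \<epsilon> \<subseteq> (\<Union>\<sigma>. octant (w \<sigma>) \<epsilon>)"
    proof
      fix x :: vec3 assume "x \<in> ball 0 \<epsilon>"
      then have "x \<in> octant (w (\<lambda>i. 0 \<le> x $ i)) \<epsilon>"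
        by (simp add: octant_def w_def inner_axis)
      then show "x \<in> (\<Union>\<sigma>. octant (w \<sigma>) \<epsilon>)" by blast
    qed
  qed (auto simp: octant_def)
  moreover have "negligible (octant (w \<sigma>) \<epsilon> \<inter> octant (w \<sigma>') \<epsilon>)" if ne: "\<sigma> \<noteq> \<sigma>'" for \<sigma> \<sigma>'
  proof -
    obtain i where i: "\<sigma> i \<noteq> \<sigma>' i" using ne by blast
    have "x $ i = 0" if "x \<in> octant (w \<sigma>) \<epsilon> \<inter> octant (w \<sigma>') \<epsilon>" for x
    proof -
      have "0 \<le> x \<bullet> w \<sigma> i" "0 \<le> x \<bullet> w \<sigma>' i" using that by (auto simp: octant_def)
      then show ?thesis using i by (auto simp: w_def inner_axis split: if_splits)
    qed
    then have "octant (w \<sigma>) \<epsilon> \<inter> octant (w \<sigma>') \<epsilon> \<subseteq> {x. x $ i = 0}" by blast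
    then show ?thesis
      using negligible_standard_hyperplane_cart negligible_subset by blast
  qed
  ultimately have "real (card (UNIV :: (3 \<Rightarrow> bool) set)) * measure lebesgue (octant (\<lambda>i. axis i 1) \<epsilon>)
      = measure lebesgue (ball (0::vec3) \<epsilon>)"
    by (intro measure_octant_tiling[of _ w]) (auto simp: pairwise_def)
  moreover have "card (UNIV :: (3 \<Rightarrow> bool) set) = 8" by (simp add: card_fun)
  ultimately have "real (card S) * measure lebesgue (octant (\<lambda>i. axis i 1) \<epsilon>)
     = 8 * measure lebesgue (octant (\<lambda>i. axis i 1) \<epsilon>)"
    using measure_octant_tiling[OF assms(1,2,4,5)] by simp
  \<comment> \<open>A null octant would make the whole ball null.\<close>
  moreover have "measure lebesgue (octant (\<lambda>i. axis i 1) \<epsilon>) \<noteq> 0"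
    using measure_octant_tiling[OF assms(1,2,4,5)] content_ball_pos[OF assms(3), of "0::vec3"] by auto
  ultimately show ?thesis by simp
qed

section \<open>Conforming cuboid meshes\<close>

context
  fixes \<Omega> :: "vec3 set" and T :: "vec3 set set" and r :: "vec3 set \<Rightarrow> nat \<Rightarrow> vec3"
  assumes mesh: "conforming_cuboid_mesh \<Omega> T r"
begin

lemma finite_mesh: "finite T"
  and Union_mesh: "\<Union>T = closure \<Omega>"
  and interior_Union_mesh: "interior (\<Union>T) = \<Omega>"
  and cuboid_mesh: "E \<in> T \<Longrightarrow> cuboid E (r E)"
  and mesh_inter_face: "E \<in> T \<Longrightarrow> E' \<in> T \<Longrightarrow> (E \<inter> E') face_of E"
  using mesh by (auto simp: conforming_cuboid_mesh_def)

lemma interior_subset_domain: "E \<in> T \<Longrightarrow> interior E \<subseteq> \<Omega>"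
  unfolding interior_Union_mesh[symmetric] by (intro interior_mono) auto

lemma subset_Union_mesh: "\<Omega> \<subseteq> \<Union>T"
  using Union_mesh closure_subset by auto

text \<open>An element contained in another one would be a proper face of it and miss its interior,
  although its own nonempty interior lies there.\<close>

lemma mesh_inter_neq:
  assumes "E \<in> T" "E' \<in> T" "E \<noteq> E'"
  shows "E \<inter> E' \<noteq> E"
proof
  assume "E \<inter> E' = E"
  then have "E face_of E'" using mesh_inter_face[OF assms(2,1)] by (simp add: inf_commute)
  then have "E \<inter> interior E' = {}" using face_of_disjoint_interior assms(3) by blast
  moreover have "interior E \<subseteq> interior E'" using \<open>E \<inter> E' = E\<close> by (intro interior_mono) auto
  ultimately show False
    using interior_cuboid_nonempty[OF cuboid_mesh[OF assms(1)]] interior_subset by blast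
qed

lemma mesh_interior_disjoint:
  assumes "E \<in> T" "E' \<in> T" "E \<noteq> E'"
  shows "interior E \<inter> E' = {}"
  using face_of_disjoint_interior[OF mesh_inter_face mesh_inter_neq] assms interior_subset by blast

lemma mesh_inter_negligible:
  assumes "E \<in> T" "E' \<in> T" "E \<noteq> E'"
  shows "negligible (E \<inter> E')"
proof -
  have "interior (E \<inter> E') = {}"
    using mesh_interior_disjoint[OF assms] interior_subset by (auto simp: interior_Int)
  moreover have "convex (E \<inter> E')"
    using assms cuboid_mesh convex_cuboid by (intro convex_Int) blast+
  ultimately show ?thesis using negligible_convex_interior by blast
qed

lemma mesh_inter_facet:
  assumes "E \<in> T" "E' \<in> T" "E \<noteq> E'" "aff_dim (E \<inter> E') \<ge> 2"
  shows "(E \<inter> E') facet_of E"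
proof -
  have "aff_dim (E \<inter> E') < aff_dim E"
    using face_of_aff_dim_lt[OF convex_cuboid[OF cuboid_mesh] mesh_inter_face mesh_inter_neq] assms by blast
  then show ?thesis
    using assms mesh_inter_face[OF assms(1,2)] aff_dim_cuboid[OF cuboid_mesh[OF assms(1)]]
    by (auto simp: facet_of_def)
qed

text \<open>One shared relative interior point suffices: the common face then contains all of
  \<open>f\<close>, and both have dimension 2.\<close>

lemma facet_inter_mesh:
  assumes "E \<in> T" "E' \<in> T" "E \<noteq> E'" "f facet_of E" "x \<in> rel_interior f" "x \<in> E'"
  shows "f = E \<inter> E'" "f facet_of E'"
proof -
  have f: "f face_of E" "aff_dim f = 2"
    using assms(4) aff_dim_cuboid[OF cuboid_mesh[OF assms(1)]] by (auto simp: facet_of_def)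
  have "x \<in> f" using assms(5) rel_interior_subset by blast
  then have sub: "f \<subseteq> E \<inter> E'"
    using subset_of_face_of[OF mesh_inter_face[OF assms(1,2)], of f] f(1) face_of_imp_subset assms(5,6)
    by blast
  have facet: "(E \<inter> E') facet_of E"
    using mesh_inter_facet[OF assms(1-3)] aff_dim_subset[OF sub] f(2) by simp
  then have d: "aff_dim (E \<inter> E') = 2"
    using aff_dim_cuboid[OF cuboid_mesh[OF assms(1)]] by (simp add: facet_of_def)
  have "f face_of (E \<inter> E')" using face_of_subset[OF f(1) sub] by blast
  moreover have "convex (E \<inter> E')"
    using assms cuboid_mesh convex_cuboid by (intro convex_Int) blast+
  ultimately show eq: "f = E \<inter> E'"
    using face_of_aff_dim_lt f(2) d by fastforce
  have "(E' \<inter> E) facet_of E'"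
    using mesh_inter_facet[OF assms(2,1)] assms(3) d by (simp add: inf_commute)
  then show "f facet_of E'" by (simp add: eq inf_commute)
qed

lemma facet_rel_interior_nonempty:
  assumes "f facet_of E"
  shows "rel_interior f \<noteq> {}"
  using assms face_of_imp_convex rel_interior_eq_empty by (auto simp: facet_of_def)

section \<open>Elements sharing a facet\<close>

lemma facet_half_balls:
  assumes "unit_normals T \<nu>" "E \<in> T" "f facet_of E" "x \<in> rel_interior f"
  obtains \<epsilon> \<sigma> where "\<epsilon> > 0" "\<sigma> \<in> {-1, 1}" "\<And>y. y \<in> ball x \<epsilon> \<Longrightarrow> y \<in> E \<longleftrightarrow> 0 \<le> \<sigma> * (\<nu> f \<bullet> (y - x))"
proof -
  have "f \<in> mesh_faces T" using assms by (auto simp: mesh_faces_def)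
  then have "\<nu> f \<noteq> 0" "\<And>x y. x \<in> f \<Longrightarrow> y \<in> f \<Longrightarrow> \<nu> f \<bullet> (x - y) = 0"
    using assms(1) by (auto simp: unit_normals_def)
  then show thesis
    using cuboid_half_ball[OF cuboid_mesh[OF assms(2)] assms(3,4), of "\<nu> f"] that by blast
qed

text \<open>With equal signs both elements would coincide near \<open>x\<close>, against the
  disjointness of the interior of one from the other.\<close>

lemma facet_two_sides:
  assumes "unit_normals T \<nu>" "E \<in> T" "f facet_of E" "x \<in> rel_interior f"
    "E' \<in> T" "f facet_of E'" "E \<noteq> E'"
  obtains \<epsilon> \<sigma> where "\<epsilon> > 0" "\<sigma> \<in> {-1, 1}"
     "\<And>y. y \<in> ball x \<epsilon> \<Longrightarrow> y \<in> E \<longleftrightarrow> 0 \<le> \<sigma> * (\<nu> f \<bullet> (y - x))"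
     "\<And>y. y \<in> ball x \<epsilon> \<Longrightarrow> y \<in> E' \<longleftrightarrow> 0 \<le> - \<sigma> * (\<nu> f \<bullet> (y - x))"
proof -
  obtain \<epsilon> \<sigma> where 1: "\<epsilon> > 0" "\<sigma> \<in> {-1, 1}"
      "\<And>y. y \<in> ball x \<epsilon> \<Longrightarrow> y \<in> E \<longleftrightarrow> 0 \<le> \<sigma> * (\<nu> f \<bullet> (y - x))"
    using facet_half_balls[OF assms(1-4)] by blast
  obtain \<epsilon>' \<sigma>' where 2: "\<epsilon>' > 0" "\<sigma>' \<in> {-1, 1}"
      "\<And>y. y \<in> ball x \<epsilon>' \<Longrightarrow> y \<in> E' \<longleftrightarrow> 0 \<le> \<sigma>' * (\<nu> f \<bullet> (y - x))"
    using facet_half_balls[OF assms(1,5,6,4)] by blast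
  have "\<sigma> \<noteq> \<sigma>'"
  proof
    assume "\<sigma> = \<sigma>'"
    then have eq: "y \<in> E \<longleftrightarrow> y \<in> E'" if "y \<in> ball x (min \<epsilon> \<epsilon>')" for y
      using 1(3) 2(3) that by simp
    have "x \<in> E"
      using assms(3,4) rel_interior_subset face_of_imp_subset by (fastforce simp: facet_of_def)
    then have "x \<in> closure (interior E)"
      using closure_interior_cuboid[OF cuboid_mesh[OF assms(2)]] by simp
    then obtain y where "y \<in> interior E" "dist y x < min \<epsilon> \<epsilon>'"
      unfolding closure_approachable using 1(1) 2(1) by (metis min_less_iff_conj)
    then have "y \<in> interior E \<inter> E'"
      using eq[of y] interior_subset by (auto simp: dist_commute)
    then show False using mesh_interior_disjoint assms by blast
  qed
  then have "\<sigma>' = - \<sigma>" using 1(2) 2(2) by auto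
  then show thesis
    using that[of "min \<epsilon> \<epsilon>'" \<sigma>] 1 2 by simp
qed

text \<open>Three elements at one facet would need three pairwise opposite signs. The signs are
  compared at the point \<open>x + e *\<^sub>R \<nu> f\<close>, with \<open>e\<close> below all
  three radii.\<close>

lemma facet_at_most_two:
  assumes "unit_normals T \<nu>" "E1 \<in> T" "E2 \<in> T" "E3 \<in> T"
    "f facet_of E1" "f facet_of E2" "f facet_of E3" "E1 \<noteq> E2" "E1 \<noteq> E3"
  shows "E2 = E3"
proof (rule ccontr)
  assume ne: "E2 \<noteq> E3"
  obtain x where x: "x \<in> rel_interior f" using facet_rel_interior_nonempty assms(5) by blast
  obtain e1 s1 where 1: "e1 > 0" "s1 \<in> {-1, 1}"
     "\<And>y. y \<in> ball x e1 \<Longrightarrow> y \<in> E1 \<longleftrightarrow> 0 \<le> s1 * (\<nu> f \<bullet> (y - x))"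
     "\<And>y. y \<in> ball x e1 \<Longrightarrow> y \<in> E2 \<longleftrightarrow> 0 \<le> - s1 * (\<nu> f \<bullet> (y - x))"
    using facet_two_sides[OF assms(1,2,5) x assms(3,6,8)] by blast
  obtain e2 s2 where 2: "e2 > 0" "s2 \<in> {-1, 1}"
     "\<And>y. y \<in> ball x e2 \<Longrightarrow> y \<in> E1 \<longleftrightarrow> 0 \<le> s2 * (\<nu> f \<bullet> (y - x))"
     "\<And>y. y \<in> ball x e2 \<Longrightarrow> y \<in> E3 \<longleftrightarrow> 0 \<le> - s2 * (\<nu> f \<bullet> (y - x))"
    using facet_two_sides[OF assms(1,2,5) x assms(4,7,9)] by blast
  obtain e3 s3 where 3: "e3 > 0" "s3 \<in> {-1, 1}"
     "\<And>y. y \<in> ball x e3 \<Longrightarrow> y \<in> E2 \<longleftrightarrow> 0 \<le> s3 * (\<nu> f \<bullet> (y - x))"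
     "\<And>y. y \<in> ball x e3 \<Longrightarrow> y \<in> E3 \<longleftrightarrow> 0 \<le> - s3 * (\<nu> f \<bullet> (y - x))"
    using facet_two_sides[OF assms(1,3,6) x assms(4,7) ne] by blast
  define e where "e = min e1 (min e2 e3) / 2"
  have "f \<in> mesh_faces T" using assms by (auto simp: mesh_faces_def)
  then have n: "norm (\<nu> f) = 1" using assms(1) by (simp add: unit_normals_def)
  then have nn: "\<nu> f \<bullet> \<nu> f = 1" by (simp add: norm_eq_1)
  have "e > 0" "e < e1" "e < e2" "e < e3" using 1 2 3 by (auto simp: e_def)
  then have b: "x + e *\<^sub>R \<nu> f \<in> ball x e1" "x + e *\<^sub>R \<nu> f \<in> ball x e2" "x + e *\<^sub>R \<nu> f \<in> ball x e3"
    using n by (simp_all add: dist_norm)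
  have "0 \<le> s1 \<longleftrightarrow> 0 \<le> s2" "0 \<le> - s1 \<longleftrightarrow> 0 \<le> s3" "0 \<le> - s2 \<longleftrightarrow> 0 \<le> - s3"
    using 1(3,4)[OF b(1)] 2(3,4)[OF b(2)] 3(3,4)[OF b(3)] nn \<open>e > 0\<close>
    by (simp_all add: zero_le_mult_iff mult_le_0_iff)
  then show False using 1(2) 2(2) 3(2) by auto
qed

text \<open>Two elements at a facet fill a ball around \<open>x\<close>, so \<open>x\<close> is
  interior to the union of the mesh. This is where the absence of slits,
  \<open>interior (\<Union>T) = \<Omega>\<close>, enters.\<close>

lemma boundary_facet_unique:
  assumes "unit_normals T \<nu>" "E \<in> T" "f facet_of E" "E' \<in> T" "f facet_of E'" "f \<subseteq> frontier \<Omega>"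
  shows "E = E'"
proof (rule ccontr)
  assume "E \<noteq> E'"
  obtain x where x: "x \<in> rel_interior f" using facet_rel_interior_nonempty assms(3) by blast
  obtain e s where e: "e > 0" "s \<in> {-1, 1}"
     "\<And>y. y \<in> ball x e \<Longrightarrow> y \<in> E \<longleftrightarrow> 0 \<le> s * (\<nu> f \<bullet> (y - x))"
     "\<And>y. y \<in> ball x e \<Longrightarrow> y \<in> E' \<longleftrightarrow> 0 \<le> - s * (\<nu> f \<bullet> (y - x))"
    using facet_two_sides[OF assms(1-3) x assms(4,5) \<open>E \<noteq> E'\<close>] by blast
  have "ball x e \<subseteq> \<Union>T"
  proof
    fix y assume y: "y \<in> ball x e"
    have "0 \<le> s * (\<nu> f \<bullet> (y - x)) \<or> 0 \<le> - s * (\<nu> f \<bullet> (y - x))" by auto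
    then have "y \<in> E \<or> y \<in> E'" using e(3,4)[OF y] by blast
    then show "y \<in> \<Union>T" using assms(2,4) by blast
  qed
  then have "x \<in> interior (\<Union>T)"
    using e(1) by (auto simp: mem_interior)
  then have "x \<in> \<Omega>" "open \<Omega>" using interior_Union_mesh open_interior by metis+
  moreover have "x \<in> frontier \<Omega>" using x rel_interior_subset assms(6) by blast
  ultimately show False by (simp add: frontier_def interior_open)
qed

text \<open>If no other element came near, a neighbourhood of a facet point would lie in
  \<open>E\<close>, but a facet misses the interior.\<close>

lemma interior_facet_neighbour:
  assumes "E \<in> T" "f facet_of E" "p \<in> f" "p \<in> \<Omega>"
  obtains E' where "E' \<in> T" "E' \<noteq> E" "f facet_of E'"
proof -
  have "open \<Omega>" using interior_Union_mesh open_interior by metis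
  \<comment> \<open>The point \<open>p\<close> may be a vertex of \<open>f\<close>; a relative
    interior point close to it still lies in the open set \<open>\<Omega>\<close>.\<close>
  have "convex f" using assms(2) face_of_imp_convex by (auto simp: facet_of_def)
  then have "p \<in> closure (rel_interior f)"
    using assms(3) closure_subset convex_closure_rel_interior by blast
  then obtain x where x: "x \<in> rel_interior f" "x \<in> \<Omega>"
    using \<open>open \<Omega>\<close> assms(4) open_Int_closure_eq_empty by blast
  have "x \<in> \<Union>(T - {E})"
  proof (rule ccontr)
    assume "x \<notin> \<Union>(T - {E})"
    moreover have "closed (\<Union>(T - {E}))"
      using finite_mesh closed_cuboid[OF cuboid_mesh] by (intro closed_Union) auto
    ultimately have "open (\<Omega> - \<Union>(T - {E}))" "x \<in> \<Omega> - \<Union>(T - {E})"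
      using \<open>open \<Omega>\<close> x by auto
    moreover have "\<Omega> - \<Union>(T - {E}) \<subseteq> E" using subset_Union_mesh by blast
    ultimately have "x \<in> interior E" by (meson interior_maximal subsetD)
    moreover have "f \<inter> interior E = {}"
      using assms(2) facet_of_irrefl by (intro face_of_disjoint_interior) (auto simp: facet_of_def)
    ultimately show False using x(1) rel_interior_subset by blast
  qed
  then obtain E' where "E' \<in> T" "E' \<noteq> E" "x \<in> E'" by blast
  then show thesis using that facet_inter_mesh(2)[of E E' f x] assms(1,2) x(1) by metis
qed

lemma card_interior_facet_elements:
  assumes "unit_normals T \<nu>" "f \<in> mesh_faces T" "p \<in> f" "p \<in> \<Omega>"
  shows "card {E\<in>T. f facet_of E} = 2"
proof -
  obtain E where E: "E \<in> T" "f facet_of E" using assms(2) by (auto simp: mesh_faces_def)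
  obtain E' where E': "E' \<in> T" "E' \<noteq> E" "f facet_of E'"
    using interior_facet_neighbour[OF E assms(3,4)] by blast
  have "{E\<in>T. f facet_of E} = {E, E'}"
    using facet_at_most_two[OF assms(1)] E E' by blast
  then show ?thesis using E'(2) by simp
qed

text \<open>Conformity excludes hanging nodes: extremality passes from one element to the common
  face and from there to the other element.\<close>

lemma mesh_vertex_extreme:
  assumes "p \<in> mesh_vertices T r" "E \<in> T" "p \<in> E"
  shows "p extreme_point_of E"
proof -
  obtain E' i where E': "E' \<in> T" "i \<in> {1..8}" "p = r E' i"
    using assms(1) by (auto simp: mesh_vertices_def)
  then have "p extreme_point_of E'"
    using vertex_iff[OF cuboid_mesh] extreme_point_of_cuboid_iff[OF cuboid_mesh] by blast
  then have "p extreme_point_of (E' \<inter> E)"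
    using extreme_point_of_face[OF mesh_inter_face[OF E'(1) assms(2)]] assms(3)
    by (auto simp: extreme_point_of_def)
  then show ?thesis
    using extreme_point_of_face[OF mesh_inter_face[OF assms(2) E'(1)]] by (simp add: inf_commute)
qed

lemma card_vertex_elements:
  assumes "p \<in> mesh_vertices T r" "p \<in> \<Omega>"
  shows "card {E\<in>T. p \<in> E} = 8"
proof -
  define S where "S = {E\<in>T. p \<in> E}"
  have "finite S" using finite_mesh by (simp add: S_def)
  have cub: "cuboid E (r E)" if "E \<in> S" for E using that cuboid_mesh by (simp add: S_def)
  have co: "coord (r E) i p \<in> {0, 1}" if "E \<in> S" for E i
  proof -
    have "p extreme_point_of E" using mesh_vertex_extreme[OF assms(1)] that by (simp add: S_def)
    then show ?thesis using extreme_point_of_cuboid_iff[OF cub[OF that]] by blast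
  qed
  \<comment> \<open>The vectors \<open>u E i\<close> are the unit vectors along the edges of
    \<open>E\<close>, directed from \<open>p\<close> into \<open>E\<close>.\<close>
  define sg where "sg E i = (if coord (r E) i p = 0 then 1 else - 1 :: real)" for E i
  define u where "u E i = (sg E i / norm (edge (r E) i)) *\<^sub>R edge (r E) i" for E i
  have "open \<Omega>" using interior_Union_mesh open_interior by metis
  moreover have "closed (\<Union>(T - S))"
    using finite_mesh closed_cuboid[OF cuboid_mesh] by (intro closed_Union) auto
  ultimately have "open (\<Omega> - \<Union>(T - S))" by (rule open_Diff)
  moreover have "p \<in> \<Omega> - \<Union>(T - S)" using assms(2) by (auto simp: S_def)
  ultimately obtain e where e: "e > 0" "ball p e \<subseteq> \<Omega> - \<Union>(T - S)"
    unfolding open_contains_ball by blast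
  \<comment> \<open>The radius keeps away from elements that do not contain \<open>p\<close>, and
    does not exceed any edge length, so that the facets opposite to \<open>p\<close> impose no
    condition.\<close>
  define \<epsilon> where "\<epsilon> = Min (insert e ((\<lambda>(E, i). norm (edge (r E) i)) ` (S \<times> UNIV)))"
  have fin: "finite (insert e ((\<lambda>(E, i). norm (edge (r E) i)) ` (S \<times> UNIV)))"
    using \<open>finite S\<close> by simp
  have \<epsilon>: "\<epsilon> > 0" "\<epsilon> \<le> e"
    using fin e(1) edge_nonzero[OF cub] unfolding \<epsilon>_def by (auto simp: Min_gr_iff)
  have \<epsilon>': "\<epsilon> \<le> norm (edge (r E) i)" if "E \<in> S" for E i
    unfolding \<epsilon>_def by (rule Min_le[OF fin]) (use that in force)
  have mem: "p + z \<in> E \<longleftrightarrow> z \<in> octant (u E) \<epsilon>" if E: "E \<in> S" and z: "z \<in> ball 0 \<epsilon>" for E z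
  proof -
    have "0 \<le> coord (r E) i (p + z) \<and> coord (r E) i (p + z) \<le> 1 \<longleftrightarrow> 0 \<le> z \<bullet> u E i" for i
    proof -
      let ?a = "edge (r E) i"
      have a: "norm ?a > 0" using edge_nonzero[OF cub[OF E]] by simp
      \<comment> \<open>The change of the coordinate is at most 1 in size by Cauchy-Schwarz, so only
        its sign decides whether the coordinate stays between 0 and 1.\<close>
      define t where "t = coord (r E) i (p + z) - coord (r E) i p"
      have t: "z \<bullet> ?a = t * (norm ?a)\<^sup>2"
        using a by (simp add: t_def coord_diff dot_square_norm)
      have "\<bar>t\<bar> * (norm ?a)\<^sup>2 = \<bar>z \<bullet> ?a\<bar>" by (simp add: t abs_mult)
      also have "\<dots> \<le> norm z * norm ?a" by (rule Cauchy_Schwarz_ineq2)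
      also have "\<dots> \<le> norm ?a * norm ?a"
        using z \<epsilon>'[OF E, of i] by (intro mult_right_mono) auto
      finally have "\<bar>t\<bar> \<le> 1" using a by (simp add: power2_eq_square)
      have "z \<bullet> u E i = sg E i * (t * norm ?a)"
        using a by (simp add: u_def t power2_eq_square)
      then have "0 \<le> z \<bullet> u E i \<longleftrightarrow> 0 \<le> sg E i * t"
        using a by (simp add: zero_le_mult_iff mult_le_0_iff)
      moreover have "coord (r E) i (p + z) = coord (r E) i p + t" by (simp add: t_def)
      ultimately show ?thesis
        using co[OF E, of i] \<open>\<bar>t\<bar> \<le> 1\<close> by (auto simp: sg_def)
    qed
    then show ?thesis using z by (simp add: octant_def mem_cuboid_iff[OF cub[OF E]])
  qed
  have "orthonormal_frame (u E)" if "E \<in> S" for E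
    unfolding orthonormal_frame_def
  proof (intro allI)
    fix i j
    show "u E i \<bullet> u E j = (if i = j then 1 else 0)"
      using edge_orthogonal[OF cub[OF that], of i j] edge_nonzero[OF cub[OF that], of i]
      by (auto simp: u_def sg_def dot_square_norm power2_eq_square)
  qed
  moreover have "(\<Union>E\<in>S. octant (u E) \<epsilon>) = ball 0 \<epsilon>"
  proof
    show "ball 0 \<epsilon> \<subseteq> (\<Union>E\<in>S. octant (u E) \<epsilon>)"
    proof
      fix z :: vec3 assume z: "z \<in> ball 0 \<epsilon>"
      then have "p + z \<in> ball p e" using \<epsilon> by (simp add: dist_norm)
      then have "p + z \<in> \<Union>T" "p + z \<notin> \<Union>(T - S)" using e(2) subset_Union_mesh by blast+
      then obtain E where "E \<in> S" "p + z \<in> E" by blast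
      then show "z \<in> (\<Union>E\<in>S. octant (u E) \<epsilon>)" using mem z by blast
    qed
  qed (auto simp: octant_def)
  moreover have "pairwise (\<lambda>E E'. negligible (octant (u E) \<epsilon> \<inter> octant (u E') \<epsilon>)) S"
  proof (rule pairwiseI)
    fix E E' assume E: "E \<in> S" "E' \<in> S" "E \<noteq> E'"
    have "octant (u E) \<epsilon> \<inter> octant (u E') \<epsilon> \<subseteq> (+) (-p) ` (E \<inter> E')"
    proof
      fix z assume z: "z \<in> octant (u E) \<epsilon> \<inter> octant (u E') \<epsilon>"
      then have "z \<in> ball 0 \<epsilon>" by (simp add: octant_def)
      then have "p + z \<in> E \<inter> E'" using mem E z by blast
      then show "z \<in> (+) (-p) ` (E \<inter> E')" by (intro image_eqI[of _ _ "p + z"]) auto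
    qed
    moreover have "negligible ((+) (-p) ` (E \<inter> E'))"
      using mesh_inter_negligible E by (intro negligible_translation) (auto simp: S_def)
    ultimately show "negligible (octant (u E) \<epsilon> \<inter> octant (u E') \<epsilon>)" using negligible_subset by blast
  qed
  ultimately have "card S = 8"
    using octant_tiling_card[OF \<open>finite S\<close> _ \<epsilon>(1)] by blast
  then show ?thesis by (simp add: S_def)
qed

lemma mesh_faces_vertex:
  assumes "p \<in> mesh_vertices T r" "E \<in> T" "p \<in> E"
  shows "{f. f facet_of E \<and> p \<in> f} = (\<lambda>i. elem_face E (r E) i (coord (r E) i p)) ` UNIV"
    and "card {f. f facet_of E \<and> p \<in> f} = 3"
proof -
  have cub: "cuboid E (r E)" using assms cuboid_mesh by blast
  have co: "coord (r E) i p \<in> {0, 1}" for i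
    using mesh_vertex_extreme[OF assms] extreme_point_of_cuboid_iff[OF cub] by blast
  show eq: "{f. f facet_of E \<and> p \<in> f} = (\<lambda>i. elem_face E (r E) i (coord (r E) i p)) ` UNIV"
  proof
    show "{f. f facet_of E \<and> p \<in> f} \<subseteq> (\<lambda>i. elem_face E (r E) i (coord (r E) i p)) ` UNIV"
    proof
      fix f assume "f \<in> {f. f facet_of E \<and> p \<in> f}"
      then have f: "f facet_of E" "p \<in> f" by auto
      obtain i s where "f = elem_face E (r E) i s" using facet_of_cuboidE[OF cub f(1)] by blast
      then show "f \<in> (\<lambda>i. elem_face E (r E) i (coord (r E) i p)) ` UNIV"
        using f(2) by (auto simp: elem_face_def)
    qed
    show "(\<lambda>i. elem_face E (r E) i (coord (r E) i p)) ` UNIV \<subseteq> {f. f facet_of E \<and> p \<in> f}"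
      using elem_face_facet_of[OF cub co] assms(3) by (auto simp: elem_face_def)
  qed
  have "inj (\<lambda>i. elem_face E (r E) i (coord (r E) i p))"
    using elem_face_eqD[OF cub _ co] by (intro injI) blast
  then show "card {f. f facet_of E \<and> p \<in> f} = 3"
    unfolding eq by (simp add: card_image)
qed

lemma card_vertex_faces:
  assumes "unit_normals T \<nu>" "p \<in> mesh_vertices T r" "p \<in> \<Omega>"
  shows "card {f\<in>mesh_faces T. p \<in> f} = 12" "finite {f\<in>mesh_faces T. p \<in> f}"
proof -
  define F where "F = {f\<in>mesh_faces T. p \<in> f}"
  define S where "S = {E\<in>T. p \<in> E}"
  have "finite S" using finite_mesh by (simp add: S_def)
  have sub: "f \<subseteq> E" if "f facet_of E" for f E :: "vec3 set"
    using that face_of_imp_subset by (auto simp: facet_of_def)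
  have F: "F = (\<Union>E\<in>S. {f. f facet_of E \<and> p \<in> f})"
    using sub by (auto simp: F_def S_def mesh_faces_def)
  have 3: "card {f. f facet_of E \<and> p \<in> f} = 3" "finite {f. f facet_of E \<and> p \<in> f}" if "E \<in> S" for E
  proof -
    show "card {f. f facet_of E \<and> p \<in> f} = 3"
      using mesh_faces_vertex(2)[OF assms(2), of E] that by (simp add: S_def)
    then show "finite {f. f facet_of E \<and> p \<in> f}" by (metis card.infinite zero_neq_numeral)
  qed
  show "finite {f\<in>mesh_faces T. p \<in> f}"
    unfolding F_def[symmetric] F using \<open>finite S\<close> 3 by blast
  then have "finite F" by (simp add: F_def)
  \<comment> \<open>Double counting of incident pairs of an element and a face at \<open>p\<close>:
    8 * 3 pairs in all, and 2 for each face.\<close>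
  have "(\<Sum>E\<in>S. card {f\<in>F. f facet_of E}) = (\<Sum>f\<in>F. card {E\<in>S. f facet_of E})"
    using sum.swap_restrict[OF \<open>finite S\<close> \<open>finite F\<close>, of "\<lambda>_ _. 1::nat" "\<lambda>E f. f facet_of E"] by simp
  moreover have "{f\<in>F. f facet_of E} = {f. f facet_of E \<and> p \<in> f}" if "E \<in> S" for E
    using that by (auto simp: F_def S_def mesh_faces_def)
  moreover have "{E\<in>S. f facet_of E} = {E\<in>T. f facet_of E}" if "f \<in> F" for f
    using that sub by (auto simp: F_def S_def)
  ultimately have "(\<Sum>E\<in>S. 3) = (\<Sum>f\<in>F. 2::nat)"
    using 3 card_interior_facet_elements[OF assms(1) _ _ assms(3)] by (simp add: F_def)
  moreover have "card S = 8" unfolding S_def by (rule card_vertex_elements[OF assms(2,3)])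
  ultimately show "card {f\<in>mesh_faces T. p \<in> f} = 12" by (simp add: F_def)
qed

text \<open>Two generic points of \<open>\<Omega>\<close> close to each other are joined by a segment that avoids all
  intersections of elements of codimension at least two, so it passes between elements
  through facets only.\<close>

lemma mesh_facet_connected:
  assumes "connected \<Omega>"
    and step: "\<And>E E' f. E \<in> T \<Longrightarrow> E' \<in> T \<Longrightarrow> P E \<Longrightarrow> E \<noteq> E' \<Longrightarrow> f facet_of E \<Longrightarrow> f facet_of E' \<Longrightarrow> P E'"
    and start: "E0 \<in> T" "P E0"
    and "E \<in> T"
  shows "P E"
proof (rule ccontr)
  assume "\<not> P E"
  \<comment> \<open>Two closed sets that cover \<open>\<Omega>\<close> and both meet it; by
    connectedness they meet each other inside \<open>\<Omega>\<close>.\<close>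
  define K1 where "K1 = \<Union>{E\<in>T. P E}"
  define K2 where "K2 = \<Union>{E\<in>T. \<not> P E}"
  have "open \<Omega>" using interior_Union_mesh open_interior by metis
  have cl: "closed K1" "closed K2"
    unfolding K1_def K2_def using finite_mesh closed_cuboid[OF cuboid_mesh]
    by (auto intro!: closed_Union)
  have cover: "\<Omega> \<subseteq> K1 \<union> K2"
    using subset_Union_mesh by (auto simp: K1_def K2_def)
  have meet: "interior E \<noteq> {}" "interior E \<subseteq> \<Omega> \<inter> E" if "E \<in> T" for E
    using interior_cuboid_nonempty[OF cuboid_mesh[OF that]] interior_subset_domain[OF that] interior_subset
    by auto
  have "K1 \<inter> \<Omega> \<noteq> {}" "K2 \<inter> \<Omega> \<noteq> {}"
    using meet[OF start(1)] meet[OF \<open>E \<in> T\<close>] start \<open>E \<in> T\<close> \<open>\<not> P E\<close> unfolding K1_def K2_def by blast+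
  then obtain x where x: "x \<in> \<Omega>" "x \<in> K1" "x \<in> K2"
    using assms(1) cl cover unfolding connected_closed by blast
  obtain E1 where E1: "E1 \<in> T" "P E1" "x \<in> E1" using x(2) by (auto simp: K1_def)
  obtain E2 where E2: "E2 \<in> T" "\<not> P E2" "x \<in> E2" using x(3) by (auto simp: K2_def)
  obtain e where e: "e > 0" "ball x e \<subseteq> \<Omega>" using \<open>open \<Omega>\<close> x(1) by (auto simp: open_contains_ball)
  have near: "interior E \<inter> ball x e \<noteq> {}" if "E \<in> T" "x \<in> E" for E
  proof -
    have "x \<in> closure (interior E)"
      using closure_interior_cuboid[OF cuboid_mesh[OF that(1)]] that(2) by simp
    then obtain y where "y \<in> interior E" "dist y x < e"
      using e(1) unfolding closure_approachable by blast
    then show ?thesis by (auto simp: dist_commute)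
  qed
  obtain y where y: "y \<in> interior E1" "y \<in> ball x e" using near E1 by blast
  \<comment> \<open>The endpoints \<open>y'\<close> to be avoided: a segment from \<open>y\<close>
    to \<open>y'\<close> through an intersection of dimension at most 1 has \<open>y'\<close> in one
    of these hulls. They have dimension at most 2, hence form a null set.\<close>
  define L where "L = (\<Union>(F, F')\<in>{(F, F')\<in>T \<times> T. aff_dim (F \<inter> F') \<le> 1}. affine hull (insert y (F \<inter> F')))"
  have "negligible L"
    unfolding L_def
  proof (intro negligible_Union)
    have "finite {(F, F')\<in>T \<times> T. aff_dim (F \<inter> F') \<le> 1}"
      by (rule finite_subset[of _ "T \<times> T"]) (use finite_mesh in auto)
    then show "finite ((\<lambda>(F, F'). affine hull (insert y (F \<inter> F'))) ` {(F, F')\<in>T \<times> T. aff_dim (F \<inter> F') \<le> 1})"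
      by blast
    fix A assume "A \<in> (\<lambda>(F, F'). affine hull (insert y (F \<inter> F'))) ` {(F, F')\<in>T \<times> T. aff_dim (F \<inter> F') \<le> 1}"
    then obtain F F' where F: "A = affine hull (insert y (F \<inter> F'))" "aff_dim (F \<inter> F') \<le> 1" by auto
    have "aff_dim A \<le> 2" using F by (simp add: aff_dim_insert)
    then have "interior A = {}" by (intro low_dim_interior) simp
    then show "negligible A"
      using negligible_convex_interior[OF affine_imp_convex[OF affine_affine_hull], of "insert y (F \<inter> F')"]
      by (simp add: F(1))
  qed
  moreover have "\<not> negligible (interior E2 \<inter> ball x e)"
    using near[OF E2(1,3)] by (intro open_not_negligible) auto
  ultimately have "\<not> interior E2 \<inter> ball x e \<subseteq> L" using negligible_subset by blast
  then obtain y' where y': "y' \<in> interior E2" "y' \<in> ball x e" "y' \<notin> L" by blast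
  have seg: "closed_segment y y' \<subseteq> \<Omega>"
    using closed_segment_subset[OF y(2) y'(2) convex_ball] e(2) by blast
  have "y \<in> K1" "y' \<in> K2"
    using y(1) y'(1) E1 E2 interior_subset by (auto simp: K1_def K2_def)
  \<comment> \<open>The same connectedness argument, now along the segment.\<close>
  then obtain z where z: "z \<in> closed_segment y y'" "z \<in> K1" "z \<in> K2"
    using connected_segment(1)[of y y'] cl cover seg unfolding connected_closed by blast
  obtain F1 where F1: "F1 \<in> T" "P F1" "z \<in> F1" using z(2) by (auto simp: K1_def)
  obtain F2 where F2: "F2 \<in> T" "\<not> P F2" "z \<in> F2" using z(3) by (auto simp: K2_def)
  have "F1 \<noteq> F2" using F1 F2 by blast
  have "aff_dim (F1 \<inter> F2) \<le> 1"
  proof (rule ccontr)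
    assume "\<not> aff_dim (F1 \<inter> F2) \<le> 1"
    then have "(F1 \<inter> F2) facet_of F1" "(F1 \<inter> F2) facet_of F2"
      using mesh_inter_facet[OF F1(1) F2(1)] mesh_inter_facet[OF F2(1) F1(1)] \<open>F1 \<noteq> F2\<close>
      by (auto simp: inf_commute)
    then show False using step[OF F1(1) F2(1) F1(2) \<open>F1 \<noteq> F2\<close>] F2(2) by blast
  qed
  then have L: "affine hull (insert y (F1 \<inter> F2)) \<subseteq> L"
    using F1(1) F2(1) by (auto simp: L_def)
  obtain t where t: "z = (1 - t) *\<^sub>R y + t *\<^sub>R y'" using z(1) by (auto simp: in_segment)
  have "t \<noteq> 0"
  proof
    assume "t = 0"
    then have "y \<in> F2" using t F2(3) by simp
    then show False using mesh_interior_disjoint[OF E1(1) F2(1)] y(1) E1(2) F2(2) by blast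
  qed
  \<comment> \<open>As \<open>z\<close> is not \<open>y\<close>, the endpoint \<open>y'\<close> lies
    on the line through \<open>y\<close> and \<open>z\<close>, hence in a hull that it was chosen to
    avoid.\<close>
  have "y' = (1 - 1/t) *\<^sub>R y + (1/t) *\<^sub>R z"
    using \<open>t \<noteq> 0\<close> by (simp add: t algebra_simps)
  moreover have "y \<in> affine hull (insert y (F1 \<inter> F2))" "z \<in> affine hull (insert y (F1 \<inter> F2))"
    using F1(3) F2(3) by (auto intro: hull_inc)
  ultimately have "y' \<in> affine hull (insert y (F1 \<inter> F2))"
    using mem_affine[OF affine_affine_hull, of y "insert y (F1 \<inter> F2)" z "1 - 1/t" "1/t"] by simp
  then show False using L y'(3) by blast
qed

end

section \<open>The enhanced Raviart-Thomas space\<close>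

lemma partial_eq:
  assumes "(g has_derivative g') (at x)"
  shows "partial j g x = g' (axis j 1)"
  using frechet_derivative_at[OF assms] by (simp add: partial_def)

text \<open>\<open>p + curl (x \<times> b)\<close> written out, with \<open>\<alpha>\<close>, \<open>\<beta>\<close> the coefficients of \<open>p\<close> in \<open>RT0\<close> and \<open>c\<close> those of \<open>b\<close>
  with respect to \<^const>\<open>B_generators\<close>.\<close>

definition ert_poly :: "vec3 \<Rightarrow> vec3 \<Rightarrow> (nat \<Rightarrow> real) \<Rightarrow> real \<Rightarrow> real \<Rightarrow> real \<Rightarrow> vec3" where
  "ert_poly \<alpha> \<beta> c x y z = vector
    [\<alpha>$1 + \<beta>$1*x - 3*c 0*y - 3*c 1*z - 3*c 2*x*y - 3*c 3*x*z - 4*c 4*y*z - 4*c 5*x*y*z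
       + c 8*x^2 + c 10*x*z + c 11*x^2*z + c 15*x^2 + c 16*x*y + c 17*x^2*y,
     \<alpha>$2 + \<beta>$2*y - 3*c 6*x - 3*c 7*z - 3*c 8*x*y - 4*c 9*x*z - 3*c 10*y*z - 4*c 11*x*y*z
       + c 2*y^2 + c 3*y*z + c 5*y^2*z + c 15*x*y + c 16*y^2 + c 17*x*y^2,
     \<alpha>$3 + \<beta>$3*z - 3*c 12*x - 3*c 13*y - 4*c 14*x*y - 3*c 15*x*z - 3*c 16*y*z - 4*c 17*x*y*z
       + c 2*y*z + c 3*z^2 + c 5*y*z^2 + c 8*x*z + c 10*z^2 + c 11*x*z^2]"

text \<open>For \<open>b\<close> homogeneous of degree m, curl (x \<times> b) = x div b - (m + 2) b.
  This yields -3, -4, -5 for degrees 1, 2, 3, and the term x div b raises the coefficient by 1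
  wherever it reproduces the same monomial.\<close>

lemma ERT0_ert_poly:
  assumes "q \<in> ERT0"
  obtains \<alpha> \<beta> c where "q = (\<lambda>x. ert_poly \<alpha> \<beta> c (x$1) (x$2) (x$3))"
proof -
  obtain p b where pb: "p \<in> RT0" "b \<in> B_space" "q = (\<lambda>x. p x + curl (\<lambda>y. cross3 y (b y)) x)"
    using assms by (auto simp: ERT0_def)
  obtain \<alpha> \<beta> :: vec3 where p: "p = (\<lambda>x. vector [\<alpha> $ 1 + \<beta> $ 1 * x $ 1, \<alpha> $ 2 + \<beta> $ 2 * x $ 2, \<alpha> $ 3 + \<beta> $ 3 * x $ 3])"
    using pb(1) by (auto simp: RT0_def)
  obtain c where b: "b = (\<lambda>x. \<Sum>i<18. c i *\<^sub>R (B_generators x ! i))"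
    using pb(2) by (auto simp: B_space_def)
  define b1 b2 b3 :: "vec3 \<Rightarrow> real" where
    "b1 = (\<lambda>x. c 0*x$2 + c 1*x$3 + c 2*(x$1*x$2) + c 3*(x$1*x$3) + c 4*(x$2*x$3) + c 5*(x$1*x$2*x$3))" and
    "b2 = (\<lambda>x. c 6*x$1 + c 7*x$3 + c 8*(x$1*x$2) + c 9*(x$1*x$3) + c 10*(x$2*x$3) + c 11*(x$1*x$2*x$3))" and
    "b3 = (\<lambda>x. c 12*x$1 + c 13*x$2 + c 14*(x$1*x$2) + c 15*(x$1*x$3) + c 16*(x$2*x$3) + c 17*(x$1*x$2*x$3))"
  have set18: "{..<18::nat} = {0,1,2,3,4,5,6,7,8,9,10,11,12,13,14,15,16,17}"
  proof -
    have "[0..<18::nat] = [0,1,2,3,4,5,6,7,8,9,10,11,12,13,14,15,16,17]" by (simp add: upt_rec)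
    then show ?thesis unfolding lessThan_atLeast0 atLeastLessThan_upt by simp
  qed
  have "b = (\<lambda>x. vector [b1 x, b2 x, b3 x])"
    unfolding b B_generators_def Let_def set18
    by (simp add: vec_eq_iff forall_3 fun_eq_iff b1_def b2_def b3_def)
  then have cross: "(\<lambda>y. cross3 y (b y) $ 1) = (\<lambda>y. y$2 * b3 y - y$3 * b2 y)"
      "(\<lambda>y. cross3 y (b y) $ 2) = (\<lambda>y. y$3 * b1 y - y$1 * b3 y)"
      "(\<lambda>y. cross3 y (b y) $ 3) = (\<lambda>y. y$1 * b2 y - y$2 * b1 y)"
    by (simp_all add: cross3_def)
  have "curl (\<lambda>y. cross3 y (b y)) x = ert_poly \<alpha> \<beta> c (x$1) (x$2) (x$3) - p x" for x
  proof -
    have d: "((\<lambda>y. y$2 * b3 y - y$3 * b2 y) has_derivative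
        (\<lambda>h. h$2 * b3 x + x$2 * (c 12*h$1 + c 13*h$2 + c 14*(h$1*x$2 + x$1*h$2) + c 15*(h$1*x$3+x$1*h$3)
              + c 16*(h$2*x$3 + x$2*h$3) + c 17*(h$1*x$2*x$3 + x$1*h$2*x$3 + x$1*x$2*h$3))
          - (h$3 * b2 x + x$3 * (c 6*h$1 + c 7*h$3 + c 8*(h$1*x$2 + x$1*h$2) + c 9*(h$1*x$3+x$1*h$3)
              + c 10*(h$2*x$3 + x$2*h$3) + c 11*(h$1*x$2*x$3 + x$1*h$2*x$3 + x$1*x$2*h$3))))) (at x)"
      "((\<lambda>y. y$3 * b1 y - y$1 * b3 y) has_derivative
        (\<lambda>h. h$3 * b1 x + x$3 * (c 0*h$2 + c 1*h$3 + c 2*(h$1*x$2 + x$1*h$2) + c 3*(h$1*x$3+x$1*h$3)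
              + c 4*(h$2*x$3 + x$2*h$3) + c 5*(h$1*x$2*x$3 + x$1*h$2*x$3 + x$1*x$2*h$3))
          - (h$1 * b3 x + x$1 * (c 12*h$1 + c 13*h$2 + c 14*(h$1*x$2 + x$1*h$2) + c 15*(h$1*x$3+x$1*h$3)
              + c 16*(h$2*x$3 + x$2*h$3) + c 17*(h$1*x$2*x$3 + x$1*h$2*x$3 + x$1*x$2*h$3))))) (at x)"
      "((\<lambda>y. y$1 * b2 y - y$2 * b1 y) has_derivative
        (\<lambda>h. h$1 * b2 x + x$1 * (c 6*h$1 + c 7*h$3 + c 8*(h$1*x$2 + x$1*h$2) + c 9*(h$1*x$3+x$1*h$3)
              + c 10*(h$2*x$3 + x$2*h$3) + c 11*(h$1*x$2*x$3 + x$1*h$2*x$3 + x$1*x$2*h$3))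
          - (h$2 * b1 x + x$2 * (c 0*h$2 + c 1*h$3 + c 2*(h$1*x$2 + x$1*h$2) + c 3*(h$1*x$3+x$1*h$3)
              + c 4*(h$2*x$3 + x$2*h$3) + c 5*(h$1*x$2*x$3 + x$1*h$2*x$3 + x$1*x$2*h$3))))) (at x)"
      unfolding b1_def b2_def b3_def
      by (auto intro!: derivative_eq_intros bounded_linear_imp_has_derivative bounded_linear_vec_nth
          simp: fun_eq_iff algebra_simps)
    show ?thesis
      unfolding curl_def cross partial_eq[OF d(1)] partial_eq[OF d(2)] partial_eq[OF d(3)]
      by (simp add: vec_eq_iff forall_3 p ert_poly_def axis_def b1_def b2_def b3_def power2_eq_square
          algebra_simps)
  qed
  then have "q = (\<lambda>x. ert_poly \<alpha> \<beta> c (x$1) (x$2) (x$3))"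
    by (simp add: pb(3))
  then show thesis using that by blast
qed

lemma continuous_ERT0:
  assumes "q \<in> ERT0"
  shows "continuous_on S q"
proof -
  obtain \<alpha> \<beta> c where q: "q = (\<lambda>x. ert_poly \<alpha> \<beta> c (x$1) (x$2) (x$3))"
    using ERT0_ert_poly[OF assms] by blast
  have "continuous_on S (\<lambda>x. q x $ 1)" "continuous_on S (\<lambda>x. q x $ 2)" "continuous_on S (\<lambda>x. q x $ 3)"
    unfolding q ert_poly_def vector_3 by (intro continuous_intros)+
  then have "continuous_on S (\<lambda>x. q x $ i)" for i using exhaust_3[of i] by auto
  then have "continuous_on S (\<lambda>x. \<chi> i. q x $ i)" by (rule continuous_on_vec_lambda)
  then show ?thesis by simp
qed

section \<open>Flux and moments in terms of vertex values\<close>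

definition unit_vertices :: "vec3 set" where
  "unit_vertices = {p. \<forall>i. p $ i \<in> {0, 1}}"

lemma unit_vertices_eq:
  "unit_vertices = {vector [0,0,0], vector [1,0,0], vector [0,1,0], vector [1,1,0],
                    vector [0,0,1], vector [1,0,1], vector [0,1,1], vector [1,1,1]}"
  by (auto simp: unit_vertices_def vec_eq_iff forall_3)

lemma sum_unit_vertices:
  fixes h :: "vec3 \<Rightarrow> real"
  shows "(\<Sum>p\<in>unit_vertices. h p) = h (vector [0,0,0]) + h (vector [1,0,0]) + h (vector [0,1,0])
    + h (vector [1,1,0]) + h (vector [0,0,1]) + h (vector [1,0,1]) + h (vector [0,1,1]) + h (vector [1,1,1])"
  unfolding unit_vertices_eq by (simp add: vec_eq_iff forall_3)

lemma has_integral_indicator_times: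
  fixes f :: "'a::euclidean_space \<Rightarrow> real"
  shows "((\<lambda>x. indicator S x * f x) has_integral i) UNIV \<longleftrightarrow> (f has_integral i) S"
proof -
  have "(\<lambda>x. indicator S x * f x) = (\<lambda>x. if x \<in> S then f x else 0)"
    by (auto simp: indicator_def)
  then show ?thesis by (simp add: has_integral_restrict_UNIV)
qed

lemma ref_cube_cbox: "ref_cube = cbox 0 1"
  by (auto simp: ref_cube_def mem_box_cart)

text \<open>Monomials are nonnegative on the cube, so the integral factors as a nonnegative integral
  over the coordinates; \<open>ex\<close> hands each basis vector its exponent.\<close>

lemma has_integral_monomial_unit_cube:
  "((\<lambda>x::vec3. x$1^a * x$2^b * x$3^c) has_integral 1 / ((real a + 1) * (real b + 1) * (real c + 1))) ref_cube"
proof -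
  define ex :: "vec3 \<Rightarrow> nat" where "ex v = (if v = axis 1 1 then a else if v = axis 2 1 then b else c)" for v
  define f where "f v t = indicator {0..1} t * t ^ ex v" for v and t :: real
  have B: "(Basis :: vec3 set) = {axis 1 1, axis 2 1, axis 3 1}"
    by (auto simp: Basis_vec_def exhaust_3) (metis exhaust_3)
  have ne: "axis 1 1 \<noteq> (axis 2 1 :: vec3)" "axis 1 1 \<noteq> (axis 3 1 :: vec3)" "axis 2 1 \<noteq> (axis 3 1 :: vec3)"
    by (simp_all add: axis_eq_axis)
  have int1: "(\<integral>\<^sup>+x. ennreal (f v x) \<partial>lborel) = ennreal (1 / (real (ex v) + 1))" for v
  proof -
    have "((\<lambda>t. t ^ ex v) has_integral (1 ^ Suc (ex v) / real (Suc (ex v)) - 0 ^ Suc (ex v) / real (Suc (ex v)))) {0..1::real}"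
      by (intro fundamental_theorem_of_calculus)
         (auto intro!: derivative_eq_intros simp: has_real_derivative_iff_has_vector_derivative[symmetric] simp del: power_Suc)
    then have "(f v has_integral 1 / (real (ex v) + 1)) UNIV"
      unfolding f_def has_integral_indicator_times by (simp add: add.commute)
    moreover have "f v \<in> borel_measurable borel" unfolding f_def by measurable
    moreover have "0 \<le> f v t" for t by (simp add: f_def indicator_def)
    ultimately show ?thesis by (intro nn_integral_has_integral_lborel)
  qed
  have "(\<integral>\<^sup>+x. (\<Prod>v\<in>Basis. ennreal (f v (x \<bullet> v))) \<partial>lborel) = (\<Prod>v\<in>Basis. ennreal (1 / (real (ex v) + 1)))"
    unfolding int1[symmetric] by (rule nn_integral_lborel_prod) (auto simp: f_def)
  also have "\<dots> = ennreal (1 / ((real a + 1) * (real b + 1) * (real c + 1)))"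
    unfolding B using ne by (simp add: ex_def ennreal_mult[symmetric] mult.assoc)
  also have "(\<lambda>x. \<Prod>v\<in>Basis. ennreal (f v (x \<bullet> v))) =
      (\<lambda>x. ennreal (indicator ref_cube x * (x$1^a * x$2^b * x$3^c)))"
  proof
    fix x :: vec3
    show "(\<Prod>v\<in>Basis. ennreal (f v (x \<bullet> v))) = ennreal (indicator ref_cube x * (x$1^a * x$2^b * x$3^c))"
      unfolding B using ne
      by (auto simp: f_def ex_def inner_axis ref_cube_def forall_3 indicator_def ennreal_mult[symmetric] mult.assoc)
  qed
  finally have "(\<integral>\<^sup>+x. ennreal (indicator ref_cube x * (x$1^a * x$2^b * x$3^c)) \<partial>lborel)
     = ennreal (1 / ((real a + 1) * (real b + 1) * (real c + 1)))" .
  moreover have "closed ref_cube"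
    unfolding ref_cube_cbox by (rule closed_cbox)
  then have "(\<lambda>x. indicator ref_cube x * (x$1^a * x$2^b * x$3^c)) \<in> borel_measurable borel"
    by (intro borel_measurable_times borel_measurable_indicator borel_measurable_continuous_onI continuous_intros)
       auto
  ultimately have "((\<lambda>x. indicator ref_cube x * (x$1^a * x$2^b * x$3^c)) has_integral
      1 / ((real a + 1) * (real b + 1) * (real c + 1))) UNIV"
    by (intro nn_integral_has_integral) (auto simp: ref_cube_def indicator_def)
  then show ?thesis unfolding has_integral_indicator_times .
qed

text \<open>The integral of \<open>ert_poly\<close> over the unit cube, term by term: the monomial
  with exponents a, b, c contributes 1 / ((a + 1) (b + 1) (c + 1)).\<close>

definition ert_moment :: "vec3 \<Rightarrow> vec3 \<Rightarrow> (nat \<Rightarrow> real) \<Rightarrow> vec3" where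
  "ert_moment \<alpha> \<beta> c = vector
    [\<alpha>$1 + \<beta>$1/2 - 3/2*c 0 - 3/2*c 1 - 3/4*c 2 - 3/4*c 3 - c 4 - c 5/2
       + c 8/3 + c 10/4 + c 11/6 + c 15/3 + c 16/4 + c 17/6,
     \<alpha>$2 + \<beta>$2/2 - 3/2*c 6 - 3/2*c 7 - 3/4*c 8 - c 9 - 3/4*c 10 - c 11/2
       + c 2/3 + c 3/4 + c 5/6 + c 15/4 + c 16/3 + c 17/6,
     \<alpha>$3 + \<beta>$3/2 - 3/2*c 12 - 3/2*c 13 - c 14 - 3/4*c 15 - 3/4*c 16 - c 17/2
       + c 2/4 + c 3/3 + c 5/6 + c 8/4 + c 10/3 + c 11/6]"

lemma has_integral_ert_poly:
  "((\<lambda>x. ert_poly \<alpha> \<beta> c (x$1) (x$2) (x$3)) has_integral ert_moment \<alpha> \<beta> c) ref_cube"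
proof -
  let ?m = "\<lambda>a b c :: nat. 1 / ((real a + 1) * (real b + 1) * (real c + 1))"
  let ?x = "\<lambda>(x :: vec3) (a :: nat) (b :: nat) (c :: nat). x$1^a * x$2^b * x$3^c"
  have i1: "((\<lambda>x::vec3. \<alpha>$1 * ?x x 0 0 0 + \<beta>$1 * ?x x 1 0 0
        + (- 3 * c 0) * ?x x 0 1 0 + (- 3 * c 1) * ?x x 0 0 1 + (- 3 * c 2) * ?x x 1 1 0
        + (- 3 * c 3) * ?x x 1 0 1 + (- 4 * c 4) * ?x x 0 1 1 + (- 4 * c 5) * ?x x 1 1 1
        + (1 * c 8) * ?x x 2 0 0 + (1 * c 10) * ?x x 1 0 1 + (1 * c 11) * ?x x 2 0 1
        + (1 * c 15) * ?x x 2 0 0 + (1 * c 16) * ?x x 1 1 0 + (1 * c 17) * ?x x 2 1 0)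
      has_integral (\<alpha>$1 * ?m 0 0 0 + \<beta>$1 * ?m 1 0 0 + (- 3 * c 0) * ?m 0 1 0
        + (- 3 * c 1) * ?m 0 0 1 + (- 3 * c 2) * ?m 1 1 0 + (- 3 * c 3) * ?m 1 0 1
        + (- 4 * c 4) * ?m 0 1 1 + (- 4 * c 5) * ?m 1 1 1 + (1 * c 8) * ?m 2 0 0
        + (1 * c 10) * ?m 1 0 1 + (1 * c 11) * ?m 2 0 1 + (1 * c 15) * ?m 2 0 0
        + (1 * c 16) * ?m 1 1 0 + (1 * c 17) * ?m 2 1 0)) ref_cube"
    by (intro has_integral_add has_integral_mult_right has_integral_monomial_unit_cube)
  have i2: "((\<lambda>x::vec3. \<alpha>$2 * ?x x 0 0 0 + \<beta>$2 * ?x x 0 1 0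
        + (- 3 * c 6) * ?x x 1 0 0 + (- 3 * c 7) * ?x x 0 0 1 + (- 3 * c 8) * ?x x 1 1 0
        + (- 4 * c 9) * ?x x 1 0 1 + (- 3 * c 10) * ?x x 0 1 1 + (- 4 * c 11) * ?x x 1 1 1
        + (1 * c 2) * ?x x 0 2 0 + (1 * c 3) * ?x x 0 1 1 + (1 * c 5) * ?x x 0 2 1
        + (1 * c 15) * ?x x 1 1 0 + (1 * c 16) * ?x x 0 2 0 + (1 * c 17) * ?x x 1 2 0)
      has_integral (\<alpha>$2 * ?m 0 0 0 + \<beta>$2 * ?m 0 1 0 + (- 3 * c 6) * ?m 1 0 0
        + (- 3 * c 7) * ?m 0 0 1 + (- 3 * c 8) * ?m 1 1 0 + (- 4 * c 9) * ?m 1 0 1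
        + (- 3 * c 10) * ?m 0 1 1 + (- 4 * c 11) * ?m 1 1 1 + (1 * c 2) * ?m 0 2 0
        + (1 * c 3) * ?m 0 1 1 + (1 * c 5) * ?m 0 2 1 + (1 * c 15) * ?m 1 1 0
        + (1 * c 16) * ?m 0 2 0 + (1 * c 17) * ?m 1 2 0)) ref_cube"
    by (intro has_integral_add has_integral_mult_right has_integral_monomial_unit_cube)
  have i3: "((\<lambda>x::vec3. \<alpha>$3 * ?x x 0 0 0 + \<beta>$3 * ?x x 0 0 1
        + (- 3 * c 12) * ?x x 1 0 0 + (- 3 * c 13) * ?x x 0 1 0 + (- 4 * c 14) * ?x x 1 1 0
        + (- 3 * c 15) * ?x x 1 0 1 + (- 3 * c 16) * ?x x 0 1 1 + (- 4 * c 17) * ?x x 1 1 1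
        + (1 * c 2) * ?x x 0 1 1 + (1 * c 3) * ?x x 0 0 2 + (1 * c 5) * ?x x 0 1 2
        + (1 * c 8) * ?x x 1 0 1 + (1 * c 10) * ?x x 0 0 2 + (1 * c 11) * ?x x 1 0 2)
      has_integral (\<alpha>$3 * ?m 0 0 0 + \<beta>$3 * ?m 0 0 1 + (- 3 * c 12) * ?m 1 0 0
        + (- 3 * c 13) * ?m 0 1 0 + (- 4 * c 14) * ?m 1 1 0 + (- 3 * c 15) * ?m 1 0 1
        + (- 3 * c 16) * ?m 0 1 1 + (- 4 * c 17) * ?m 1 1 1 + (1 * c 2) * ?m 0 1 1
        + (1 * c 3) * ?m 0 0 2 + (1 * c 5) * ?m 0 1 2 + (1 * c 8) * ?m 1 0 1 + (1 * c 10) * ?m 0 0 2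
        + (1 * c 11) * ?m 1 0 2)) ref_cube"
    by (intro has_integral_add has_integral_mult_right has_integral_monomial_unit_cube)
    have "((\<lambda>x. ert_poly \<alpha> \<beta> c (x$1) (x$2) (x$3) $ i) has_integral ert_moment \<alpha>
      \<beta> c $ i) ref_cube" for i
  proof -
      have "((\<lambda>x. ert_poly \<alpha> \<beta> c (x$1) (x$2) (x$3) $ 1) has_integral ert_moment
      \<alpha> \<beta> c $ 1) ref_cube"
        by (rule has_integral_eq_rhs[OF has_integral_eq[OF _ i1]]) (simp_all add: ert_poly_def
      ert_moment_def algebra_simps)
      moreover have "((\<lambda>x. ert_poly \<alpha> \<beta> c (x$1) (x$2) (x$3) $ 2) has_integral
      ert_moment \<alpha> \<beta> c $ 2) ref_cube"
        by (rule has_integral_eq_rhs[OF has_integral_eq[OF _ i2]]) (simp_all add: ert_poly_def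
      ert_moment_def algebra_simps)
      moreover have "((\<lambda>x. ert_poly \<alpha> \<beta> c (x$1) (x$2) (x$3) $ 3) has_integral
      ert_moment \<alpha> \<beta> c $ 3) ref_cube"
        by (rule has_integral_eq_rhs[OF has_integral_eq[OF _ i3]]) (simp_all add: ert_poly_def
      ert_moment_def algebra_simps)
    ultimately show ?thesis using exhaust_3[of i] by auto
  qed
  then show ?thesis
    by (subst has_integral_componentwise_iff) (auto simp: Basis_vec_def inner_axis)
qed

text \<open>The weights in the next two lemmas come from the divergence theorem: \<open>q\<close> has constant
  divergence, so \<open>\<integral> q\<^sub>l\<close> is the boundary integral of \<open>(q \<cdot> n) (x\<^sub>l - 1/2)\<close>, and \<open>q \<cdot> n\<close> is bilinear on each
  face, hence determined by its values at the vertices.\<close>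

lemma ert_poly_flux:
  assumes "q = (\<lambda>x. ert_poly \<alpha> \<beta> c (x$1) (x$2) (x$3))"
  shows "\<beta>$1 + \<beta>$2 + \<beta>$3 = (\<Sum>p\<in>unit_vertices. \<Sum>i\<in>UNIV. (2 * p$i - 1) / 4 * q p $ i)"
  unfolding sum_unit_vertices sum_3 assms by (simp add: ert_poly_def field_simps)

lemma ert_poly_moment:
  assumes "q = (\<lambda>x. ert_poly \<alpha> \<beta> c (x$1) (x$2) (x$3))"
  shows "ert_moment \<alpha> \<beta> c $ l = (\<Sum>p\<in>unit_vertices. \<Sum>i\<in>UNIV.
           (if i = l then 1/8 else (2 * p$i - 1) * (2 * p$l - 1) / 24) * q p $ i)"
  unfolding sum_unit_vertices sum_3 assms
  using exhaust_3[of l] by (elim disjE) (simp_all add: ert_poly_def ert_moment_def field_simps)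

text \<open>The pair \<open>(p, i)\<close> stands for the normal component at the corner
  \<open>p\<close> on the facet of direction \<open>i\<close> through it. If it is the only nonzero
  one, the sums of \<open>ert_poly_flux\<close> and \<open>ert_poly_moment\<close> reduce to one
  term. The gradients \<open>D\<close> are supplied for the integration by parts.\<close>

lemma ERT0_dual_moments:
  assumes "q \<in> ERT0" "p \<in> unit_vertices"
    and zero: "\<And>p' i'. p' \<in> unit_vertices \<Longrightarrow> (p', i') \<noteq> (p, i) \<Longrightarrow> q p' $ i' = 0"
  obtains D c where
    "\<And>i x. GDERIV (\<lambda>x. q x $ i) x :> D i x" "\<And>i. continuous_on UNIV (D i)"
    "\<And>x. (\<Sum>i\<in>UNIV. D i x $ i) = c"
    "c = (2 * p$i - 1) / 4 * q p $ i"
    "(q has_integral (\<chi> l. (if i = l then 1/8 else (2 * p$i - 1) * (2 * p$l - 1) / 24) * q p $ i)) ref_cube"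
proof -
  obtain \<alpha> \<beta> k where q: "q = (\<lambda>x. ert_poly \<alpha> \<beta> k (x$1) (x$2) (x$3))"
    using ERT0_ert_poly[OF assms(1)] by blast
  have fin: "finite unit_vertices" by (simp add: unit_vertices_eq)
  have single: "(\<Sum>p'\<in>unit_vertices. \<Sum>i'\<in>UNIV. W p' i' * q p' $ i') = W p i * q p $ i" for W
  proof -
    have "(\<Sum>p'\<in>unit_vertices. \<Sum>i'\<in>UNIV. W p' i' * q p' $ i') =
        (\<Sum>p'\<in>unit_vertices. if p' = p then \<Sum>i'\<in>UNIV. W p i' * q p $ i' else 0)"
      using zero by (intro sum.cong) auto
    also have "\<dots> = (\<Sum>i'\<in>UNIV. W p i' * q p $ i')" using assms(2) fin by simp
    also have "\<dots> = (\<Sum>i'\<in>UNIV. if i' = i then W p i * q p $ i else 0)"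
      using zero assms(2) by (intro sum.cong) auto
    finally show ?thesis by simp
  qed
  \<comment> \<open>The gradients of the three components of \<open>ert_poly\<close>. Their diagonal
    entries add up to a constant, because the curl part is divergence free.\<close>
  define D where "D = (\<lambda>(i::3) (x::vec3). if i = 1 then
      vector [\<beta>$1 - 3*k 2*x$2 - 3*k 3*x$3 - 4*k 5*x$2*x$3 + 2*k 8*x$1 + k 10*x$3 + 2*k 11*x$1*x$3 + 2*k 15*x$1 + k 16*x$2 + 2*k 17*x$1*x$2,
              - 3*k 0 - 3*k 2*x$1 - 4*k 4*x$3 - 4*k 5*x$1*x$3 + k 16*x$1 + k 17*(x$1)^2,
              - 3*k 1 - 3*k 3*x$1 - 4*k 4*x$2 - 4*k 5*x$1*x$2 + k 10*x$1 + k 11*(x$1)^2]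
    else if i = 2 then
      vector [- 3*k 6 - 3*k 8*x$2 - 4*k 9*x$3 - 4*k 11*x$2*x$3 + k 15*x$2 + k 17*(x$2)^2,
              \<beta>$2 - 3*k 8*x$1 - 3*k 10*x$3 - 4*k 11*x$1*x$3 + 2*k 2*x$2 + k 3*x$3 + 2*k 5*x$2*x$3 + k 15*x$1 + 2*k 16*x$2 + 2*k 17*x$1*x$2,
              - 3*k 7 - 4*k 9*x$1 - 3*k 10*x$2 - 4*k 11*x$1*x$2 + k 3*x$2 + k 5*(x$2)^2]
    else
      vector [- 3*k 12 - 4*k 14*x$2 - 3*k 15*x$3 - 4*k 17*x$2*x$3 + k 8*x$3 + k 11*(x$3)^2,
              - 3*k 13 - 4*k 14*x$1 - 3*k 16*x$3 - 4*k 17*x$1*x$3 + k 2*x$3 + k 5*(x$3)^2,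
              \<beta>$3 - 3*k 15*x$1 - 3*k 16*x$2 - 4*k 17*x$1*x$2 + k 2*x$2 + 2*k 3*x$3 + 2*k 5*x$2*x$3 + k 8*x$1 + 2*k 10*x$3 + 2*k 11*x$1*x$3] :: vec3)"
  show thesis
  proof (rule that)
    have "GDERIV (\<lambda>x. q x $ 1) x :> D 1 x" "GDERIV (\<lambda>x. q x $ 2) x :> D 2 x" "GDERIV (\<lambda>x. q x $ 3) x :> D 3 x" for x
      unfolding gderiv_def q ert_poly_def D_def
      by (auto intro!: derivative_eq_intros bounded_linear_imp_has_derivative bounded_linear_vec_nth
          simp: fun_eq_iff inner_vec_def sum_3 power2_eq_square algebra_simps)
    then show "GDERIV (\<lambda>x. q x $ i) x :> D i x" for i x
      using exhaust_3[of i] by auto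
    have "continuous_on UNIV (\<lambda>x. D 1 x $ j)" "continuous_on UNIV (\<lambda>x. D 2 x $ j)"
         "continuous_on UNIV (\<lambda>x. D 3 x $ j)" for j
      using exhaust_3[of j] by (elim disjE; simp add: D_def; intro continuous_intros)+
    then have "continuous_on UNIV (\<lambda>x. D i x $ j)" for i j
      using exhaust_3[of i] by auto
    then have "continuous_on UNIV (\<lambda>x. \<chi> j. D i x $ j)" for i
      by (intro continuous_on_vec_lambda) auto
    then show "continuous_on UNIV (D i)" for i by simp
    show "(\<Sum>i\<in>UNIV. D i x $ i) = \<beta>$1 + \<beta>$2 + \<beta>$3" for x
      by (simp add: sum_3 D_def algebra_simps)
    show "\<beta>$1 + \<beta>$2 + \<beta>$3 = (2 * p$i - 1) / 4 * q p $ i"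
      unfolding ert_poly_flux[OF q] by (rule single)
    have "ert_moment \<alpha> \<beta> k $ l = (if i = l then 1/8 else (2 * p$i - 1) * (2 * p$l - 1) / 24) * q p $ i" for l
      unfolding ert_poly_moment[OF q] by (rule single)
    then have "(\<chi> l. (if i = l then 1/8 else (2 * p$i - 1) * (2 * p$l - 1) / 24) * q p $ i) = ert_moment \<alpha> \<beta> k"
      by (simp add: vec_eq_iff)
    then show "(q has_integral (\<chi> l. (if i = l then 1/8 else (2 * p$i - 1) * (2 * p$l - 1) / 24) * q p $ i)) ref_cube"
      using has_integral_ert_poly[of \<alpha> \<beta> k] by (simp only: q)
  qed
qed

section \<open>Compactly supported functions\<close>

lemma integrable_compact_support:
  fixes f :: "'a::euclidean_space \<Rightarrow> real"
  assumes "continuous_on UNIV f" "compact K" "\<And>x. x \<notin> K \<Longrightarrow> f x = 0"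
  shows "integrable lborel f"
proof -
  have "integrable lborel (\<lambda>x. indicator K x *\<^sub>R f x)"
    using assms by (intro borel_integrable_compact) (auto intro: continuous_on_subset)
  moreover have "(\<lambda>x. indicator K x *\<^sub>R f x) = f"
    using assms(3) by (auto simp: indicator_def fun_eq_iff)
  ultimately show ?thesis by simp
qed

lemma GDERIV_zero_outside_compact:
  fixes F :: "'a::euclidean_space \<Rightarrow> real"
  assumes "GDERIV F x :> g" "compact K" "\<And>x. x \<notin> K \<Longrightarrow> F x = 0" "x \<notin> K"
  shows "g = 0"
proof -
  have "open (- K)" using assms(2) by (simp add: compact_imp_closed open_Compl)
  have "((\<lambda>_. 0) has_derivative (\<lambda>h. h \<bullet> g)) (at x)"
    by (rule has_derivative_transform_within_open[OF assms(1)[unfolded gderiv_def] \<open>open (- K)\<close>])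
       (use assms(3,4) in auto)
  moreover have "((\<lambda>_. 0) has_derivative (\<lambda>h. 0)) (at x)" by (rule has_derivative_const)
  ultimately have "(\<lambda>h. h \<bullet> g) = (\<lambda>h. 0)" by (rule has_derivative_unique)
  from fun_cong[OF this, of g] show ?thesis by simp
qed

lemma continuous_GDERIV: "(\<And>x. GDERIV F x :> G x) \<Longrightarrow> continuous_on S F"
  by (meson continuous_at_imp_continuous_on gderiv_def has_derivative_continuous)

text \<open>By translation invariance the difference quotients in direction \<open>a\<close> integrate to zero.\<close>

lemma integral_directional_derivative_zero:
  fixes F :: "'a::euclidean_space \<Rightarrow> real"
  assumes deriv: "\<And>x. GDERIV F x :> G x" and cont: "continuous_on UNIV G"
    and K: "compact K" "\<And>x. x \<notin> K \<Longrightarrow> F x = 0"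
  shows "integral\<^sup>L lborel (\<lambda>x. G x \<bullet> a) = 0"
proof -
  have contF: "continuous_on UNIV F" using deriv by (rule continuous_GDERIV)
  have intF: "integrable lborel F" using contF K by (rule integrable_compact_support)
  have G0: "G x = 0" if "x \<notin> K" for x
    using GDERIV_zero_outside_compact[OF deriv K that] .
  have "bounded (G ` K)"
    using compact_continuous_image[OF continuous_on_subset[OF cont] K(1)] compact_imp_bounded by blast
  then obtain M where M: "M > 0" "\<And>x. x \<in> K \<Longrightarrow> norm (G x) \<le> M"
    by (auto simp: bounded_pos)
  then have M': "norm (G x) \<le> M" for x using G0[of x] by (cases "x \<in> K") auto
  \<comment> \<open>A global Lipschitz bound, which provides the majorant of the difference
    quotients.\<close>
  have lip: "\<bar>F x - F y\<bar> \<le> M * norm (x - y)" for x y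
  proof -
    have "norm (F x - F y) \<le> M * norm (x - y)"
    proof (rule differentiable_bound[of UNIV F "\<lambda>x h. h \<bullet> G x"])
      show "(F has_derivative (\<lambda>h. h \<bullet> G x)) (at x within UNIV)" for x
        using deriv by (simp add: gderiv_def)
      show "onorm (\<lambda>h. h \<bullet> G x) \<le> M" for x
      proof (rule onorm_bound)
        show "norm (h \<bullet> G x) \<le> M * norm h" for h
          using Cauchy_Schwarz_ineq2[of h "G x"] mult_left_mono[OF M'[of x] norm_ge_zero[of h]]
          by (simp add: mult.commute)
      qed (use M in simp)
    qed auto
    then show ?thesis by simp
  qed
  define s where "s n x = (F (x + (1 / real (Suc n)) *\<^sub>R a) - F x) * real (Suc n)" for n x
  \<comment> \<open>Contains the supports of all difference quotients \<open>s n\<close>, whose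
    shifts have length at most \<open>norm a\<close>.\<close>
  define K' where "K' = {x + y | x y. x \<in> K \<and> y \<in> cball 0 (norm a)}"
  have "compact K'" unfolding K'_def using K(1) by (intro compact_sums) auto
  have int: "integrable lborel (\<lambda>x. F (x + b))" for b
  proof -
    have "integrable (distr lborel borel ((+) b)) F" using intF by (simp add: lborel_distr_plus)
    then have "integrable lborel (\<lambda>x. F (b + x))" 
      by (subst (asm) integrable_distr_eq) (simp_all add: borel_measurable_continuous_onI[OF contF])
    then show ?thesis by (simp add: add.commute)
  qed
  have "integral\<^sup>L lborel (\<lambda>x. F (x + b)) = integral\<^sup>L lborel F" for b
  proof -
    have "integral\<^sup>L (distr lborel borel ((+) b)) F = integral\<^sup>L lborel (\<lambda>x. F (b + x))"
      by (rule integral_distr[OF _ borel_measurable_continuous_onI[OF contF]]) simp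
    then show ?thesis by (simp add: lborel_distr_plus add.commute)
  qed
  then have s0: "integral\<^sup>L lborel (s n) = 0" for n
    unfolding s_def using int intF by simp
  have "(\<lambda>n. integral\<^sup>L lborel (s n)) \<longlonglongrightarrow> integral\<^sup>L lborel (\<lambda>x. G x \<bullet> a)"
  proof (rule integral_dominated_convergence[where w = "\<lambda>x. indicator K' x *\<^sub>R (M * norm a)"])
    show "(\<lambda>x. G x \<bullet> a) \<in> borel_measurable lborel"
      using cont by (auto intro!: borel_measurable_continuous_onI continuous_intros)
    show "s n \<in> borel_measurable lborel" for n
      unfolding s_def using int intF by (intro borel_measurable_times borel_measurable_diff) auto
    show "integrable lborel (\<lambda>x. indicator K' x *\<^sub>R (M * norm a))"
      using \<open>compact K'\<close> by (intro borel_integrable_compact continuous_on_const)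
    show "AE x in lborel. (\<lambda>n. s n x) \<longlonglongrightarrow> G x \<bullet> a"
    proof (rule AE_I2)
      fix x
      have "((\<lambda>t. x + t *\<^sub>R a) has_derivative (\<lambda>h. h *\<^sub>R a)) (at 0)"
        by (auto intro!: derivative_eq_intros)
      then have "((\<lambda>t. F (x + t *\<^sub>R a)) has_derivative (\<lambda>h. (h *\<^sub>R a) \<bullet> G (x + 0 *\<^sub>R a))) (at 0)"
        using deriv[of "x + 0 *\<^sub>R a"] unfolding gderiv_def by (rule has_derivative_compose)
      then have "((\<lambda>t. F (x + t *\<^sub>R a)) has_field_derivative (G x \<bullet> a)) (at 0)"
        by (simp add: has_field_derivative_def inner_commute mult_commute_abs)
      then have "(\<lambda>h. (F (x + h *\<^sub>R a) - F x) / h) \<midarrow>0\<rightarrow> G x \<bullet> a"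
        by (simp add: DERIV_def)
      moreover have "filterlim (\<lambda>n. 1 / real (Suc n)) (at 0) sequentially"
        using LIMSEQ_Suc[OF lim_1_over_n] by (auto simp: filterlim_at intro!: always_eventually)
      ultimately have "(\<lambda>n. (F (x + (1 / real (Suc n)) *\<^sub>R a) - F x) / (1 / real (Suc n))) \<longlonglongrightarrow> G x \<bullet> a"
        by (rule filterlim_compose)
      then show "(\<lambda>n. s n x) \<longlonglongrightarrow> G x \<bullet> a" by (simp add: s_def)
    qed
    show "AE x in lborel. norm (s n x) \<le> indicator K' x *\<^sub>R (M * norm a)" for n
    proof (rule AE_I2)
      fix x
      define h where "h = 1 / real (Suc n)"
      have h: "0 < h" "h \<le> 1" by (auto simp: h_def)
      show "norm (s n x) \<le> indicator K' x *\<^sub>R (M * norm a)"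
      proof (cases "x \<in> K'")
        case True
        have "norm (s n x) = \<bar>F (x + h *\<^sub>R a) - F x\<bar> * (1 / h)"
          by (simp add: s_def h_def abs_mult)
        also have "\<dots> \<le> (M * norm (h *\<^sub>R a)) * (1 / h)"
          using lip[of "x + h *\<^sub>R a" x] h by (intro mult_right_mono) auto
        also have "\<dots> = M * norm a" using h by simp
        finally show ?thesis using True by simp
      next
        case False
        have "x \<notin> K"
        proof
          assume "x \<in> K"
          then have "x + 0 \<in> K'" unfolding K'_def by force
          then show False using False by simp
        qed
        moreover have "x + h *\<^sub>R a \<notin> K"
        proof
          assume k: "x + h *\<^sub>R a \<in> K"
          have "norm (- (h *\<^sub>R a)) \<le> norm a" using h mult_left_le_one_le[of "norm a" h] by simp
          then have "- (h *\<^sub>R a) \<in> cball 0 (norm a)" by simp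
          then have "(x + h *\<^sub>R a) + (- (h *\<^sub>R a)) \<in> K'" unfolding K'_def using k by blast
          then show False using False by simp
        qed
        ultimately show ?thesis using False K(2) by (simp add: s_def h_def)
      qed
    qed
  qed
  then show ?thesis by (simp add: s0 LIMSEQ_const_iff)
qed

subsection \<open>Cutoff functions on a cuboid\<close>

text \<open>Squaring the positive part gives a function with one continuous derivative, which is as
  much as \<open>test_function\<close> asks for.\<close>

definition pos_square :: "real \<Rightarrow> real" where "pos_square s = (max 0 s)\<^sup>2"

lemma DERIV_pos_square: "(pos_square has_real_derivative 2 * max 0 s) (at s)"
proof -
  \<comment> \<open>Since \<open>pos_square s\<close> is half the sum of the square of
    \<open>s\<close> and \<open>s * \<bar>s\<bar>\<close>, only the latter needs care, at 0.\<close>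
  have abs: "((\<lambda>s. s * \<bar>s\<bar>) has_real_derivative 2 * \<bar>s\<bar>) (at s)" for s :: real
  proof -
    consider "s > 0" | "s < 0" | "s = 0" by linarith
    then show ?thesis
    proof cases
      case 1
      show ?thesis
        by (rule has_field_derivative_transform_within_open[of "\<lambda>s. s * s" _ _ "{0<..}"])
           (use 1 in \<open>auto intro!: derivative_eq_intros\<close>)
    next
      case 2
      show ?thesis
        by (rule has_field_derivative_transform_within_open[of "\<lambda>s. - (s * s)" _ _ "{..<0}"])
           (use 2 in \<open>auto intro!: derivative_eq_intros\<close>)
    next
      case 3
      have "(\<lambda>h::real. \<bar>h\<bar>) \<midarrow>0\<rightarrow> \<bar>0\<bar>" by (intro tendsto_intros)
      then have "(\<lambda>h::real. (h * \<bar>h\<bar>) / h) \<midarrow>0\<rightarrow> 0"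
        using LIM_equal[of 0 "\<lambda>h::real. h * \<bar>h\<bar> / h" abs 0] by simp
      then show ?thesis by (simp add: 3 DERIV_def)
    qed
  qed
  have eq: "pos_square = (\<lambda>s. (s\<^sup>2 + s * \<bar>s\<bar>) / 2)"
    by (auto simp: pos_square_def max_def power2_eq_square fun_eq_iff)
  show ?thesis
  proof -
    have "((\<lambda>s. (s\<^sup>2 + s * \<bar>s\<bar>) / 2) has_real_derivative (2 * s + 2 * \<bar>s\<bar>) / 2) (at s)"
      by (intro DERIV_cdivide DERIV_add abs) (auto intro!: derivative_eq_intros)
    moreover have "(2 * s + 2 * \<bar>s\<bar>) / 2 = 2 * max 0 s" by (simp add: max_def)
    ultimately show ?thesis unfolding eq by (simp only:)
  qed
qed

text \<open>A continuously differentiable step that rises from 0 at 0 to 1 at 1 and is constant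
  outside the unit interval.\<close>

definition cutoff :: "real \<Rightarrow> real" where "cutoff s = 1 - pos_square (1 - pos_square s)"

lemma DERIV_cutoff:
  "(cutoff has_real_derivative 4 * max 0 (1 - pos_square s) * max 0 s) (at s)"
  unfolding cutoff_def
  by (auto intro!: derivative_eq_intros DERIV_chain2[OF DERIV_pos_square] DERIV_pos_square)

lemma cutoff_bounds: "0 \<le> cutoff s" "cutoff s \<le> 1"
  and cutoff_zero: "s \<le> 0 \<Longrightarrow> cutoff s = 0"
  and cutoff_one: "s \<ge> 1 \<Longrightarrow> cutoff s = 1"
proof -
  have "0 \<le> max 0 (1 - pos_square s)" "max 0 (1 - pos_square s) \<le> 1"
    by (auto simp: pos_square_def)
  then have "(max 0 (1 - pos_square s))\<^sup>2 \<le> 1" by (simp add: power_le_one)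
  then show "0 \<le> cutoff s" by (simp add: cutoff_def pos_square_def)
  show "cutoff s \<le> 1" by (simp add: cutoff_def pos_square_def)
  show "s \<le> 0 \<Longrightarrow> cutoff s = 0" by (simp add: cutoff_def pos_square_def max_def)
  assume "s \<ge> 1"
  then have "pos_square s \<ge> 1" by (simp add: pos_square_def max_def one_le_power)
  then show "cutoff s = 1" by (simp add: cutoff_def pos_square_def[of "1 - _"] max_def)
qed

lemma GDERIV_coord: "GDERIV (coord r i) x :> edge r i /\<^sub>R (edge r i \<bullet> edge r i)"
proof -
  have "((\<lambda>x. (x - r 1) \<bullet> (edge r i /\<^sub>R (edge r i \<bullet> edge r i))) has_derivative
      (\<lambda>h. h \<bullet> (edge r i /\<^sub>R (edge r i \<bullet> edge r i)))) (at x)"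
    by (auto intro!: derivative_eq_intros)
  then show ?thesis
    unfolding gderiv_def coord_def by (simp add: divide_inverse mult.commute)
qed

text \<open>A product of one-dimensional cutoffs in the three element coordinates; these functions
  localise the weak divergence to one element.\<close>

lemma cuboid_cutoff:
  assumes cub: "cuboid E r"
  obtains \<phi> :: "nat \<Rightarrow> vec3 \<Rightarrow> real" and g K where
    "\<And>n x. GDERIV (\<phi> n) x :> g n x" "\<And>n. continuous_on UNIV (g n)"
    "\<And>n. compact (K n)" "\<And>n. K n \<subseteq> interior E" "\<And>n x. x \<notin> K n \<Longrightarrow> \<phi> n x = 0"
    "\<And>n x. 0 \<le> \<phi> n x" "\<And>n x. \<phi> n x \<le> 1" "\<And>x. x \<in> interior E \<Longrightarrow> (\<lambda>n. \<phi> n x) \<longlonglongrightarrow> 1"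
proof -
  \<comment> \<open>At a fixed \<open>t\<close> strictly between 0 and 1 this exceeds 1 for large
    \<open>n\<close>, while for fixed \<open>n\<close> it is nonnegative only on a compact part of
    the open unit interval.\<close>
  define s where "s n t = real n * (t * (1 - t)) - 1" for n t
  define a where "a i = edge r i /\<^sub>R (edge r i \<bullet> edge r i)" for i
  define \<psi> where "\<psi> n i x = cutoff (s n (coord r i x))" for n i x
  define \<psi>' where "\<psi>' n i x = (4 * max 0 (1 - pos_square (s n (coord r i x))) * max 0 (s n (coord r i x))
      * (real n * (1 - 2 * coord r i x))) *\<^sub>R a i" for n i x
  have \<psi>: "GDERIV (\<psi> n i) x :> \<psi>' n i x" for n i x
  proof -
    have "((\<lambda>t. cutoff (s n t)) has_real_derivative
       4 * max 0 (1 - pos_square (s n t)) * max 0 (s n t) * (real n * (1 - 2 * t))) (at t)" for t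
      unfolding s_def
      by (rule DERIV_chain2[OF DERIV_cutoff]) (auto intro!: derivative_eq_intros simp: algebra_simps)
    from GDERIV_DERIV_compose[OF GDERIV_coord this]
    show ?thesis by (simp add: \<psi>_def[abs_def] \<psi>'_def a_def)
  qed
  have c\<psi>: "continuous_on UNIV (\<psi> n i)" for n i using \<psi> by (rule continuous_GDERIV)
  have c\<psi>': "continuous_on UNIV (\<psi>' n i)" for n i
    unfolding \<psi>'_def s_def pos_square_def by (intro continuous_intros)
  define \<phi> where "\<phi> n x = \<psi> n 1 x * (\<psi> n 2 x * \<psi> n 3 x)" for n x
  define g where "g n x = \<psi> n 1 x *\<^sub>R (\<psi> n 2 x *\<^sub>R \<psi>' n 3 x + \<psi> n 3 x *\<^sub>R \<psi>' n 2 x)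
      + (\<psi> n 2 x * \<psi> n 3 x) *\<^sub>R \<psi>' n 1 x" for n x
  define K where "K n = {x. \<forall>i. s n (coord r i x) \<ge> 0}" for n
  have \<psi>01: "0 \<le> \<psi> n i x" "\<psi> n i x \<le> 1" for n i x
    using cutoff_bounds by (auto simp: \<psi>_def)
  show thesis
  proof (rule that)
    show "GDERIV (\<phi> n) x :> g n x" for n x
      unfolding \<phi>_def[abs_def] g_def by (intro GDERIV_mult \<psi>)
    show "continuous_on UNIV (g n)" for n
      unfolding g_def by (intro continuous_intros c\<psi> c\<psi>')
    show sub: "K n \<subseteq> interior E" for n
    proof
      fix x assume "x \<in> K n"
      then have "0 < coord r i x \<and> coord r i x < 1" for i
      proof -
        have "real n * (coord r i x * (1 - coord r i x)) \<ge> 1"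
          using \<open>x \<in> K n\<close> by (simp add: K_def s_def)
        then have "coord r i x * (1 - coord r i x) > 0"
          by (smt (verit) mult_nonneg_nonpos of_nat_0_le_iff)
        then show ?thesis by (auto simp: zero_less_mult_iff)
      qed
      then show "x \<in> interior E" by (simp add: interior_cuboid[OF cub])
    qed
    show "compact (K n)" for n
    proof -
      have "K n = (\<Inter>i. {x. 0 \<le> s n (coord r i x)})" by (auto simp: K_def)
      also have "closed \<dots>"
        unfolding s_def by (intro closed_INT ballI closed_Collect_le continuous_intros)
      finally have "closed (K n)" .
      moreover have "bounded (K n)"
        using compact_imp_bounded[OF compact_cuboid[OF cub]] sub[of n] interior_subset
        by (meson bounded_subset order_trans)
      ultimately show ?thesis by (simp add: compact_eq_bounded_closed)
    qed
    show "\<phi> n x = 0" if nK: "x \<notin> K n" for n x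
    proof -
      obtain i where "s n (coord r i x) \<le> 0" using nK less_imp_le by (auto simp: K_def not_le)
      then have "\<psi> n i x = 0" by (simp add: \<psi>_def cutoff_zero)
      then show ?thesis using exhaust_3[of i] by (auto simp: \<phi>_def)
    qed
    show "0 \<le> \<phi> n x" "\<phi> n x \<le> 1" for n x
      using \<psi>01 by (auto simp: \<phi>_def intro!: mult_le_one mult_nonneg_nonneg)
    show "(\<lambda>n. \<phi> n x) \<longlonglongrightarrow> 1" if "x \<in> interior E" for x
    proof -
      have "eventually (\<lambda>n. \<psi> n i x = 1) sequentially" for i
      proof -
        define w where "w = coord r i x * (1 - coord r i x)"
        have "w > 0" using that by (simp add: w_def interior_cuboid[OF cub])
        obtain N where N: "real N > 2 / w" using reals_Archimedean2 by blast
        show ?thesis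
        proof (rule eventually_sequentiallyI)
          fix n assume "N \<le> n"
          then have "real n > 2 / w" using N by linarith
          then have "real n * w > 2" using \<open>w > 0\<close> by (simp add: pos_divide_less_eq)
          then show "\<psi> n i x = 1" by (simp add: \<psi>_def s_def cutoff_one flip: w_def)
        qed
      qed
      then have "eventually (\<lambda>n. \<psi> n 1 x = 1 \<and> \<psi> n 2 x = 1 \<and> \<psi> n 3 x = 1) sequentially"
        by (intro eventually_conj)
      then have "eventually (\<lambda>n. \<phi> n x = 1) sequentially"
        by eventually_elim (simp add: \<phi>_def)
      then show ?thesis by (rule tendsto_eventually)
    qed
  qed
qed

section \<open>Piola transforms\<close>

definition coord_vec :: "(nat \<Rightarrow> vec3) \<Rightarrow> vec3 \<Rightarrow> vec3" where
  "coord_vec r x = (\<chi> l. coord r l x)"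

lemma coord_vec_nth: "coord_vec r x $ l = coord r l x"
  by (simp add: coord_vec_def)

definition piola :: "(nat \<Rightarrow> vec3) \<Rightarrow> (vec3 \<Rightarrow> vec3) \<Rightarrow> vec3 \<Rightarrow> vec3" where
  "piola r q x = (1 / \<bar>det (elem_jac r)\<bar>) *\<^sub>R (\<Sum>i\<in>UNIV. q (coord_vec r x) $ i *\<^sub>R edge r i)"

lemma elem_jac_nth: "elem_jac r $ m $ i = edge r i $ m"
  using exhaust_3[of i] by (auto simp: elem_jac_def transpose_def)

lemma elem_jac_mult: "elem_jac r *v x = (\<Sum>i\<in>UNIV. x $ i *\<^sub>R edge r i)"
  by (simp add: vec_eq_iff matrix_vector_mult_def elem_jac_nth mult.commute)

lemma continuous_coord_vec: "continuous_on S (coord_vec r)"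
  unfolding coord_vec_def by (intro continuous_on_vec_lambda continuous_intros)

context
  fixes E :: "vec3 set" and r :: "nat \<Rightarrow> vec3"
  assumes cub: "cuboid E r"
begin

lemma det_elem_jac_nonzero: "det (elem_jac r) \<noteq> 0"
proof -
  have "x = 0" if "elem_jac r *v x = 0" for x
  proof -
    have "elem_map r x = elem_map r 0" using that by (simp add: elem_map_edge elem_jac_mult)
    then show ?thesis using inj_elem_map[OF cub] by (simp add: inj_eq)
  qed
  then have "\<exists>B. B ** elem_jac r = mat 1" by (simp add: matrix_left_invertible_ker)
  then have "invertible (elem_jac r)"
    using matrix_left_right_inverse by (auto simp: invertible_def)
  then show ?thesis by (simp add: invertible_det_nz)
qed

lemma coord_vec_elem_map: "coord_vec r (elem_map r x) = x"
  by (simp add: coord_vec_def coord_elem_map[OF cub])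

text \<open>Change of variables by \<open>elem_map r\<close>, whose derivative is the constant
  matrix \<open>elem_jac r\<close>.\<close>

lemma has_integral_cuboid:
  fixes h :: "vec3 \<Rightarrow> vec3"
  assumes "continuous_on UNIV h" "(h has_integral v) ref_cube"
  shows "(\<lambda>x. h (coord_vec r x)) absolutely_integrable_on E"
    and "integral E (\<lambda>x. h (coord_vec r x)) = \<bar>det (elem_jac r)\<bar> *\<^sub>R v"
proof -
  have d: "(elem_map r has_derivative (\<lambda>h. elem_jac r *v h)) (at x within S)" for x S
    unfolding elem_map_edge[abs_def] elem_jac_mult
    by (auto intro!: derivative_eq_intros bounded_linear_imp_has_derivative bounded_linear_vec_nth)
  have inj: "inj_on (elem_map r) ref_cube"
    using inj_elem_map[OF cub] inj_on_subset by blast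
  have "h absolutely_integrable_on ref_cube"
    unfolding ref_cube_cbox
    by (intro absolutely_integrable_continuous continuous_on_subset[OF assms(1)]) auto
  then have "(\<lambda>x. \<bar>det (elem_jac r)\<bar> *\<^sub>R h x) absolutely_integrable_on ref_cube"
    by (intro absolutely_integrable_scaleR_left)
  moreover have "integral ref_cube (\<lambda>x. \<bar>det (elem_jac r)\<bar> *\<^sub>R h x) = \<bar>det (elem_jac r)\<bar> *\<^sub>R v"
    using assms(2) by (intro integral_unique has_integral_cmul)
  moreover have "ref_cube \<in> sets lebesgue" unfolding ref_cube_cbox by simp
  moreover have "E = elem_map r ` ref_cube" using cub by (simp add: cuboid_def)
  ultimately show "(\<lambda>x. h (coord_vec r x)) absolutely_integrable_on E"
    "integral E (\<lambda>x. h (coord_vec r x)) = \<bar>det (elem_jac r)\<bar> *\<^sub>R v"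
    using has_absolute_integral_change_of_variables[OF _ d inj, of "\<lambda>x. h (coord_vec r x)"
        "\<bar>det (elem_jac r)\<bar> *\<^sub>R v"]
    by (simp_all add: coord_vec_elem_map)
qed

lemma interior_cuboid_integral:
  fixes f :: "vec3 \<Rightarrow> 'b::euclidean_space"
  assumes "f absolutely_integrable_on E"
  shows "integrable (lebesgue_on (interior E)) f"
    and "integral\<^sup>L (lebesgue_on (interior E)) f = integral E f"
proof -
  have "f absolutely_integrable_on interior E"
    by (rule set_integrable_subset[OF assms]) (auto simp: interior_subset)
  then show int: "integrable (lebesgue_on (interior E)) f"
    by (rule absolutely_integrable_imp_integrable) auto
  have "integral\<^sup>L (lebesgue_on (interior E)) f = integral (interior E) f"
    using int by (rule lebesgue_integral_eq_integral) auto
  also have "\<dots> = integral E f"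
  proof (rule integral_unique)
    have "(f has_integral integral E f) E"
      using assms by (intro integrable_integral) (simp add: absolutely_integrable_on_def)
    then show "(f has_integral integral E f) (interior E)"
      using has_integral_interior[OF negligible_convex_frontier[OF convex_cuboid[OF cub]]] by blast
  qed
  finally show "integral\<^sup>L (lebesgue_on (interior E)) f = integral E f" .
qed

lemma measure_interior_cuboid: "measure lebesgue (interior E) = \<bar>det (elem_jac r)\<bar>"
proof -
  \<comment> \<open>A constant vector field takes the place of the constant 1, as
    \<open>has_integral_cuboid\<close> is about vector-valued integrands.\<close>
  have "((\<lambda>x. axis 1 1 :: vec3) has_integral axis 1 1) ref_cube"
  proof -
    have "measure lborel (cbox 0 (1::vec3)) = 1"
      by (subst content_cbox_cart) (auto simp: interval_ne_empty_cart)
    then show ?thesis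
      using has_integral_const[of "axis 1 1 :: vec3" "0::vec3" 1] unfolding ref_cube_cbox by simp
  qed
  note * = has_integral_cuboid[OF continuous_on_const this]
  have "integral\<^sup>L (lebesgue_on (interior E)) (\<lambda>x. axis 1 1 :: vec3) = \<bar>det (elem_jac r)\<bar> *\<^sub>R axis 1 1"
    using interior_cuboid_integral(2)[OF *(1)] *(2) by simp
  then have "measure lebesgue (interior E) *\<^sub>R (axis 1 1 :: vec3) = \<bar>det (elem_jac r)\<bar> *\<^sub>R axis 1 1"
    by (simp add: measure_restrict_space)
  then show ?thesis by simp
qed

text \<open>The factor of the Piola transform cancels the Jacobian determinant of the change of
  variables.\<close>

lemma integral_piola:
  assumes "continuous_on UNIV q" "(q has_integral v) ref_cube"
  shows "integrable (lebesgue_on (interior E)) (piola r q)"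
    and "integral\<^sup>L (lebesgue_on (interior E)) (piola r q) = (\<Sum>i\<in>UNIV. v $ i *\<^sub>R edge r i)"
proof -
  let ?J = "\<bar>det (elem_jac r)\<bar>"
  note * = has_integral_cuboid[OF assms]
  have int: "integrable (lebesgue_on (interior E)) (\<lambda>x. q (coord_vec r x))"
    and eq: "integral\<^sup>L (lebesgue_on (interior E)) (\<lambda>x. q (coord_vec r x)) = ?J *\<^sub>R v"
    using interior_cuboid_integral[OF *(1)] *(2) by simp_all
  have inti: "integrable (lebesgue_on (interior E)) (\<lambda>x. q (coord_vec r x) $ i)" for i
    using integrable_bounded_linear[OF bounded_linear_vec_nth int] .
  have eqi: "integral\<^sup>L (lebesgue_on (interior E)) (\<lambda>x. q (coord_vec r x) $ i) = ?J * v $ i" for i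
    using integral_bounded_linear[OF bounded_linear_vec_nth[of i] int] eq by simp
  show "integrable (lebesgue_on (interior E)) (piola r q)"
    unfolding piola_def[abs_def] using inti by simp
  show "integral\<^sup>L (lebesgue_on (interior E)) (piola r q) = (\<Sum>i\<in>UNIV. v $ i *\<^sub>R edge r i)"
    unfolding piola_def[abs_def] using inti det_elem_jac_nonzero
    by (simp add: eqi scaleR_sum_right)
qed

text \<open>The second claim says that differentiating along the edge \<open>i\<close> amounts to
  the \<open>i\<close>-th partial derivative on the reference cube; it rests on the orthogonality of
  the edges.\<close>

lemma GDERIV_comp_coord_vec:
  assumes "GDERIV f (coord_vec r x) :> D"
  shows "GDERIV (\<lambda>x. f (coord_vec r x)) x :> (\<Sum>l\<in>UNIV. D $ l *\<^sub>R (edge r l /\<^sub>R (edge r l \<bullet> edge r l)))"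
    and "(\<Sum>l\<in>UNIV. D $ l *\<^sub>R (edge r l /\<^sub>R (edge r l \<bullet> edge r l))) \<bullet> edge r i = D $ i"
proof -
  have "(coord_vec r has_derivative (\<lambda>h. \<chi> l. h \<bullet> (edge r l /\<^sub>R (edge r l \<bullet> edge r l)))) (at x)"
    unfolding coord_vec_def[abs_def] using GDERIV_coord
    by (subst has_derivative_componentwise_within)
       (auto simp: Basis_vec_def inner_axis gderiv_def)
  from has_derivative_compose[OF this, of f "\<lambda>h. h \<bullet> D"] assms
  have "((\<lambda>x. f (coord_vec r x)) has_derivative
      (\<lambda>h. (\<chi> l. h \<bullet> (edge r l /\<^sub>R (edge r l \<bullet> edge r l))) \<bullet> D)) (at x)"
    by (simp add: gderiv_def)
  then show "GDERIV (\<lambda>x. f (coord_vec r x)) x :> (\<Sum>l\<in>UNIV. D $ l *\<^sub>R (edge r l /\<^sub>R (edge r l \<bullet> edge r l)))"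
    unfolding gderiv_def
    by (simp add: inner_vec_def[of "\<chi> l. _ l"] inner_sum_right mult.commute mult.left_commute)
  have "(\<Sum>l\<in>UNIV. D $ l *\<^sub>R (edge r l /\<^sub>R (edge r l \<bullet> edge r l))) \<bullet> edge r i
     = (\<Sum>l\<in>UNIV. if l = i then D $ i else 0)"
    unfolding inner_sum_left
    by (intro sum.cong) (use edge_orthogonal[OF cub] edge_nonzero[OF cub] in auto)
  then show "(\<Sum>l\<in>UNIV. D $ l *\<^sub>R (edge r l /\<^sub>R (edge r l \<bullet> edge r l))) \<bullet> edge r i = D $ i"
    by simp
qed

text \<open>For each \<open>i\<close> the derivative of \<open>\<phi>\<close> times the
  \<open>i\<close>-th component of \<open>q\<close>, taken along the edge \<open>i\<close>,
  integrates to zero. In the sum over \<open>i\<close> the derivatives of \<open>q\<close> add up to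
  its divergence \<open>c\<close>, and those of \<open>\<phi>\<close> form the Piola term.\<close>

lemma piola_integration_by_parts:
  fixes q :: "vec3 \<Rightarrow> vec3"
  assumes D: "\<And>i x. GDERIV (\<lambda>x. q x $ i) x :> D i x" "\<And>i. continuous_on UNIV (D i)"
      "\<And>x. (\<Sum>i\<in>UNIV. D i x $ i) = c"
    and \<phi>: "\<And>x. GDERIV \<phi> x :> g x" "continuous_on UNIV g" "compact K" "\<And>x. x \<notin> K \<Longrightarrow> \<phi> x = 0"
  shows "integral\<^sup>L lborel (\<lambda>x. piola r q x \<bullet> g x) = - (c / \<bar>det (elem_jac r)\<bar>) * integral\<^sup>L lborel \<phi>"
proof -
  let ?J = "\<bar>det (elem_jac r)\<bar>"
  define H where "H i x = (\<Sum>l\<in>UNIV. D i (coord_vec r x) $ l *\<^sub>R (edge r l /\<^sub>R (edge r l \<bullet> edge r l)))" for i x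
  have H: "GDERIV (\<lambda>x. q (coord_vec r x) $ i) x :> H i x" "H i x \<bullet> edge r i = D i (coord_vec r x) $ i" for i x
    unfolding H_def using GDERIV_comp_coord_vec[OF D(1)] by blast+
  have cH: "continuous_on UNIV (H i)" for i
    unfolding H_def using continuous_on_compose2[OF D(2) continuous_coord_vec]
    by (intro continuous_intros) auto
  have cq: "continuous_on UNIV (\<lambda>x. q (coord_vec r x) $ i)" for i
    using H(1) by (rule continuous_GDERIV)
  have c\<phi>: "continuous_on UNIV \<phi>" using \<phi>(1) by (rule continuous_GDERIV)
  have g0: "g x = 0" if "x \<notin> K" for x
    using GDERIV_zero_outside_compact[OF \<phi>(1,3,4) that] .
  define G where "G i x = \<phi> x *\<^sub>R H i x + q (coord_vec r x) $ i *\<^sub>R g x" for i x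
  have cG: "continuous_on UNIV (G i)" for i
    unfolding G_def by (intro continuous_intros c\<phi> cH cq \<phi>(2))
  have zero: "integral\<^sup>L lborel (\<lambda>x. G i x \<bullet> edge r i) = 0" for i
  proof (rule integral_directional_derivative_zero)
    show "GDERIV (\<lambda>x. \<phi> x * q (coord_vec r x) $ i) x :> G i x" for x
      unfolding G_def by (intro GDERIV_mult \<phi> H)
  qed (use cG \<phi> in auto)
  have intG: "integrable lborel (\<lambda>x. G i x \<bullet> edge r i)" for i
  proof (rule integrable_compact_support[OF _ \<phi>(3)])
    show "continuous_on UNIV (\<lambda>x. G i x \<bullet> edge r i)" by (intro continuous_intros cG)
  qed (simp add: G_def g0 \<phi>(4))
  have sum: "(\<Sum>i\<in>UNIV. G i x \<bullet> edge r i) = c * \<phi> x + ?J * (piola r q x \<bullet> g x)" for x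
  proof -
    have "(\<Sum>i\<in>UNIV. G i x \<bullet> edge r i)
       = \<phi> x * (\<Sum>i\<in>UNIV. D i (coord_vec r x) $ i) + (\<Sum>i\<in>UNIV. q (coord_vec r x) $ i *\<^sub>R edge r i) \<bullet> g x"
      by (simp add: G_def inner_add_left H(2) sum.distrib sum_distrib_left inner_sum_left
          inner_commute[of "g x"])
    then show ?thesis
      using det_elem_jac_nonzero by (simp add: D(3) piola_def mult.commute)
  qed
  have "integral\<^sup>L lborel (\<lambda>x. \<Sum>i\<in>UNIV. G i x \<bullet> edge r i) = 0"
    using intG zero by (simp add: Bochner_Integration.integral_sum)
  moreover have "integrable lborel \<phi>" using integrable_compact_support c\<phi> \<phi>(3,4) by blast
  moreover have "integrable lborel (\<lambda>x. piola r q x \<bullet> g x)"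
  proof (rule integrable_compact_support[OF _ \<phi>(3)])
    show "continuous_on UNIV (\<lambda>x. piola r q x \<bullet> g x)"
      unfolding piola_def by (intro continuous_intros cq \<phi>(2))
  qed (simp add: g0)
  ultimately have "c * integral\<^sup>L lborel \<phi> + ?J * integral\<^sup>L lborel (\<lambda>x. piola r q x \<bullet> g x) = 0"
    unfolding sum by simp
  then show ?thesis using det_elem_jac_nonzero by (simp add: field_simps)
qed

text \<open>Testing with the cutoffs of the element gives the integral of
  \<open>d x $ k * \<phi> n x\<close> as \<open>c\<close> / J times that of \<open>\<phi> n\<close>,
  where J is the absolute value of \<open>det (elem_jac r)\<close>. Dominated convergence removes
  the cutoffs, and J is the volume of the element.\<close>

lemma weak_div_piola:
  fixes q :: "vec3 \<Rightarrow> vec3"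
  assumes D: "\<And>i x. GDERIV (\<lambda>x. q x $ i) x :> D i x" "\<And>i. continuous_on UNIV (D i)"
      "\<And>x. (\<Sum>i\<in>UNIV. D i x $ i) = c"
    and \<Omega>: "open \<Omega>" "interior E \<subseteq> \<Omega>"
    and d: "in_L2 \<Omega> d" "weak_div \<Omega> \<tau> d"
    and \<tau>: "\<And>x. x \<in> interior E \<Longrightarrow> \<tau> x $ k = piola r q x"
  shows "integrable (lebesgue_on (interior E)) (\<lambda>x. d x $ k)"
    and "integral\<^sup>L (lebesgue_on (interior E)) (\<lambda>x. d x $ k) = c"
proof -
  let ?M = "lebesgue_on (interior E)"
  let ?J = "\<bar>det (elem_jac r)\<bar>"
  have [simp]: "interior E \<in> sets lebesgue" "\<Omega> \<in> sets lebesgue" using \<Omega>(1) by auto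
  have restr: "integral\<^sup>L (lebesgue_on S) f = integral\<^sup>L lebesgue (\<lambda>x. indicator S x *\<^sub>R f x)"
    if "S \<in> sets lebesgue" for S and f :: "vec3 \<Rightarrow> real"
    using that by (intro integral_restrict_space) simp
  have "interior E \<in> lmeasurable"
    using compact_imp_bounded[OF compact_cuboid[OF cub]] bounded_subset[OF _ interior_subset]
    by (intro bounded_set_imp_lmeasurable) auto
  then interpret finite_measure ?M by (rule finite_measure_lebesgue_on)
  have one: "integrable ?M (\<lambda>x. 1 :: real)" by simp
  have d2: "integrable ?M (\<lambda>x. (norm (d x))\<^sup>2)" and "d \<in> borel_measurable ?M"
  proof -
    have "integrable lebesgue (\<lambda>x. indicator \<Omega> x *\<^sub>R (norm (d x))\<^sup>2)"
      using d(1) by (subst integrable_restrict_space[symmetric]) (auto simp: in_L2_def)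
    then have "set_integrable lebesgue \<Omega> (\<lambda>x. (norm (d x))\<^sup>2)" by (simp add: set_integrable_def)
    then have "set_integrable lebesgue (interior E) (\<lambda>x. (norm (d x))\<^sup>2)"
      by (rule set_integrable_subset) (use \<Omega>(2) in auto)
    then show "integrable ?M (\<lambda>x. (norm (d x))\<^sup>2)"
      by (subst integrable_restrict_space) (auto simp: set_integrable_def)
    show "d \<in> borel_measurable ?M"
      using d(1) \<Omega>(2) measurable_restrict_mono by (auto simp: in_L2_def)
  qed
  then have dM: "(\<lambda>x. d x $ k) \<in> borel_measurable ?M"
    by (intro borel_measurable_continuous_on[where f = "\<lambda>v. v $ k"]) (auto intro: continuous_intros)
  \<comment> \<open>Square integrability suffices on a set of finite measure, through the bound by 1
    plus the squared norm.\<close>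
  show int: "integrable ?M (\<lambda>x. d x $ k)"
  proof (rule Bochner_Integration.integrable_bound)
    show "integrable ?M (\<lambda>x. 1 + (norm (d x))\<^sup>2)" using one d2 by simp
    show "AE x in ?M. norm (d x $ k) \<le> norm (1 + (norm (d x))\<^sup>2)"
    proof (rule AE_I2)
      fix x
      have "\<bar>d x $ k\<bar> \<le> norm (d x)" by (rule component_le_norm_cart)
      also have "\<dots> \<le> 1 + (norm (d x))\<^sup>2"
      proof -
        have "2 * norm (d x) \<le> (norm (d x))\<^sup>2 + 1"
          using zero_le_power2[of "norm (d x) - 1"] unfolding power2_diff by simp
        then show ?thesis using norm_ge_zero[of "d x"] by linarith
      qed
      finally show "norm (d x $ k) \<le> norm (1 + (norm (d x))\<^sup>2)" by simp
    qed
  qed (rule dM)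
  obtain \<phi> :: "nat \<Rightarrow> vec3 \<Rightarrow> real" and g K where
    \<phi>: "\<And>n x. GDERIV (\<phi> n) x :> g n x" "\<And>n. continuous_on UNIV (g n)"
      "\<And>n. compact (K n)" "\<And>n. K n \<subseteq> interior E" "\<And>n x. x \<notin> K n \<Longrightarrow> \<phi> n x = 0"
    and \<phi>1: "\<And>n x. 0 \<le> \<phi> n x" "\<And>n x. \<phi> n x \<le> 1" "\<And>x. x \<in> interior E \<Longrightarrow> (\<lambda>n. \<phi> n x) \<longlonglongrightarrow> 1"
    using cuboid_cutoff[OF cub] by metis
  have c\<phi>: "continuous_on UNIV (\<phi> n)" for n using \<phi>(1) by (rule continuous_GDERIV)
  have \<phi>M: "\<phi> n \<in> borel_measurable ?M" for n
    using borel_measurable_continuous_onI[OF c\<phi>] by (intro measurable_restrict_space1) (simp add: measurable_completion)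
  have g0: "g n x = 0" if "x \<notin> K n" for n x
    using GDERIV_zero_outside_compact[OF \<phi>(1,3,5) that] .
  have cq: "continuous_on UNIV (\<lambda>x. q (coord_vec r x) $ i)" for i
    using GDERIV_comp_coord_vec(1)[OF D(1)] by (rule continuous_GDERIV)
  have eq: "integral\<^sup>L ?M (\<lambda>x. d x $ k * \<phi> n x) = c / ?J * integral\<^sup>L ?M (\<phi> n)" for n
  proof -
    have "test_function \<Omega> (\<phi> n) (g n)"
      unfolding test_function_def
    proof (intro conjI allI)
      have "closure {x. \<phi> n x \<noteq> 0} \<subseteq> K n"
        using \<phi>(5) by (intro closure_minimal) (auto simp: compact_imp_closed[OF \<phi>(3)])
      then show "compact (closure {x. \<phi> n x \<noteq> 0})" "closure {x. \<phi> n x \<noteq> 0} \<subseteq> \<Omega>"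
        using \<phi>(3,4) \<Omega>(2) compact_closure bounded_subset compact_imp_bounded
        by (metis bounded_closure_image closure_closed compact_eq_bounded_closed closed_closure, blast)
    qed (use \<phi> in auto)
    then have "integral\<^sup>L (lebesgue_on \<Omega>) (\<lambda>x. \<tau> x $ k \<bullet> g n x) = - integral\<^sup>L (lebesgue_on \<Omega>) (\<lambda>x. d x $ k * \<phi> n x)"
      using d(2) by (simp add: weak_div_def)
    moreover have "integral\<^sup>L (lebesgue_on \<Omega>) (\<lambda>x. \<tau> x $ k \<bullet> g n x) = integral\<^sup>L lborel (\<lambda>x. piola r q x \<bullet> g n x)"
    proof -
      have "(\<lambda>x. indicator \<Omega> x *\<^sub>R (\<tau> x $ k \<bullet> g n x)) = (\<lambda>x. piola r q x \<bullet> g n x)"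
      proof
        fix x
        show "indicator \<Omega> x *\<^sub>R (\<tau> x $ k \<bullet> g n x) = piola r q x \<bullet> g n x"
        proof (cases "x \<in> K n")
          case True
          then have "x \<in> interior E" "x \<in> \<Omega>" using \<phi>(4) \<Omega>(2) by blast+
          then show ?thesis by (simp add: \<tau>)
        qed (simp add: g0)
      qed
      moreover have "(\<lambda>x. piola r q x \<bullet> g n x) \<in> borel_measurable borel"
        unfolding piola_def by (intro borel_measurable_continuous_onI continuous_intros cq \<phi>(2))
      ultimately show ?thesis by (simp add: restr integral_completion)
    qed
    moreover have "integral\<^sup>L (lebesgue_on \<Omega>) (\<lambda>x. d x $ k * \<phi> n x) = integral\<^sup>L ?M (\<lambda>x. d x $ k * \<phi> n x)"
    proof -
      have "(\<lambda>x. indicator \<Omega> x *\<^sub>R (d x $ k * \<phi> n x)) = (\<lambda>x. indicator (interior E) x *\<^sub>R (d x $ k * \<phi> n x))"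
      proof
        fix x
        show "indicator \<Omega> x *\<^sub>R (d x $ k * \<phi> n x) = indicator (interior E) x *\<^sub>R (d x $ k * \<phi> n x)"
        proof (cases "x \<in> K n")
          case True
          then have "x \<in> interior E" "x \<in> \<Omega>" using \<phi>(4) \<Omega>(2) by blast+
          then show ?thesis by simp
        qed (simp add: \<phi>(5))
      qed
      then show ?thesis by (simp add: restr)
    qed
    moreover have "integral\<^sup>L ?M (\<phi> n) = integral\<^sup>L lborel (\<phi> n)"
    proof -
      have "(\<lambda>x. indicator (interior E) x *\<^sub>R \<phi> n x) = \<phi> n"
      proof
        fix x
        show "indicator (interior E) x *\<^sub>R \<phi> n x = \<phi> n x"
        proof (cases "x \<in> K n")
          case True
          then have "x \<in> interior E" using \<phi>(4) by blast
          then show ?thesis by simp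
        qed (simp add: \<phi>(5))
      qed
      moreover have "\<phi> n \<in> borel_measurable borel" using c\<phi> by (rule borel_measurable_continuous_onI)
      ultimately show ?thesis by (simp add: restr integral_completion)
    qed
    ultimately show ?thesis
      using piola_integration_by_parts[OF D \<phi>(1,2,3,5)] by simp
  qed
  have "(\<lambda>n. integral\<^sup>L ?M (\<lambda>x. d x $ k * \<phi> n x)) \<longlonglongrightarrow> integral\<^sup>L ?M (\<lambda>x. d x $ k)"
  proof (rule integral_dominated_convergence[where w = "\<lambda>x. \<bar>d x $ k\<bar>"])
    show "AE x in ?M. (\<lambda>n. d x $ k * \<phi> n x) \<longlonglongrightarrow> d x $ k"
      using tendsto_mult[OF tendsto_const \<phi>1(3)] by (intro AE_I2) (fastforce simp: space_restrict_space)
    show "AE x in ?M. norm (d x $ k * \<phi> n x) \<le> \<bar>d x $ k\<bar>" for n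
      using \<phi>1(1,2) by (intro AE_I2) (simp add: abs_mult mult_left_le)
  qed (use int dM \<phi>M in auto)
  moreover have "(\<lambda>n. integral\<^sup>L ?M (\<phi> n)) \<longlonglongrightarrow> integral\<^sup>L ?M (\<lambda>x. 1)"
  proof (rule integral_dominated_convergence[where w = "\<lambda>x. 1"])
    show "AE x in ?M. (\<lambda>n. \<phi> n x) \<longlonglongrightarrow> 1"
      using \<phi>1(3) by (intro AE_I2) (auto simp: space_restrict_space)
    show "AE x in ?M. norm (\<phi> n x) \<le> 1" for n
      using \<phi>1(1,2) by (intro AE_I2) simp
  qed (use one \<phi>M in auto)
  then have "(\<lambda>n. c / ?J * integral\<^sup>L ?M (\<phi> n)) \<longlonglongrightarrow> c / ?J * integral\<^sup>L ?M (\<lambda>x. 1)"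
    by (intro tendsto_intros)
  ultimately have "integral\<^sup>L ?M (\<lambda>x. d x $ k) = c / ?J * integral\<^sup>L ?M (\<lambda>x. 1)"
    unfolding eq by (rule LIMSEQ_unique)
  also have "integral\<^sup>L ?M (\<lambda>x. 1 :: real) = ?J"
    by (simp add: measure_restrict_space measure_interior_cuboid)
  finally show "integral\<^sup>L ?M (\<lambda>x. d x $ k) = c"
    using det_elem_jac_nonzero by simp
qed

end

lemma sum_swap3: "(\<Sum>i\<in>A. \<Sum>j\<in>B. \<Sum>e\<in>C. g i j e) = (\<Sum>e\<in>C. \<Sum>i\<in>A. \<Sum>j\<in>B. g i j e)"
proof -
  have "(\<Sum>i\<in>A. \<Sum>j\<in>B. \<Sum>e\<in>C. g i j e) = (\<Sum>i\<in>A. \<Sum>e\<in>C. \<Sum>j\<in>B. g i j e)"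
    by (intro sum.cong refl sum.swap)
  also have "\<dots> = (\<Sum>e\<in>C. \<Sum>i\<in>A. \<Sum>j\<in>B. g i j e)" by (rule sum.swap)
  finally show ?thesis .
qed

section \<open>Values at mesh vertices\<close>

text \<open>Limits from inside are unique because every point of the closed element is a limit point
  of its interior.\<close>

lemma elem_val_eqI:
  assumes "cuboid E r" "p \<in> E" "(g \<longlongrightarrow> l) (at p within interior E)"
  shows "elem_val E g p = l"
proof -
  have "p islimpt interior E"
  proof (cases "p \<in> interior E")
    case True
    then show ?thesis using interior_limit_point[of p "interior E"] by simp
  next
    case False
    have "p \<in> closure (interior E)" using closure_interior_cuboid[OF assms(1)] assms(2) by simp
    then show ?thesis using False by (simp add: closure_def)
  qed
  then have "\<not> trivial_limit (at p within interior E)" by (simp add: trivial_limit_within)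
  then show ?thesis unfolding elem_val_def using assms(3) by (rule tendsto_Lim)
qed

lemma elem_val_continuous:
  assumes "cuboid E r" "p \<in> E" "continuous_on E g'" "\<And>x. x \<in> interior E \<Longrightarrow> g x = g' x"
  shows "(g \<longlongrightarrow> g' p) (at p within interior E)" "elem_val E g p = g' p"
proof -
  have "(g' \<longlongrightarrow> g' p) (at p within E)" using assms(2,3) by (simp add: continuous_on_def)
  then have "(g' \<longlongrightarrow> g' p) (at p within interior E)"
    by (rule tendsto_within_subset) (rule interior_subset)
  then show "(g \<longlongrightarrow> g' p) (at p within interior E)"
    by (rule Lim_transform_eventually) (use assms(4) in \<open>auto simp: eventually_at_filter\<close>)
  then show "elem_val E g p = g' p" by (rule elem_val_eqI[OF assms(1,2)])
qed

text \<open>Symmetry and a lower bound with a fixed constant are closed conditions on the operator,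
  so they pass to the boundary through the continuous extension. Uniformity of the bound keeps
  positivity strict in the limit.\<close>

lemma compliance_elem_val:
  assumes "compliance_tensor \<Omega> T A" "E \<in> T" "cuboid E r" "interior E \<subseteq> \<Omega>" "p \<in> E"
  shows "elem_val E A p \<sigma> \<bullet> \<tau> = \<sigma> \<bullet> elem_val E A p \<tau>"
    and "\<tau> \<noteq> 0 \<Longrightarrow> elem_val E A p \<tau> \<bullet> \<tau> > 0"
proof -
  obtain A' where A': "continuous_on E A'" "\<forall>x\<in>interior E. A' x = A x"
    using assms(1,2) unfolding compliance_tensor_def by blast
  have lim: "(A \<longlongrightarrow> A' p) (at p within interior E)" and eq: "elem_val E A p = A' p"
    using elem_val_continuous[OF assms(3,5) A'(1), of A] A'(2) by auto
  have "p \<in> closure (interior E)" using closure_interior_cuboid[OF assms(3)] assms(5) by simp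
  have cl: "closed {B :: mat3 \<Rightarrow>\<^sub>L mat3. B \<sigma> \<bullet> \<tau> = \<sigma> \<bullet> B \<tau>}" for \<sigma> \<tau>
    by (intro closed_Collect_eq continuous_intros)
  have A'cl: "A' p \<in> S" if "closed S" "\<And>x. x \<in> \<Omega> \<Longrightarrow> A x \<in> S" for S
  proof -
    have "A' ` closure (interior E) \<subseteq> closure (A' ` interior E)"
      using A'(1) closure_interior_cuboid[OF assms(3)]
      by (intro image_closure_subset closed_closure closure_subset) auto
    also have "\<dots> \<subseteq> S"
      using that A'(2) assms(4) by (intro closure_minimal) auto
    finally show ?thesis using \<open>p \<in> closure (interior E)\<close> by blast
  qed
  show "elem_val E A p \<sigma> \<bullet> \<tau> = \<sigma> \<bullet> elem_val E A p \<tau>"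
    using A'cl[OF cl] assms(1) unfolding eq compliance_tensor_def by blast
  assume "\<tau> \<noteq> 0"
  obtain a where a: "a > 0" "\<And>x \<tau>. x \<in> \<Omega> \<Longrightarrow> A x \<tau> \<bullet> \<tau> \<ge> a * (\<tau> \<bullet> \<tau>)"
    using assms(1) unfolding compliance_tensor_def by blast
  have "closed {B :: mat3 \<Rightarrow>\<^sub>L mat3. a * (\<tau> \<bullet> \<tau>) \<le> B \<tau> \<bullet> \<tau>}"
    by (intro closed_Collect_le continuous_intros)
  then have "a * (\<tau> \<bullet> \<tau>) \<le> A' p \<tau> \<bullet> \<tau>" using A'cl a(2) by blast
  moreover have "a * (\<tau> \<bullet> \<tau>) > 0" using a(1) \<open>\<tau> \<noteq> 0\<close> by simp
  ultimately show "elem_val E A p \<tau> \<bullet> \<tau> > 0" unfolding eq by linarith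
qed

lemma matrix_zero_on_edges:
  fixes M :: mat3
  assumes "cuboid E r" "\<And>i. M *v edge r i = 0"
  shows "M = 0"
proof -
  have "M *v x = 0" for x
  proof -
    have "M *v x = M *v (\<Sum>i\<in>UNIV. ((x \<bullet> edge r i) / (edge r i \<bullet> edge r i)) *\<^sub>R edge r i)"
      using vec_edge_expansion[OF assms(1), of x] by simp
    also have "\<dots> = (\<Sum>i\<in>UNIV. ((x \<bullet> edge r i) / (edge r i \<bullet> edge r i)) *\<^sub>R (M *v edge r i))"
      by (simp add: linear_sum[OF matrix_vector_mul_linear] matrix_vector_mult_scaleR
          del: scaleR_conv_of_real)
    finally show ?thesis by (simp add: assms(2))
  qed
  then show ?thesis by (simp add: matrix_eq)
qed

lemma matrix_component_inner: "(M *v x) $ k = M $ k \<bullet> x" for M :: mat3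
  by (simp add: matrix_vector_mult_def inner_vec_def)

text \<open>The image of the remaining edge is orthogonal to that edge by skewness, and to the two
  others because \<open>S\<close> annihilates them.\<close>

lemma skew_matrix_zero:
  fixes S :: mat3
  assumes "transpose S = - S" "cuboid E r" "\<And>l. l \<noteq> i \<Longrightarrow> S *v edge r l = 0"
  shows "S = 0"
proof (rule matrix_zero_on_edges[OF assms(2)])
  have skew: "(S *v x) \<bullet> y = - (x \<bullet> (S *v y))" for x y
  proof -
    have "(S *v x) \<bullet> y = x \<bullet> (transpose S *v y)"
      by (simp add: dot_lmul_matrix[symmetric] inner_commute)
    also have "\<dots> = - (x \<bullet> (S *v y))"
      by (simp add: assms(1) inner_vec_def matrix_vector_mult_def sum_negf)
    finally show ?thesis .
  qed
  have "(S *v edge r i) \<bullet> edge r l = 0" for l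
  proof (cases "l = i")
    case True
    then show ?thesis using skew[of "edge r i" "edge r i"] by (simp add: inner_commute)
  next
    case False
    then show ?thesis using skew[of "edge r i" "edge r l"] assms(3) by simp
  qed
  then have "S *v edge r i = 0"
    using vec_edge_expansion[OF assms(2), of "S *v edge r i"] by simp
  then show "S *v edge r l = 0" for l using assms(3) by (cases "l = i") auto
qed

section \<open>Integrals over the mesh\<close>

text \<open>Elements overlap only in null sets, and their union exceeds \<open>\<Omega>\<close> by a
  null set. Integrability on \<open>\<Omega>\<close> is derived from the pieces, since otherwise the
  Lebesgue integral on the left would have the default value 0.\<close>

lemma mesh_integral:
  fixes f :: "vec3 \<Rightarrow> real"
  assumes mesh: "conforming_cuboid_mesh \<Omega> T r"
    and int: "\<And>E. E \<in> T \<Longrightarrow> integrable (lebesgue_on (interior E)) f"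
  shows "integral\<^sup>L (lebesgue_on \<Omega>) f = (\<Sum>E\<in>T. integral\<^sup>L (lebesgue_on (interior E)) f)"
proof -
  note cub = cuboid_mesh[OF mesh]
  have "open \<Omega>" using interior_Union_mesh[OF mesh] open_interior by metis
  have fr: "negligible (frontier E)" if "E \<in> T" for E
    using negligible_convex_frontier[OF convex_cuboid[OF cub[OF that]]] .
  have null: "negligible (\<Union>T - \<Omega>)"
  proof -
    have "\<Union>T - \<Omega> \<subseteq> (\<Union>E\<in>T. frontier E)"
    proof
      fix x assume "x \<in> \<Union>T - \<Omega>"
      then obtain E where E: "E \<in> T" "x \<in> E" "x \<notin> \<Omega>" by blast
      then have "x \<notin> interior E" using interior_subset_domain[OF mesh] by blast
      then have "x \<in> frontier E" using E(2) closure_subset by (auto simp: frontier_def)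
      then show "x \<in> (\<Union>E\<in>T. frontier E)" using E(1) by blast
    qed
    moreover have "negligible (\<Union>E\<in>T. frontier E)"
      using finite_mesh[OF mesh] fr by (intro negligible_Union) auto
    ultimately show ?thesis by (rule negligible_subset[rotated])
  qed
  have on_E: "(f has_integral integral\<^sup>L (lebesgue_on (interior E)) f) E" if "E \<in> T" for E
    by (rule has_integral_interior[OF fr[OF that], THEN iffD1, OF has_integral_integral_lebesgue_on[OF int[OF that]]]) simp
  have "(f has_integral (\<Sum>E\<in>T. integral\<^sup>L (lebesgue_on (interior E)) f)) (\<Union>T)"
    using finite_mesh[OF mesh] on_E
    by (rule has_integral_Union) (use mesh_inter_negligible[OF mesh] in \<open>auto simp: pairwise_def\<close>)
  moreover have dif: "negligible {x \<in> \<Omega> - \<Union>T. f x \<noteq> 0}" "negligible {x \<in> \<Union>T - \<Omega>. f x \<noteq> 0}"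
    using subset_Union_mesh[OF mesh] by (auto intro: negligible_subset[OF null] negligible_subset[OF negligible_empty])
  ultimately have has: "(f has_integral (\<Sum>E\<in>T. integral\<^sup>L (lebesgue_on (interior E)) f)) \<Omega>"
    using has_integral_spike_set_eq by blast
  have abs_E: "f absolutely_integrable_on E" if "E \<in> T" for E
  proof -
    have "f absolutely_integrable_on interior E"
      using int[OF that] by (simp add: integrable_restrict_space set_integrable_def)
    moreover have "negligible {x \<in> interior E - E. f x \<noteq> 0}"
      using interior_subset by (auto intro: negligible_subset[OF negligible_empty])
    moreover have "negligible {x \<in> E - interior E. f x \<noteq> 0}"
      using closure_subset[of E] by (intro negligible_subset[OF fr[OF that]]) (auto simp: frontier_def)
    ultimately show ?thesis using absolutely_integrable_spike_set_eq by blast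
  qed
  have "f absolutely_integrable_on \<Union>T'" if "finite T'" "T' \<subseteq> T" for T'
    using that by (induction T' rule: finite_induct) (simp_all add: absolutely_integrable_Un abs_E)
  then have "f absolutely_integrable_on \<Union>T" using finite_mesh[OF mesh] by blast
  then have "f absolutely_integrable_on \<Omega>"
    using absolutely_integrable_spike_set_eq[OF dif] by simp
  then have "integrable (lebesgue_on \<Omega>) f"
    using \<open>open \<Omega>\<close> by (intro absolutely_integrable_imp_integrable) auto
  then have "(f has_integral integral\<^sup>L (lebesgue_on \<Omega>) f) \<Omega>"
    using \<open>open \<Omega>\<close> by (intro has_integral_integral_lebesgue_on) auto
  then show ?thesis using has has_integral_unique by blast
qed

lemma L2_inner_piecewise_constant:
  assumes mesh: "conforming_cuboid_mesh \<Omega> T r"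
    and g: "\<And>E x. E \<in> T \<Longrightarrow> x \<in> interior E \<Longrightarrow> g x = c E"
    and int: "\<And>E. E \<in> T \<Longrightarrow> integrable (lebesgue_on (interior E)) (\<lambda>x. f x \<bullet> c E)"
  shows "L2_inner \<Omega> f g = (\<Sum>E\<in>T. integral\<^sup>L (lebesgue_on (interior E)) (\<lambda>x. f x \<bullet> c E))"
proof -
  have eq: "f x \<bullet> g x = f x \<bullet> c E" if "E \<in> T" "x \<in> space (lebesgue_on (interior E))" for E x
    using g[of E x] that by (simp add: space_restrict_space)
  have "integrable (lebesgue_on (interior E)) (\<lambda>x. f x \<bullet> g x)" if "E \<in> T" for E
    by (rule Bochner_Integration.integrable_cong[OF refl eq[OF that], THEN iffD2, OF _ int[OF that]])
  from mesh_integral[OF mesh this]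
  have "L2_inner \<Omega> f g = (\<Sum>E\<in>T. integral\<^sup>L (lebesgue_on (interior E)) (\<lambda>x. f x \<bullet> g x))"
    by (simp add: L2_inner_def)
  also have "\<dots> = (\<Sum>E\<in>T. integral\<^sup>L (lebesgue_on (interior E)) (\<lambda>x. f x \<bullet> c E))"
    by (intro sum.cong refl Bochner_Integration.integral_cong eq)
  finally show ?thesis .
qed

lemma ex1_unique_eq: "\<exists>!c. Q c \<Longrightarrow> Q a \<Longrightarrow> Q b \<Longrightarrow> a = b"
  by blast

text \<open>The uniqueness clause of \<open>L2_basis\<close> at the zero function is linear
  independence. Points outside all element interiors lie on the null set \<open>N\<close> of element
  frontiers.\<close>

lemma L2_basis_combination_zero:
  assumes mesh: "conforming_cuboid_mesh \<Omega> T r" and basis: "L2_basis \<Omega> V b"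
    and "(\<lambda>x. 0) \<in> V"
    and zero: "\<And>E x. E \<in> T \<Longrightarrow> x \<in> interior E \<Longrightarrow> (\<Sum>i\<in>UNIV. y $ i *\<^sub>R b i x) = 0"
  shows "y = 0"
proof -
  have "open \<Omega>" using interior_Union_mesh[OF mesh] open_interior by metis
  define N where "N = (\<Union>E\<in>T. frontier E)"
  have "negligible N"
    unfolding N_def using finite_mesh[OF mesh] negligible_convex_frontier[OF convex_cuboid[OF cuboid_mesh[OF mesh]]]
    by (intro negligible_Union) auto
  then have "N \<in> null_sets lebesgue" by (simp add: negligible_iff_null_sets)
  then have "AE x in lebesgue. x \<notin> N" by (rule AE_not_in)
  then have "AE x in lebesgue_on \<Omega>. x \<notin> N"
    using \<open>open \<Omega>\<close> by (subst AE_restrict_space_iff) auto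
  let ?Q = "\<lambda>c. AE x in lebesgue_on \<Omega>. 0 = (\<Sum>i\<in>UNIV. c i *\<^sub>R b i x)"
  have "?Q (\<lambda>i. y $ i)"
    using \<open>AE x in lebesgue_on \<Omega>. x \<notin> N\<close>
  proof (rule AE_mp, intro AE_I2 impI)
    fix x assume "x \<in> space (lebesgue_on \<Omega>)" "x \<notin> N"
    then have "x \<in> \<Union>T" using subset_Union_mesh[OF mesh] by (auto simp: space_restrict_space)
    then obtain E where "E \<in> T" "x \<in> E" by blast
    then have "x \<in> interior E" using \<open>x \<notin> N\<close> closure_subset by (auto simp: N_def frontier_def)
    then show "0 = (\<Sum>i\<in>UNIV. y $ i *\<^sub>R b i x)" using zero \<open>E \<in> T\<close> by simp
  qed
  moreover have "?Q (\<lambda>i. 0)" by simp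
  moreover have "\<forall>s\<in>V. \<exists>!c. AE x in lebesgue_on \<Omega>. s x = (\<Sum>i\<in>UNIV. c i *\<^sub>R b i x)"
    using basis by (simp add: L2_basis_def)
  then have "\<exists>!c. ?Q c" using assms(3) by (rule bspec)
  ultimately have "(\<lambda>i. y $ i) = (\<lambda>i. 0)" by (intro ex1_unique_eq[of ?Q])
  then show ?thesis by (simp add: vec_eq_iff fun_eq_iff)
qed

section \<open>The stress basis\<close>

locale stress_basis =
  fixes \<Omega> \<Gamma>D \<Gamma>N :: "vec3 set"
    and T :: "vec3 set set" and r :: "vec3 set \<Rightarrow> nat \<Rightarrow> vec3"
    and \<nu> :: "vec3 set \<Rightarrow> vec3"
    and d :: "'j::finite \<Rightarrow> dof" and \<tau> :: "'j \<Rightarrow> vec3 \<Rightarrow> mat3"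
  assumes mesh: "conforming_cuboid_mesh \<Omega> T r"
    and normals: "unit_normals T \<nu>"
    and boundary: "boundary_partition \<Omega> T \<Gamma>D \<Gamma>N"
    and numbering: "bij_betw d UNIV (dofs T \<Gamma>N)"
    and X: "\<And>j. \<tau> j \<in> X_space \<Omega> T r \<nu> \<Gamma>N"
    and dual: "dual_to_dofs T \<nu> d \<tau>"
begin

section \<open>Degrees of freedom as corners and directions\<close>

lemma cub: "E \<in> T \<Longrightarrow> cuboid E (r E)"
  using mesh by (rule cuboid_mesh)

lemma dof_surj: "x \<in> dofs T \<Gamma>N \<Longrightarrow> \<exists>j. d j = x"
  using numbering by (metis bij_betw_iff_bijections)

lemma dof_in: "d j \<in> dofs T \<Gamma>N"
  using numbering by (auto simp: bij_betw_def)

lemma dof_inj: "d i = d j \<Longrightarrow> i = j"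
  using numbering by (auto simp: bij_betw_def inj_def)

text \<open>The level of the face is read off from the vertex \<open>p\<close> itself, so within an
  element a corner and a direction determine the face.\<close>

lemma dofE:
  obtains f p k E i where "d j = (f, p, k)" "f \<in> mesh_faces T" "\<not> f \<subseteq> \<Gamma>N" "E \<in> T" "f facet_of E"
    "f = elem_face E (r E) i (coord (r E) i p)" "\<forall>l. coord (r E) l p \<in> {0, 1}"
proof -
  obtain f p k where j: "d j = (f, p, k)" by (metis prod_cases3)
  then have f: "f \<in> mesh_faces T" "\<not> f \<subseteq> \<Gamma>N" "p extreme_point_of f"
    using dof_in[of j] by (auto simp: dofs_def)
  obtain E where E: "E \<in> T" "f facet_of E" using f(1) unfolding mesh_faces_def by blast
  obtain i s where i: "s \<in> {0, 1}" "f = elem_face E (r E) i s"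
    using facet_of_cuboidE[OF cub[OF E(1)] E(2)] by blast
  then have c: "coord (r E) i p = s" "\<forall>l. coord (r E) l p \<in> {0, 1}"
    using f(3) extreme_point_of_elem_face_iff[OF cub[OF E(1)] i(1)] by blast+
  show thesis by (rule that[OF j f(1,2) E i(2)[folded c(1)] c(2)])
qed

lemma dof_vertex_mesh: "dof_vertex (d j) \<in> mesh_vertices T r"
proof -
  obtain f p k E i where j: "d j = (f, p, k)" "E \<in> T" "\<forall>l. coord (r E) l p \<in> {0, 1}"
    by (rule dofE)
  then obtain m where "m \<in> {1..8}" "p = r E m" using vertex_iff[OF cub[OF j(2)]] by blast
  then show ?thesis
    using j(1,2) unfolding mesh_vertices_def dof_vertex_def by auto
qed

lemma normal_edge:
  assumes "E \<in> T" "s \<in> {0, 1}"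
  obtains c where "c \<noteq> 0" "\<nu> (elem_face E (r E) i s) = c *\<^sub>R edge (r E) i"
proof -
  let ?f = "elem_face E (r E) i s"
  have "?f \<in> mesh_faces T"
    using elem_face_facet_of[OF cub assms(2)] assms(1) by (auto simp: mesh_faces_def)
  then have "norm (\<nu> ?f) = 1" "\<And>x y. x \<in> ?f \<Longrightarrow> y \<in> ?f \<Longrightarrow> \<nu> ?f \<bullet> (x - y) = 0"
    using normals by (auto simp: unit_normals_def)
  moreover from this have "\<nu> ?f \<noteq> 0" by auto
  ultimately show thesis using normal_parallel_edge[OF cub[OF assms(1)] _ _ assms(2), of i "\<nu> ?f"] that
    by blast
qed

lemma vertex_mem:
  assumes "E \<in> T" "\<forall>l. coord (r E) l q \<in> {0, 1}"
  shows "q \<in> E" "q \<in> elem_face E (r E) i (coord (r E) i q)"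
proof -
  show "q \<in> E"
    using extreme_point_of_cuboid_iff[OF cub[OF assms(1)], of q] assms(2) by (simp add: extreme_point_of_def)
  then show "q \<in> elem_face E (r E) i (coord (r E) i q)" by (simp add: elem_face_def)
qed

text \<open>Extends duality to every facet at a corner: on a facet in \<open>\<Gamma>N\<close> the
  left side vanishes by the boundary condition, the right side because no degree of freedom is
  located there.\<close>

lemma normal_value:
  assumes "E \<in> T" "\<forall>l. coord (r E) l q \<in> {0, 1}" "f = elem_face E (r E) i (coord (r E) i q)"
  shows "(elem_val E (\<tau> j) q *v \<nu> f) $ k = (if d j = (f, q, k) then 1 else 0)"
proof -
  have ci: "coord (r E) i q \<in> {0, 1}" using assms(2) by blast
  have f: "f facet_of E" unfolding assms(3) by (rule elem_face_facet_of[OF cub[OF assms(1)] ci])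
  have q: "q \<in> f" unfolding assms(3) using vertex_mem[OF assms(1,2)] by blast
  show ?thesis
  proof (cases "f \<subseteq> \<Gamma>N")
    case True
    then have "elem_val E (\<tau> j) q *v \<nu> f = 0"
      using X[of j] assms(1) f q by (auto simp: X_space_def)
    moreover have "d j \<noteq> (f, q, k)" using dof_in[of j] True by (auto simp: dofs_def)
    ultimately show ?thesis by simp
  next
    case False
    have "q extreme_point_of f"
      unfolding assms(3) using extreme_point_of_elem_face_iff[OF cub[OF assms(1)] ci] assms(2) by blast
    then have "(f, q, k) \<in> dofs T \<Gamma>N"
      using False f assms(1) by (auto simp: dofs_def mesh_faces_def)
    then obtain i' where i': "d i' = (f, q, k)" using dof_surj by blast
    then have "dof_val \<nu> E (d i') (\<tau> j) = (if i' = j then 1 else 0)"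
      using dual[unfolded dual_to_dofs_def, rule_format, of E i' j] assms(1) f by (simp add: dof_face_def)
    moreover have "i' = j \<longleftrightarrow> d j = (f, q, k)" using i' dof_inj by metis
    ultimately show ?thesis by (simp add: i' dof_val_def)
  qed
qed

lemma elem_val_zero:
  assumes "E \<in> T" "\<forall>l. coord (r E) l q \<in> {0, 1}" "dof_vertex (d j) \<noteq> q"
  shows "elem_val E (\<tau> j) q = 0"
proof (rule matrix_zero_on_edges[OF cub[OF assms(1)]])
  fix i
  let ?f = "elem_face E (r E) i (coord (r E) i q)"
  have ci: "coord (r E) i q \<in> {0, 1}" using assms(2) by blast
  obtain c where c: "c \<noteq> 0" "\<nu> ?f = c *\<^sub>R edge (r E) i"
    using normal_edge[OF assms(1) ci] by blast
  have "d j \<noteq> (?f, q, k)" for k using assms(3) by (auto simp: dof_vertex_def)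
  then have "elem_val E (\<tau> j) q *v \<nu> ?f = 0"
    using normal_value[OF assms(1,2) refl, where j = j and i = i] by (simp add: vec_eq_iff)
  then show "elem_val E (\<tau> j) q *v edge (r E) i = 0"
    using c by (simp add: matrix_vector_mult_scaleR)
qed

subsection \<open>The mass matrix\<close>

lemma quad_off_block:
  assumes "dof_vertex (d i) \<noteq> dof_vertex (d j)"
  shows "quad T r A (\<tau> j) (\<tau> i) = 0"
  unfolding quad_def
proof (intro sum.neutral ballI)
  fix E assume E: "E \<in> T"
  have "elem_val E A (r E m) (elem_val E (\<tau> j) (r E m)) \<bullet> elem_val E (\<tau> i) (r E m) = 0"
    if "m \<in> {1..8}" for m
  proof -
    have m: "\<forall>l. coord (r E) l (r E m) \<in> {0, 1}"
      using vertex_iff[OF cub[OF E]] that by blast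
    show ?thesis
    proof (cases "dof_vertex (d i) = r E m")
      case True
      then have "elem_val E (\<tau> j) (r E m) = 0" using elem_val_zero[OF E m, of j] assms by simp
      then show ?thesis by (simp add: blinfun.zero_right)
    next
      case False
      then show ?thesis using elem_val_zero[OF E m, of i] by simp
    qed
  qed
  then show "measure lebesgue E / 8 * (\<Sum>m = 1..8. elem_val E A (r E m) (elem_val E (\<tau> j) (r E m)) \<bullet>
      elem_val E (\<tau> i) (r E m)) = 0"
    by simp
qed

lemma measure_cuboid_pos:
  assumes "E \<in> T"
  shows "measure lebesgue E > 0"
proof -
  have "measure lebesgue (interior E) = measure lebesgue E"
    using compact_imp_bounded[OF compact_cuboid[OF cub[OF assms]]]
      negligible_convex_frontier[OF convex_cuboid[OF cub[OF assms]]] by (rule measure_interior)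
  then show ?thesis
    using measure_interior_cuboid[OF cub[OF assms]] det_elem_jac_nonzero[OF cub[OF assms]] by simp
qed

lemma mass_matrix_sym_pos_def:
  assumes A: "compliance_tensor \<Omega> T A"
  shows "sym_pos_def_on UNIV (\<chi> i j. quad T r A (\<tau> j) (\<tau> i) :: real^'j^'j)"
proof -
  let ?M = "\<chi> i j. quad T r A (\<tau> j) (\<tau> i) :: real^'j^'j"
  have mem: "r E m \<in> E" "\<forall>l. coord (r E) l (r E m) \<in> {0, 1}" if "E \<in> T" "m \<in> {1..8}" for E m
  proof -
    show "\<forall>l. coord (r E) l (r E m) \<in> {0, 1}" using vertex_iff[OF cub[OF that(1)]] that(2) by blast
    then show "r E m \<in> E" using vertex_mem(1)[OF that(1)] by blast
  qed
  note A_val = compliance_elem_val[OF A _ cub interior_subset_domain[OF mesh]]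
  have "quad T r A (\<tau> j) (\<tau> i) = quad T r A (\<tau> i) (\<tau> j)" for i j
    unfolding quad_def
    by (intro sum.cong refl arg_cong2[of _ _ _ _ "(*)"]) (metis A_val(1) mem(1) inner_commute)
  moreover have "(\<Sum>i\<in>UNIV. \<Sum>j\<in>UNIV. x $ i * ?M $ i $ j * x $ j) > 0" if nz: "\<exists>i. x $ i \<noteq> 0" for x :: "real^'j"
  proof -
    \<comment> \<open>The value at the vertex \<open>m\<close> of \<open>E\<close>, taken from
      within \<open>E\<close>, of the field with coefficients \<open>x\<close>.\<close>
    define S where "S E m = (\<Sum>j\<in>UNIV. x $ j *\<^sub>R elem_val E (\<tau> j) (r E m))" for E m
    define t where "t E m = elem_val E A (r E m) (S E m) \<bullet> S E m" for E m
    have "(\<Sum>i\<in>UNIV. \<Sum>j\<in>UNIV. x $ i * ?M $ i $ j * x $ j)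
      = (\<Sum>i\<in>UNIV. \<Sum>j\<in>UNIV. \<Sum>E\<in>T. measure lebesgue E / 8 *
         (\<Sum>m=1..8. x $ i * x $ j * (elem_val E A (r E m) (elem_val E (\<tau> j) (r E m)) \<bullet> elem_val E (\<tau> i) (r E m))))"
      by (simp add: quad_def sum_distrib_left sum_distrib_right mult_ac)
    also have "\<dots> = (\<Sum>E\<in>T. measure lebesgue E / 8 * (\<Sum>m=1..8. \<Sum>i\<in>UNIV. \<Sum>j\<in>UNIV.
         x $ i * x $ j * (elem_val E A (r E m) (elem_val E (\<tau> j) (r E m)) \<bullet> elem_val E (\<tau> i) (r E m))))"
      by (subst sum_swap3, subst sum_swap3[symmetric]) (simp only: sum_distrib_left)
    also have "\<dots> = (\<Sum>E\<in>T. measure lebesgue E / 8 * (\<Sum>m=1..8. t E m))"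
      by (simp add: t_def S_def inner_sum_left inner_sum_right blinfun.sum_right blinfun.scaleR_right
          sum_distrib_left mult_ac)
    also have "\<dots> > 0"
    proof -
      have pos: "t E m \<ge> 0" "S E m \<noteq> 0 \<Longrightarrow> t E m > 0" if "E \<in> T" "m \<in> {1..8}" for E m
        using A_val(2)[OF that(1) that(1) that(1) mem(1)[OF that], of "S E m"]
        by (cases "S E m = 0"; simp add: t_def less_imp_le)+
      obtain j where j: "x $ j \<noteq> 0" using nz by blast
      obtain f p k E i where dj: "d j = (f, p, k)" "E \<in> T" "f facet_of E"
          "f = elem_face E (r E) i (coord (r E) i p)" "\<forall>l. coord (r E) l p \<in> {0, 1}"
        by (rule dofE[of j])
      obtain m where m: "m \<in> {1..8}" "p = r E m" using vertex_iff[OF cub[OF dj(2)]] dj(5) by blast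
      \<comment> \<open>A normal component of the field returns its coefficient, so a nonzero
        coefficient forces a nonzero value at a quadrature point.\<close>
      have "(S E m *v \<nu> f) $ k = (\<Sum>j'\<in>UNIV. x $ j' * (elem_val E (\<tau> j') p *v \<nu> f) $ k)"
        by (simp add: S_def m(2) matrix_component_inner inner_sum_left)
      also have "\<dots> = (\<Sum>j'\<in>UNIV. if j' = j then x $ j else 0)"
        using normal_value[OF dj(2,5,4)] dj(1) dof_inj by (intro sum.cong) auto
      finally have "S E m \<noteq> 0" using j by auto
      then have "t E m > 0" using pos dj(2) m(1) by blast
      then have "(\<Sum>m=1..8. t E m) > 0"
        using pos(1)[OF dj(2)] m(1) by (intro sum_pos2[of _ m]) auto
      then have "measure lebesgue E / 8 * (\<Sum>m=1..8. t E m) > 0"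
        using measure_cuboid_pos[OF dj(2)] by simp
      moreover have "measure lebesgue E / 8 * (\<Sum>m=1..8. t E m) \<ge> 0" if "E \<in> T" for E
        using pos(1)[OF that] by (auto intro!: mult_nonneg_nonneg sum_nonneg)
      ultimately show ?thesis
        using finite_mesh[OF mesh] dj(2) by (intro sum_pos2[of _ E]) auto
    qed
    finally show ?thesis .
  qed
  ultimately show ?thesis unfolding sym_pos_def_on_def by simp
qed

lemma card_interior_vertex_dofs:
  assumes "p \<in> mesh_vertices T r" "p \<in> \<Omega>"
  shows "card {i. dof_vertex (d i) = p} = 36"
proof -
  have "open \<Omega>" using interior_Union_mesh[OF mesh] open_interior by metis
  \<comment> \<open>A vertex in the open set \<open>\<Omega>\<close> is off the boundary, so none of
    its faces is excluded from the degrees of freedom; 12 faces times 3 components give 36.\<close>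
  then have N: "p \<notin> \<Gamma>N"
    using boundary assms(2) by (auto simp: boundary_partition_def frontier_def interior_open)
  have ext: "p extreme_point_of f" if f: "f \<in> mesh_faces T" "p \<in> f" for f
  proof -
    obtain E where E: "E \<in> T" "f facet_of E" using f(1) unfolding mesh_faces_def by blast
    then have fE: "f face_of E" by (simp add: facet_of_def)
    then have "p \<in> E" using f(2) face_of_imp_subset by blast
    from mesh_vertex_extreme[OF mesh assms(1) E(1) this] show ?thesis
      using extreme_point_of_face[OF fE] f(2) by simp
  qed
  have "d ` {i. dof_vertex (d i) = p} = {x \<in> dofs T \<Gamma>N. dof_vertex x = p}"
  proof
    show "{x \<in> dofs T \<Gamma>N. dof_vertex x = p} \<subseteq> d ` {i. dof_vertex (d i) = p}"
    proof
      fix x assume x: "x \<in> {x \<in> dofs T \<Gamma>N. dof_vertex x = p}"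
      then obtain j where "d j = x" using dof_surj by blast
      then show "x \<in> d ` {i. dof_vertex (d i) = p}" using x by auto
    qed
  qed (use dof_in in auto)
  also have "\<dots> = {f\<in>mesh_faces T. p \<in> f} \<times> {p} \<times> UNIV"
    using ext N by (auto simp: dofs_def dof_vertex_def extreme_point_of_def)
  finally have "d ` {i. dof_vertex (d i) = p} = {f\<in>mesh_faces T. p \<in> f} \<times> {p} \<times> UNIV" .
  then have "card (d ` {i. dof_vertex (d i) = p}) = 36"
    using card_vertex_faces(1)[OF mesh normals assms] by (simp add: card_cartesian_product)
  moreover have "inj_on d {i. dof_vertex (d i) = p}" using dof_inj by (auto intro: inj_onI)
  ultimately show ?thesis by (simp add: card_image)
qed

subsection \<open>Injectivity of the coupling form\<close>

lemma stress_basis_piola: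
  assumes "E \<in> T"
  obtains q where "\<And>k. q k \<in> ERT0" "\<And>x k. x \<in> interior E \<Longrightarrow> \<tau> j x $ k = piola (r E) (q k) x"
proof -
  obtain \<tau>' where \<tau>': "\<And>k. (\<lambda>x. \<tau>' x $ k) \<in> ERT0"
    "\<And>x. x \<in> interior E \<Longrightarrow> transpose (\<tau> j x) =
           (1 / \<bar>det (elem_jac (r E))\<bar>) *\<^sub>R (elem_jac (r E) ** transpose (\<tau>' (inv (elem_map (r E)) x)))"
    using X[of j] assms unfolding X_space_def by blast
  have "\<tau> j x $ k = piola (r E) (\<lambda>x. \<tau>' x $ k) x" if x: "x \<in> interior E" for x k
  proof -
    have "\<tau> j x $ k $ m = piola (r E) (\<lambda>x. \<tau>' x $ k) x $ m" for m
    proof -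
      have "\<tau> j x $ k $ m = transpose (\<tau> j x) $ m $ k" by (simp add: transpose_def)
      also have "\<dots> = piola (r E) (\<lambda>x. \<tau>' x $ k) x $ m"
        unfolding \<tau>'(2)[OF x] inv_elem_map[OF cub[OF assms]]
        by (simp add: piola_def coord_vec_def matrix_matrix_mult_def elem_jac_nth mult.commute)
           (simp add: transpose_def)
      finally show ?thesis .
    qed
    then show ?thesis by (simp add: vec_eq_iff)
  qed
  then show thesis using that[of "\<lambda>k x. \<tau>' x $ k"] \<tau>'(1) by blast
qed

lemma unit_vertices_coord_vec:
  "coord_vec (r E) q \<in> unit_vertices \<longleftrightarrow> (\<forall>l. coord (r E) l q \<in> {0, 1})"
  by (simp add: unit_vertices_def coord_vec_def)

text \<open>By orthogonality of the edges, the normal component on a facet of direction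
  \<open>i\<close> is a multiple of the \<open>i\<close>-th reference component alone. The factor is
  common to the three rows, so vanishing normal values transfer to the reference cube.\<close>

lemma piola_vertex_value:
  assumes E: "E \<in> T" and q: "\<And>k. continuous_on UNIV (q k)"
    "\<And>x k. x \<in> interior E \<Longrightarrow> \<tau> j x $ k = piola (r E) (q k) x"
    and P: "\<forall>l. coord (r E) l P \<in> {0, 1}"
  obtains c where "c \<noteq> 0"
    "\<And>k. (elem_val E (\<tau> j) P *v \<nu> (elem_face E (r E) i (coord (r E) i P))) $ k = c * q k (coord_vec (r E) P) $ i"
proof -
  let ?f = "elem_face E (r E) i (coord (r E) i P)"
  let ?J = "\<bar>det (elem_jac (r E))\<bar>"
  have cont: "continuous_on E (\<lambda>x. \<chi> k. piola (r E) (q k) x)"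
    unfolding piola_def
    by (intro continuous_on_vec_lambda continuous_intros continuous_on_compose2[OF q(1) continuous_coord_vec]) auto
  have "elem_val E (\<tau> j) P = (\<chi> k. piola (r E) (q k) P)"
    using elem_val_continuous(2)[OF cub[OF E] vertex_mem(1)[OF E P] cont] q(2) by (simp add: vec_eq_iff)
  moreover obtain b where b: "b \<noteq> 0" "\<nu> ?f = b *\<^sub>R edge (r E) i"
    using normal_edge[OF E] P by blast
  moreover have "piola (r E) (q k) P \<bullet> edge (r E) i
      = 1 / ?J * (q k (coord_vec (r E) P) $ i * (edge (r E) i \<bullet> edge (r E) i))" for k
  proof -
    have "(\<Sum>l\<in>UNIV. q k (coord_vec (r E) P) $ l * (edge (r E) l \<bullet> edge (r E) i))
        = (\<Sum>l\<in>UNIV. if l = i then q k (coord_vec (r E) P) $ i * (edge (r E) i \<bullet> edge (r E) i) else 0)"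
      by (intro sum.cong) (auto simp: edge_orthogonal[OF cub[OF E]])
    then show ?thesis by (simp add: piola_def inner_sum_left)
  qed
  ultimately have "(elem_val E (\<tau> j) P *v \<nu> ?f) $ k
     = (b / ?J * (edge (r E) i \<bullet> edge (r E) i)) * q k (coord_vec (r E) P) $ i" for k
    by (simp add: matrix_component_inner)
  moreover have "b / ?J * (edge (r E) i \<bullet> edge (r E) i) \<noteq> 0"
    using b(1) det_elem_jac_nonzero[OF cub[OF E]] edge_nonzero[OF cub[OF E]] by simp
  ultimately show thesis using that by blast
qed

text \<open>The share of the element \<open>E\<close> in the coupling form when displacement and
  rotation have the constant values \<open>u\<close> and \<open>S\<close> on
  \<open>E\<close>.\<close>

definition elem_form :: "vec3 set \<Rightarrow> 'j \<Rightarrow> vec3 \<Rightarrow> mat3 \<Rightarrow> real" where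
  "elem_form E j u S = integral\<^sup>L (lebesgue_on (interior E)) (\<lambda>x. divergence \<Omega> (\<tau> j) x \<bullet> u)
     + integral\<^sup>L (lebesgue_on (interior E)) (\<lambda>x. \<tau> j x \<bullet> S)"

text \<open>The weights of \<open>ert_poly_moment\<close>. In the normal direction 1/8 is the offset
  1/2 of the facet from the centre times the integral 1/4 of a bilinear nodal function; tangentially
  1/24 = (1/3 - 1/4) / 2 integrates such a function against a centred coordinate.\<close>

definition corner_weight :: "vec3 set \<Rightarrow> 3 \<Rightarrow> vec3 \<Rightarrow> 3 \<Rightarrow> real" where
  "corner_weight E i p l = (if i = l then 1/8 else (2 * coord (r E) i p - 1) * (2 * coord (r E) l p - 1) / 24)"

text \<open>Combines the mean of the weak divergence with the integral of the field, row by row. The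
  hypothesis \<open>zero\<close> leaves at most one corner and direction at which the rows can be
  nonzero.\<close>

lemma elem_form_rows:
  assumes E: "E \<in> T" and p: "\<forall>l. coord (r E) l p \<in> {0, 1}"
    and zero: "\<And>p' i'. \<forall>l. coord (r E) l p' \<in> {0, 1} \<Longrightarrow> (p', i') \<noteq> (p, i) \<Longrightarrow>
        elem_val E (\<tau> j) p' *v \<nu> (elem_face E (r E) i' (coord (r E) i' p')) = 0"
  obtains c where "c \<noteq> 0"
    "integrable (lebesgue_on (interior E)) (\<lambda>x. divergence \<Omega> (\<tau> j) x \<bullet> u)"
    "integrable (lebesgue_on (interior E)) (\<lambda>x. \<tau> j x \<bullet> S)"
    "elem_form E j u S = (\<Sum>k\<in>UNIV.
      c * (elem_val E (\<tau> j) p *v \<nu> (elem_face E (r E) i (coord (r E) i p))) $ k *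
      ((2 * coord (r E) i p - 1) / 4 * u $ k + (\<Sum>l\<in>UNIV. corner_weight E i p l * (S $ k \<bullet> edge (r E) l))))"
proof -
  let ?M = "lebesgue_on (interior E)"
  let ?a = "edge (r E)"
  let ?P = "coord_vec (r E) p"
  define val where "val k = (elem_val E (\<tau> j) p *v \<nu> (elem_face E (r E) i (coord (r E) i p))) $ k" for k
  obtain q where q: "\<And>k. q k \<in> ERT0" "\<And>x k. x \<in> interior E \<Longrightarrow> \<tau> j x $ k = piola (r E) (q k) x"
    using stress_basis_piola[OF E] by blast
  have cq: "continuous_on UNIV (q k)" for k using q(1) by (rule continuous_ERT0)
  obtain b where b: "b \<noteq> 0" "\<And>k. val k = b * q k ?P $ i"
    unfolding val_def using piola_vertex_value[OF E cq q(2) p] by blast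
  have qzero: "q k p' $ i' = 0" if p': "p' \<in> unit_vertices" "(p', i') \<noteq> (?P, i)" for k p' i'
  proof -
    define x where "x = elem_map (r E) p'"
    have x: "coord_vec (r E) x = p'" by (simp add: x_def coord_vec_elem_map[OF cub[OF E]])
    then have xc: "\<forall>l. coord (r E) l x \<in> {0, 1}" using p'(1) unit_vertices_coord_vec by metis
    have "(x, i') \<noteq> (p, i)" using p'(2) x by auto
    then have "elem_val E (\<tau> j) x *v \<nu> (elem_face E (r E) i' (coord (r E) i' x)) = 0"
      using zero xc by blast
    moreover obtain c where "c \<noteq> 0"
      "\<And>k. (elem_val E (\<tau> j) x *v \<nu> (elem_face E (r E) i' (coord (r E) i' x))) $ k = c * q k (coord_vec (r E) x) $ i'"
      using piola_vertex_value[OF E cq q(2) xc] by blast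
    ultimately show ?thesis by (simp add: x)
  qed
  have P: "?P \<in> unit_vertices" using p unit_vertices_coord_vec by blast
  have "\<exists>d. in_L2 \<Omega> d \<and> weak_div \<Omega> (\<tau> j) d"
    using X[of j] by (auto simp: X_space_def in_Hdiv_def)
  then have div: "in_L2 \<Omega> (divergence \<Omega> (\<tau> j))" "weak_div \<Omega> (\<tau> j) (divergence \<Omega> (\<tau> j))"
    unfolding divergence_def by (metis (mono_tags, lifting) someI_ex)+
  have "open \<Omega>" using interior_Union_mesh[OF mesh] open_interior by metis
  have row: "integrable ?M (\<lambda>x. divergence \<Omega> (\<tau> j) x $ k) \<and>
      integral\<^sup>L ?M (\<lambda>x. divergence \<Omega> (\<tau> j) x $ k) = (2 * coord (r E) i p - 1) / 4 * q k ?P $ i \<and>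
      integrable ?M (\<lambda>x. \<tau> j x $ k) \<and>
      integral\<^sup>L ?M (\<lambda>x. \<tau> j x $ k) = (\<Sum>l\<in>UNIV. (corner_weight E i p l * q k ?P $ i) *\<^sub>R ?a l)" for k
  proof -
    obtain D c where D: "\<And>i x. GDERIV (\<lambda>x. q k x $ i) x :> D i x" "\<And>i. continuous_on UNIV (D i)"
        "\<And>x. (\<Sum>i\<in>UNIV. D i x $ i) = c" "c = (2 * ?P $ i - 1) / 4 * q k ?P $ i"
        "(q k has_integral (\<chi> l. (if i = l then 1/8 else (2 * ?P $ i - 1) * (2 * ?P $ l - 1) / 24) * q k ?P $ i)) ref_cube"
      by (rule ERT0_dual_moments[where q = "q k" and p = "?P" and i = i, OF q(1) P])
         ((rule qzero; assumption), (rule that; assumption))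
    have eq: "\<tau> j x $ k = piola (r E) (q k) x" if "x \<in> space ?M" for x
      using q(2) that by (simp add: space_restrict_space)
    have "integrable ?M (\<lambda>x. \<tau> j x $ k) \<longleftrightarrow> integrable ?M (piola (r E) (q k))"
      using eq by (intro Bochner_Integration.integrable_cong) auto
    moreover have "integral\<^sup>L ?M (\<lambda>x. \<tau> j x $ k) = integral\<^sup>L ?M (piola (r E) (q k))"
      using eq by (intro Bochner_Integration.integral_cong) auto
    ultimately show ?thesis
      using weak_div_piola[OF cub[OF E] D(1-3) \<open>open \<Omega>\<close> interior_subset_domain[OF mesh E] div q(2)]
        integral_piola[OF cub[OF E] cq D(5)] D(4)
      by (simp add: coord_vec_nth corner_weight_def cong: if_cong)
  qed
  note row' = row[THEN conjunct1] row[THEN conjunct2, THEN conjunct1]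
    row[THEN conjunct2, THEN conjunct2, THEN conjunct1] row[THEN conjunct2, THEN conjunct2, THEN conjunct2]
  have dsum: "divergence \<Omega> (\<tau> j) x \<bullet> u = (\<Sum>k\<in>UNIV. divergence \<Omega> (\<tau> j) x $ k * u $ k)" for x
    by (simp add: inner_vec_def)
  have tsum: "\<tau> j x \<bullet> S = (\<Sum>k\<in>UNIV. \<tau> j x $ k \<bullet> S $ k)" for x
    by (simp add: inner_vec_def[of "\<tau> j x" S])
  have int: "integrable ?M (\<lambda>x. divergence \<Omega> (\<tau> j) x \<bullet> u)" "integrable ?M (\<lambda>x. \<tau> j x \<bullet> S)"
    unfolding dsum tsum by (auto intro!: Bochner_Integration.integrable_sum row'(1,3))
  have 1: "integral\<^sup>L ?M (\<lambda>x. divergence \<Omega> (\<tau> j) x \<bullet> u)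
      = (\<Sum>k\<in>UNIV. (2 * coord (r E) i p - 1) / 4 * q k ?P $ i * u $ k)"
    unfolding dsum by (simp add: Bochner_Integration.integral_sum row'(1,2))
  have "integral\<^sup>L ?M (\<lambda>x. \<tau> j x \<bullet> S) = (\<Sum>k\<in>UNIV. integral\<^sup>L ?M (\<lambda>x. \<tau> j x $ k) \<bullet> S $ k)"
    unfolding tsum by (simp add: Bochner_Integration.integral_sum row'(3))
  also have "\<dots> = (\<Sum>k\<in>UNIV. q k ?P $ i * (\<Sum>l\<in>UNIV. corner_weight E i p l * (S $ k \<bullet> ?a l)))"
    by (simp add: row'(4) inner_sum_right sum_distrib_left inner_commute[of _ "S $ _"] mult_ac)
  finally have "elem_form E j u S = (\<Sum>k\<in>UNIV. q k ?P $ i *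
      ((2 * coord (r E) i p - 1) / 4 * u $ k + (\<Sum>l\<in>UNIV. corner_weight E i p l * (S $ k \<bullet> ?a l))))"
    unfolding elem_form_def 1 by (simp add: sum.distrib distrib_left mult_ac)
  \<comment> \<open>Reference values are expressed by normal components on the mesh, with the factor
    \<open>b\<close> common to all rows.\<close>
  also have "\<dots> = (\<Sum>k\<in>UNIV. 1 / b * val k *
      ((2 * coord (r E) i p - 1) / 4 * u $ k + (\<Sum>l\<in>UNIV. corner_weight E i p l * (S $ k \<bullet> ?a l))))"
    using b by simp
  finally show thesis using that[of "1 / b"] int b(1) unfolding val_def by simp
qed

lemma dof_elem_face:
  assumes "E \<in> T" "f facet_of E" "d j = (f, p, k)"
  obtains i where "f = elem_face E (r E) i (coord (r E) i p)" "\<forall>l. coord (r E) l p \<in> {0, 1}"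
proof -
  obtain i s where i: "s \<in> {0, 1}" "f = elem_face E (r E) i s"
    using facet_of_cuboidE[OF cub[OF assms(1)] assms(2)] by blast
  have "p extreme_point_of f" using dof_in[of j] assms(3) by (simp add: dofs_def)
  then have "coord (r E) i p = s" "\<forall>l. coord (r E) l p \<in> {0, 1}"
    using extreme_point_of_elem_face_iff[OF cub[OF assms(1)] i(1)] unfolding i(2) by blast+
  then show thesis using that i(2) by blast
qed

lemma elem_form_off:
  assumes "E \<in> T" "\<not> dof_face (d j) facet_of E"
  shows "elem_form E j u S = 0"
    and "integrable (lebesgue_on (interior E)) (\<lambda>x. divergence \<Omega> (\<tau> j) x \<bullet> u)"
    and "integrable (lebesgue_on (interior E)) (\<lambda>x. \<tau> j x \<bullet> S)"
proof -
  \<comment> \<open>Any corner and direction would serve, because all normal values of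
    \<open>\<tau> j\<close> at the corners of \<open>E\<close> vanish.\<close>
  define p where "p = elem_map (r E) 0"
  have p: "\<forall>l. coord (r E) l p \<in> {0, 1}" by (simp add: p_def coord_elem_map[OF cub[OF assms(1)]])
  have val: "elem_val E (\<tau> j) p' *v \<nu> (elem_face E (r E) i' (coord (r E) i' p')) = 0"
    if p': "\<forall>l. coord (r E) l p' \<in> {0, 1}" for p' i'
  proof -
    let ?f = "elem_face E (r E) i' (coord (r E) i' p')"
    have "?f facet_of E" using p' by (intro elem_face_facet_of[OF cub[OF assms(1)]]) blast
    then have "d j \<noteq> (?f, p', k)" for k using assms(2) by (auto simp: dof_face_def)
    then show ?thesis using normal_value[OF assms(1) p' refl, where i = i'] by (simp add: vec_eq_iff)
  qed
  obtain c where c: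
    "integrable (lebesgue_on (interior E)) (\<lambda>x. divergence \<Omega> (\<tau> j) x \<bullet> u)"
    "integrable (lebesgue_on (interior E)) (\<lambda>x. \<tau> j x \<bullet> S)"
    "elem_form E j u S = (\<Sum>k\<in>UNIV.
      c * (elem_val E (\<tau> j) p *v \<nu> (elem_face E (r E) 1 (coord (r E) 1 p))) $ k *
      ((2 * coord (r E) 1 p - 1) / 4 * u $ k + (\<Sum>l\<in>UNIV. corner_weight E 1 p l * (S $ k \<bullet> edge (r E) l))))"
    by (rule elem_form_rows[OF assms(1) p, where i = 1 and j = j and u = u and S = S]) (rule val, assumption)
  show "integrable (lebesgue_on (interior E)) (\<lambda>x. divergence \<Omega> (\<tau> j) x \<bullet> u)"
    "integrable (lebesgue_on (interior E)) (\<lambda>x. \<tau> j x \<bullet> S)" by (fact c)+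
  show "elem_form E j u S = 0" unfolding c(3) val[OF p] by simp
qed

text \<open>With c the centre of \<open>E\<close> and s the level of the facet, the bracket is (2 s
  - 1) / 4 times the \<open>k\<close>-th component of \<open>u\<close> + \<open>S\<close> (x - c) at
  one point x of the facet: its tangential coordinates are 2/3 where \<open>p\<close> has 1, and 1/3
  where \<open>p\<close> has 0.\<close>

lemma elem_form_on:
  assumes "E \<in> T" "f facet_of E" "d j = (f, p, k)" "f = elem_face E (r E) i (coord (r E) i p)"
    "\<forall>l. coord (r E) l p \<in> {0, 1}"
  obtains c where "c \<noteq> 0"
    "integrable (lebesgue_on (interior E)) (\<lambda>x. divergence \<Omega> (\<tau> j) x \<bullet> u)"
    "integrable (lebesgue_on (interior E)) (\<lambda>x. \<tau> j x \<bullet> S)"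
    "elem_form E j u S = c * ((2 * coord (r E) i p - 1) / 4 * u $ k +
      (\<Sum>l\<in>UNIV. corner_weight E i p l * (S $ k \<bullet> edge (r E) l)))"
proof -
  have zero: "elem_val E (\<tau> j) p' *v \<nu> (elem_face E (r E) i' (coord (r E) i' p')) = 0"
    if p': "\<forall>l. coord (r E) l p' \<in> {0, 1}" "(p', i') \<noteq> (p, i)" for p' i'
  proof -
    let ?f = "elem_face E (r E) i' (coord (r E) i' p')"
    have "d j \<noteq> (?f, p', k')" for k'
    proof
      assume "d j = (?f, p', k')"
      then have "p' = p" "?f = f" using assms(3) by auto
      then have "elem_face E (r E) i' (coord (r E) i' p') \<subseteq> elem_face E (r E) i (coord (r E) i p)"
        using assms(4) by simp
      then have "i' = i" using elem_face_eqD[OF cub[OF assms(1)]] p'(1) by blast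
      then show False using p'(2) \<open>p' = p\<close> by simp
    qed
    then show ?thesis using normal_value[OF assms(1) p'(1) refl, where i = i'] by (simp add: vec_eq_iff)
  qed
  obtain c where c: "c \<noteq> 0"
    "integrable (lebesgue_on (interior E)) (\<lambda>x. divergence \<Omega> (\<tau> j) x \<bullet> u)"
    "integrable (lebesgue_on (interior E)) (\<lambda>x. \<tau> j x \<bullet> S)"
    "elem_form E j u S = (\<Sum>k\<in>UNIV.
      c * (elem_val E (\<tau> j) p *v \<nu> (elem_face E (r E) i (coord (r E) i p))) $ k *
      ((2 * coord (r E) i p - 1) / 4 * u $ k + (\<Sum>l\<in>UNIV. corner_weight E i p l * (S $ k \<bullet> edge (r E) l))))"
    by (rule elem_form_rows[OF assms(1,5), where i = i and j = j and u = u and S = S]) (rule zero; assumption)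
  have val: "(elem_val E (\<tau> j) p *v \<nu> (elem_face E (r E) i (coord (r E) i p))) $ k' = (if k' = k then 1 else 0)" for k'
    using normal_value[OF assms(1,5,4), where j = j and k = k'] assms(3,4) by auto
  have "elem_form E j u S = (\<Sum>k'\<in>UNIV. if k' = k then
      c * ((2 * coord (r E) i p - 1) / 4 * u $ k + (\<Sum>l\<in>UNIV. corner_weight E i p l * (S $ k \<bullet> edge (r E) l))) else 0)"
    unfolding c(4) val by (intro sum.cong) auto
  then have "elem_form E j u S = c * ((2 * coord (r E) i p - 1) / 4 * u $ k +
      (\<Sum>l\<in>UNIV. corner_weight E i p l * (S $ k \<bullet> edge (r E) l)))"
    by simp
  with c(1-3) show thesis by (rule that)
qed

lemma elem_form_integrable:
  assumes "E \<in> T"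
  shows "integrable (lebesgue_on (interior E)) (\<lambda>x. divergence \<Omega> (\<tau> j) x \<bullet> u)"
    and "integrable (lebesgue_on (interior E)) (\<lambda>x. \<tau> j x \<bullet> S)"
proof -
  have "integrable (lebesgue_on (interior E)) (\<lambda>x. divergence \<Omega> (\<tau> j) x \<bullet> u) \<and>
        integrable (lebesgue_on (interior E)) (\<lambda>x. \<tau> j x \<bullet> S)"
  proof (cases "dof_face (d j) facet_of E")
    case True
    obtain f p k where j: "d j = (f, p, k)" by (metis prod_cases3)
    then have f: "f facet_of E" using True by (simp add: dof_face_def)
    obtain i where "f = elem_face E (r E) i (coord (r E) i p)" "\<forall>l. coord (r E) l p \<in> {0, 1}"
      by (rule dof_elem_face[OF assms f j])
    from elem_form_on[OF assms f j this] show ?thesis by metis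
  next
    case False
    then show ?thesis using elem_form_off[OF assms] by blast
  qed
  then show "integrable (lebesgue_on (interior E)) (\<lambda>x. divergence \<Omega> (\<tau> j) x \<bullet> u)"
    "integrable (lebesgue_on (interior E)) (\<lambda>x. \<tau> j x \<bullet> S)" by blast+
qed

text \<open>The weights at the four vertices of a facet determine an affine function on it, and a skew
  matrix vanishing on two independent directions is zero.\<close>

lemma elem_form_facet_zero:
  assumes E: "E \<in> T" "f facet_of E" "\<not> f \<subseteq> \<Gamma>N" and S: "transpose S = - S"
    and form: "\<And>j. dof_face (d j) = f \<Longrightarrow> elem_form E j u S = 0"
  shows "u = 0 \<and> S = 0"
proof -
  obtain i s where s: "s \<in> {0, 1}" and f: "f = elem_face E (r E) i s"
    using facet_of_cuboidE[OF cub[OF E(1)] E(2)] by blast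
  \<comment> \<open>The corner \<open>P i\<close> has all tangential coordinates 0; for
    \<open>t\<close> different from \<open>i\<close>, \<open>P t\<close> is its neighbour along the
    edge \<open>t\<close>.\<close>
  define P where "P t = elem_map (r E) (\<chi> l. if l = i then s else if l = t then 1 else 0)" for t
  have Pc: "coord (r E) l (P t) = (if l = i then s else if l = t then 1 else 0)" for l t
    by (simp add: P_def coord_elem_map[OF cub[OF E(1)]])
  have eq: "(2 * s - 1) / 4 * u $ k + (\<Sum>l\<in>UNIV. corner_weight E i (P t) l * (S $ k \<bullet> edge (r E) l)) = 0" for t k
  proof -
    have c: "\<forall>l. coord (r E) l (P t) \<in> {0, 1}" "coord (r E) i (P t) = s" using s by (auto simp: Pc)
    have "P t extreme_point_of f"
      unfolding f using extreme_point_of_elem_face_iff[OF cub[OF E(1)] s] c by blast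
    then have "(f, P t, k) \<in> dofs T \<Gamma>N" using E by (auto simp: dofs_def mesh_faces_def)
    then obtain j where j: "d j = (f, P t, k)" using dof_surj by blast
    obtain b where "b \<noteq> 0" "elem_form E j u S = b * ((2 * coord (r E) i (P t) - 1) / 4 * u $ k +
      (\<Sum>l\<in>UNIV. corner_weight E i (P t) l * (S $ k \<bullet> edge (r E) l)))"
      by (rule elem_form_on[OF E(1,2) j _ c(1), where i = i and u = u and S = S]) (simp add: f c)
    then show ?thesis using form[of j] j by (simp add: dof_face_def c(2))
  qed
  have "S *v edge (r E) t = 0" if t: "t \<noteq> i" for t
  proof -
    have "S $ k \<bullet> edge (r E) t = 0" for k
    proof -
      \<comment> \<open>Between these two corners only the weight of the edge \<open>t\<close>
        changes, from -(2 s - 1) / 24 to (2 s - 1) / 24, so \<open>u\<close> and the other edges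
        cancel.\<close>
      have "(\<Sum>l\<in>UNIV. corner_weight E i (P t) l * (S $ k \<bullet> edge (r E) l))
          - (\<Sum>l\<in>UNIV. corner_weight E i (P i) l * (S $ k \<bullet> edge (r E) l))
        = (\<Sum>l\<in>UNIV. if l = t then (2 * s - 1) / 12 * (S $ k \<bullet> edge (r E) t) else 0)"
        unfolding sum_subtractf[symmetric]
        by (intro sum.cong refl) (use t in \<open>auto simp: corner_weight_def Pc field_simps\<close>)
      also have "\<dots> = (2 * s - 1) / 12 * (S $ k \<bullet> edge (r E) t)" by simp
      finally have "(2 * s - 1) / 12 * (S $ k \<bullet> edge (r E) t) = 0"
        using eq[of k t] eq[of k i] by linarith
      then show ?thesis using s by auto
    qed
    then show ?thesis by (simp add: vec_eq_iff matrix_component_inner)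
  qed
  then have "S = 0" using skew_matrix_zero[OF S cub[OF E(1)]] by blast
  moreover have "u $ k = 0" for k using eq[of k i] \<open>S = 0\<close> s by auto
  ultimately show ?thesis by (simp add: vec_eq_iff)
qed

lemma form_injective:
  assumes conn: "connected \<Omega>" and D: "\<Gamma>D \<noteq> {}"
    and S: "\<And>E. E \<in> T \<Longrightarrow> transpose (S E) = - S E"
    and form: "\<And>j. (\<Sum>E\<in>T. elem_form E j (u E) (S E)) = 0"
    and "E \<in> T"
  shows "u E = 0 \<and> S E = 0"
proof -
  have bd: "frontier \<Omega> = \<Gamma>D \<union> \<Gamma>N" "\<exists>F\<subseteq>mesh_faces T. \<Gamma>D = \<Union>F"
    "\<And>f. f \<in> mesh_faces T \<Longrightarrow> \<not> (f \<subseteq> \<Gamma>D \<and> f \<subseteq> \<Gamma>N)"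
    using boundary unfolding boundary_partition_def by blast+
  \<comment> \<open>For degrees of freedom on \<open>f\<close>, only elements with facet
    \<open>f\<close> contribute; once the others among them carry zero data, the summand of
    \<open>E\<close> vanishes by itself.\<close>
  have key: "u E = 0 \<and> S E = 0"
    if E: "E \<in> T" "f facet_of E" "\<not> f \<subseteq> \<Gamma>N"
      and others: "\<And>E'. E' \<in> T \<Longrightarrow> E' \<noteq> E \<Longrightarrow> f facet_of E' \<Longrightarrow> u E' = 0 \<and> S E' = 0" for E f
  proof (rule elem_form_facet_zero[OF E S[OF E(1)]])
    fix j assume j: "dof_face (d j) = f"
    have "elem_form E' j (u E') (S E') = 0" if "E' \<in> T - {E}" for E'
    proof (cases "f facet_of E'")
      case True
      then show ?thesis using others[of E'] that by (simp add: elem_form_def)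
    next
      case False
      then show ?thesis using elem_form_off(1) that j by blast
    qed
    then have "(\<Sum>E'\<in>T - {E}. elem_form E' j (u E') (S E')) = 0" by (intro sum.neutral) blast
    then show "elem_form E j (u E) (S E) = 0"
      using form[of j] sum.remove[OF finite_mesh[OF mesh] E(1), of "\<lambda>E. elem_form E j (u E) (S E)"] by simp
  qed
  obtain F where F: "F \<subseteq> mesh_faces T" "\<Gamma>D = \<Union>F" using bd(2) by blast
  then obtain f where f: "f \<in> F" using D by blast
  then have "f \<in> mesh_faces T" "f \<subseteq> \<Gamma>D" using F by blast+
  \<comment> \<open>A face of \<open>\<Gamma>D\<close> is no face of \<open>\<Gamma>N\<close>, so it
    carries degrees of freedom, and as a boundary face it belongs to a single element.\<close>
  then have fN: "\<not> f \<subseteq> \<Gamma>N" "f \<subseteq> frontier \<Omega>" using bd by blast+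
  obtain E0 where E0: "E0 \<in> T" "f facet_of E0"
    using \<open>f \<in> mesh_faces T\<close> unfolding mesh_faces_def by blast
  have start: "u E0 = 0 \<and> S E0 = 0"
    by (rule key[OF E0 fN(1)]) (use boundary_facet_unique[OF mesh normals E0 _ _ fN(2)] in blast)
  show ?thesis
  proof (rule mesh_facet_connected[where P = "\<lambda>E. u E = 0 \<and> S E = 0", OF mesh conn _ E0(1) start \<open>E \<in> T\<close>])
    fix E1 E2 f
    assume E: "E1 \<in> T" "E2 \<in> T" "u E1 = 0 \<and> S E1 = 0" "E1 \<noteq> E2" "f facet_of E1" "f facet_of E2"
    have "\<not> f \<subseteq> frontier \<Omega>"
      using boundary_facet_unique[OF mesh normals E(1,5,2,6)] E(4) by blast
    then have "\<not> f \<subseteq> \<Gamma>N" using bd(1) by blast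
    then show "u E2 = 0 \<and> S E2 = 0"
    proof (rule key[OF E(2,6)])
      fix E' assume "E' \<in> T" "E' \<noteq> E2" "f facet_of E'"
      then have "E' = E1"
        using facet_at_most_two[OF mesh normals E(2,1) _ E(6,5)] E(4) by blast
      then show "u E' = 0 \<and> S E' = 0" using E(3) by simp
    qed
  qed
qed

end

theorem mainTheorem2:
  fixes \<Omega> \<Gamma>D \<Gamma>N :: "vec3 set"
    and T :: "vec3 set set" and r :: "vec3 set \<Rightarrow> nat \<Rightarrow> vec3" and \<kappa> :: real
    and \<nu> :: "vec3 set \<Rightarrow> vec3"
    and A :: "vec3 \<Rightarrow> mat3 \<Rightarrow>\<^sub>L mat3"
    and d :: "'j::finite \<Rightarrow> dof" and \<tau> :: "'j \<Rightarrow> vec3 \<Rightarrow> mat3"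
    and v :: "'v::finite \<Rightarrow> vec3 \<Rightarrow> vec3"
    and w :: "'w::finite \<Rightarrow> vec3 \<Rightarrow> mat3"
    and A\<sigma>\<sigma> :: "real^'j^'j" and A\<sigma>u :: "real^'j^'v" and A\<sigma>\<gamma> :: "real^'j^'w"
  assumes domain: "open \<Omega>" "connected \<Omega>" "\<Omega> \<noteq> {}" "bounded \<Omega>" "simply_connected \<Omega>"
    and mesh: "conforming_cuboid_mesh \<Omega> T r" "shape_regular \<kappa> T" "unit_normals T \<nu>"
    and boundary: "boundary_partition \<Omega> T \<Gamma>D \<Gamma>N" "\<Gamma>D \<noteq> {}"
    and compliance: "compliance_tensor \<Omega> T A"
    and dof_numbering: "bij_betw d UNIV (dofs T \<Gamma>N)"
    and stress_basis: "L2_basis \<Omega> (X_space \<Omega> T r \<nu> \<Gamma>N) \<tau>" "dual_to_dofs T \<nu> d \<tau>"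
    and displacement_basis: "L2_basis \<Omega> (V_space T) v"
    and rotation_basis: "L2_basis \<Omega> (W_space T) w"
    and matrices:
      "A\<sigma>\<sigma> = (\<chi> i j. quad T r A (\<tau> j) (\<tau> i))"
      "A\<sigma>u = (\<chi> i j. L2_inner \<Omega> (divergence \<Omega> (\<tau> j)) (v i))"
      "A\<sigma>\<gamma> = (\<chi> i j. L2_inner \<Omega> (\<tau> j) (w i))"
  shows "(\<forall>i j. dof_vertex (d i) \<noteq> dof_vertex (d j) \<longrightarrow> A\<sigma>\<sigma> $ i $ j = 0) \<and>
         (\<forall>i. dof_vertex (d i) \<in> mesh_vertices T r) \<and>
         (\<forall>p\<in>mesh_vertices T r. sym_pos_def_on {i. dof_vertex (d i) = p} A\<sigma>\<sigma>) \<and>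
         (\<forall>p\<in>mesh_vertices T r. p \<in> \<Omega> \<longrightarrow> card {i. dof_vertex (d i) = p} = 36) \<and>
         invertible A\<sigma>\<sigma> \<and>
         sym_pos_def_on UNIV
           (block_matrix
              (A\<sigma>u ** matrix_inv A\<sigma>\<sigma> ** transpose A\<sigma>u) (A\<sigma>u ** matrix_inv A\<sigma>\<sigma> ** transpose A\<sigma>\<gamma>)
              (A\<sigma>\<gamma> ** matrix_inv A\<sigma>\<sigma> ** transpose A\<sigma>u) (A\<sigma>\<gamma> ** matrix_inv A\<sigma>\<sigma> ** transpose A\<sigma>\<gamma>))"
proof -
  interpret stress_basis \<Omega> \<Gamma>D \<Gamma>N T r \<nu> d \<tau>
    using mesh boundary dof_numbering stress_basis by unfold_locales (auto simp: L2_basis_def)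
  have spd: "sym_pos_def_on UNIV A\<sigma>\<sigma>"
    unfolding matrices(1) using compliance by (rule mass_matrix_sym_pos_def)
  have "y = 0 \<and> z = 0" if yz: "transpose A\<sigma>u *v y + transpose A\<sigma>\<gamma> *v z = 0" for y z
  proof -
    have "\<forall>i. \<forall>E\<in>T. \<exists>c. \<forall>x\<in>interior E. v i x = c"
      using displacement_basis by (auto simp: L2_basis_def V_space_def)
    then obtain V where V: "\<And>i E x. E \<in> T \<Longrightarrow> x \<in> interior E \<Longrightarrow> v i x = V i E" by metis
    have "\<forall>i. \<forall>E\<in>T. \<exists>S. transpose S = - S \<and> (\<forall>x\<in>interior E. w i x = S)"
      using rotation_basis by (auto simp: L2_basis_def W_space_def)
    then obtain W where W: "\<And>i E. E \<in> T \<Longrightarrow> transpose (W i E) = - W i E"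
        "\<And>i E x. E \<in> T \<Longrightarrow> x \<in> interior E \<Longrightarrow> w i x = W i E" by metis
    \<comment> \<open>The element-wise values of the displacement and rotation fields with
      coefficient vectors \<open>y\<close> and \<open>z\<close>.\<close>
    define u where "u E = (\<Sum>i\<in>UNIV. y $ i *\<^sub>R V i E)" for E
    define S where "S E = (\<Sum>i\<in>UNIV. z $ i *\<^sub>R W i E)" for E
    have skew: "transpose (S E) = - S E" if "E \<in> T" for E
    proof -
      have "W i E $ a $ b = - W i E $ b $ a" for i a b
        using arg_cong[OF W(1)[OF that, of i], of "\<lambda>M. M $ b $ a"] by (simp add: transpose_def)
      then have eq: "z $ i * W i E $ a $ b = - (z $ i * W i E $ b $ a)" for i a b
        by (metis mult_minus_right)
      have neg: "S E $ a $ b = - S E $ b $ a" for a b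
      proof -
        have "S E $ a $ b = (\<Sum>i\<in>UNIV. z $ i * W i E $ a $ b)" by (simp add: S_def)
        also have "\<dots> = (\<Sum>i\<in>UNIV. - (z $ i * W i E $ b $ a))" by (intro sum.cong refl eq)
        also have "\<dots> = - S E $ b $ a" by (simp add: S_def sum_negf)
        finally show ?thesis .
      qed
      have "transpose (S E) $ b $ a = (- S E) $ b $ a" for a b
        unfolding transpose_def vec_lambda_beta vector_uminus_component by (rule neg)
      then show ?thesis by (simp only: vec_eq_iff) blast
    qed
    have form: "(\<Sum>E\<in>T. elem_form E j (u E) (S E)) = 0" for j
    proof -
      have div: "L2_inner \<Omega> (divergence \<Omega> (\<tau> j)) (v i) =
          (\<Sum>E\<in>T. integral\<^sup>L (lebesgue_on (interior E)) (\<lambda>x. divergence \<Omega> (\<tau> j) x \<bullet> V i E))" for i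
        by (rule L2_inner_piecewise_constant[OF mesh(1) V elem_form_integrable(1)])
      have rot: "L2_inner \<Omega> (\<tau> j) (w i) =
          (\<Sum>E\<in>T. integral\<^sup>L (lebesgue_on (interior E)) (\<lambda>x. \<tau> j x \<bullet> W i E))" for i
        by (rule L2_inner_piecewise_constant[OF mesh(1) W(2) elem_form_integrable(2)])
      have "(\<Sum>E\<in>T. integral\<^sup>L (lebesgue_on (interior E)) (\<lambda>x. divergence \<Omega> (\<tau> j) x \<bullet> u E))
          = (\<Sum>E\<in>T. \<Sum>i\<in>UNIV. y $ i * integral\<^sup>L (lebesgue_on (interior E)) (\<lambda>x. divergence \<Omega> (\<tau> j) x \<bullet> V i E))"
        by (intro sum.cong refl)
           (simp add: u_def inner_sum_right Bochner_Integration.integral_sum elem_form_integrable)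
      also have "\<dots> = (\<Sum>i\<in>UNIV. y $ i * L2_inner \<Omega> (divergence \<Omega> (\<tau> j)) (v i))"
        unfolding div sum_distrib_left by (rule sum.swap)
      finally have 1: "(\<Sum>E\<in>T. integral\<^sup>L (lebesgue_on (interior E)) (\<lambda>x. divergence \<Omega> (\<tau> j) x \<bullet> u E))
          = (transpose A\<sigma>u *v y) $ j"
        by (simp add: matrices(2) matrix_vector_mult_def transpose_def mult.commute)
      have "(\<Sum>E\<in>T. integral\<^sup>L (lebesgue_on (interior E)) (\<lambda>x. \<tau> j x \<bullet> S E))
          = (\<Sum>E\<in>T. \<Sum>i\<in>UNIV. z $ i * integral\<^sup>L (lebesgue_on (interior E)) (\<lambda>x. \<tau> j x \<bullet> W i E))"
        by (intro sum.cong refl)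
           (simp add: S_def inner_sum_right Bochner_Integration.integral_sum elem_form_integrable)
      also have "\<dots> = (\<Sum>i\<in>UNIV. z $ i * L2_inner \<Omega> (\<tau> j) (w i))"
        unfolding rot sum_distrib_left by (rule sum.swap)
      finally have 2: "(\<Sum>E\<in>T. integral\<^sup>L (lebesgue_on (interior E)) (\<lambda>x. \<tau> j x \<bullet> S E))
          = (transpose A\<sigma>\<gamma> *v z) $ j"
        by (simp add: matrices(3) matrix_vector_mult_def transpose_def mult.commute)
      have "(transpose A\<sigma>u *v y) $ j + (transpose A\<sigma>\<gamma> *v z) $ j = 0"
        using arg_cong[OF yz, of "\<lambda>t. t $ j"] by simp
      then show ?thesis by (simp add: elem_form_def sum.distrib 1 2)
    qed
    have zero: "u E = 0 \<and> S E = 0" if "E \<in> T" for E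
      by (rule form_injective[OF domain(2) \<open>\<Gamma>D \<noteq> {}\<close> skew form that])
    \<comment> \<open>Linear independence of the two bases leads back from vanishing fields to
      vanishing coefficients.\<close>
    have "y = 0"
    proof (rule L2_basis_combination_zero[OF mesh(1) displacement_basis])
      show "(\<Sum>i\<in>UNIV. y $ i *\<^sub>R v i x) = 0" if "E \<in> T" "x \<in> interior E" for E x
        using zero[OF that(1)] V[OF that] by (simp add: u_def)
    qed (auto simp: V_space_def)
    moreover have "z = 0"
    proof (rule L2_basis_combination_zero[OF mesh(1) rotation_basis])
      show "(\<Sum>i\<in>UNIV. z $ i *\<^sub>R w i x) = 0" if "E \<in> T" "x \<in> interior E" for E x
        using zero[OF that(1)] W(2)[OF that] by (simp add: S_def)
      have "transpose (0 :: mat3) = - 0" by (simp add: transpose_def vec_eq_iff)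
      then show "(\<lambda>x. 0) \<in> W_space T" unfolding W_space_def by blast
    qed
    ultimately show ?thesis by simp
  qed
  then have "sym_pos_def_on UNIV
           (block_matrix
              (A\<sigma>u ** matrix_inv A\<sigma>\<sigma> ** transpose A\<sigma>u) (A\<sigma>u ** matrix_inv A\<sigma>\<sigma> ** transpose A\<sigma>\<gamma>)
              (A\<sigma>\<gamma> ** matrix_inv A\<sigma>\<sigma> ** transpose A\<sigma>u) (A\<sigma>\<gamma> ** matrix_inv A\<sigma>\<sigma> ** transpose A\<sigma>\<gamma>))"
    by (rule sym_pos_def_schur[OF spd])
  then show ?thesis
    using quad_off_block dof_vertex_mesh card_interior_vertex_dofs sym_pos_def_on_subset[OF spd]
      sym_pos_def_invertible[OF spd] by (auto simp: matrices(1))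
qed

end
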